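(* Let $W$ be an affine Weyl group, let $u\in W$ be a translation with associated vector $\vec u$, let $M=\ell(u)$, let $\mathrm{Orb}_\Omega(\vec u)=\{\vec u_1=\vec u,\dots,\vec u_n\}$, and for $1\leq i\leq n$ let $u_i\in W$ be the element with $u_iA_0=A_0t_{\vec u_i}$. Let $z,z'\in W$, $r\in\mathbb{N}^*$ and $i,j\in\{1,\dots,n\}$ be such that $z.u_i^r$ and $z'.u_j^r$. Let $N=\ell(z')-\ell(z)$. If $r>N(M+1)$, then for any $k\geq 0$ we have $$\mathbf{P}_{z.u_i^r,\,z'.u_j^r}=\mathbf{P}_{z.u_i^{r+k},\,z'.u_j^{r+k}},$$ and if $s\in S$ satisfies $sz u_i^r<z u_i^r<z' u_j^r<sz' u_j^r$, then $$\mathbf{M}^s_{z.u_i^r,\,z'.u_j^r}=\mathbf{M}^s_{z.u_i^{r+k},\,z'.u_j^{r+k}}.$$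
   Context: Affine Weyl group. $V$ is a Euclidean space of finite dimension $\geq 1$, $\Phi\subset V$ an irreducible root system of rank $\dim V$, $\Phi^+$ a fixed set of positive roots, $\check\alpha\in V^*$ the coroot of $\alpha$, and $\langle x,y\rangle$ the value of $y\in V^*$ at $x\in V$. For $\alpha\in\Phi$, $k\in\mathbb{Z}$, $H_{\alpha,k}=\{x\in V\mid\langle x,\check\alpha\rangle=k\}$, and $\mathcal{F}=\{H_{\alpha,k}\mid\alpha\in\Phi^+,k\in\mathbb{Z}\}$. $\Omega$ is the group of affine transformations generated by the orthogonal reflections in the hyperplanes of $\mathcal{F}$, regarded as acting on $V$ on the right. Alcoves are the connected components of $V-\bigcup_{H\in\mathcal{F}}H$; $\Omega$ acts simply transitively on the set $X$ of alcoves. $S$ is the set of $\Omega$-orbits of faces (codimension 1 facets) of alcoves. For $s\in S$ and $A\in X$, $sA$ is the unique alcove distinct from $A$ sharing with $A$ a face of type $s$. The maps $A\mapsto sA$ generate a Coxeter group $(W,S)$, the affine Weyl group, which acts on $X$ on the left simply transitively and commutes with $\Omega$. $\ell$ is its length function, $\leq$ its Bruhat order. The fundamental alcove is $A_0=\{x\in V\mid 0<\langle x,\check\alpha\rangle<1\text{ for all }\alpha\in\Phi^+\}$. $\mathbb{N}=\{0,1,2,\dots\}$, $\mathbb{N}^*=\mathbb{N}\setminus\{0\}$. Dot notation. The notation $x.y$ denotes the product $xy$ and asserts that $\ell(xy)=\ell(x)+\ell(y)$ (similarly for more factors). (If $r\geq1$ and $z.u_i^r$, then also $z.u_i^{r+k}$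 for $k\geq0$.) Translations. $u\in W$ is a translation if there is a vector $\vec u\neq0$ such that $t_{\vec u}$, the translation by $\vec u$, lies in $\Omega$ and $uA_0=A_0t_{\vec u}$. $\mathrm{Orb}_\Omega(\vec u)$ is the (finite) orbit of $\vec u$ under the group of linear parts of elements of $\Omega$; its elements $\vec u_1,\dots,\vec u_n$ are pairwise distinct. Kazhdan-Lusztig polynomials. $\Gamma$ is an abelian group written multiplicatively, $\mathbf{A}=\mathbb{Z}[\Gamma]$, and $\{v_s\mid s\in S\}\subset\Gamma$ satisfies $v_s=v_t$ whenever $s,t$ are conjugate in $W$. $\mathbf{H}$ is the Iwahori-Hecke algebra with $\mathbf{A}$-basis $\{\mathbf{T}_w\mid w\in W\}$ and $\mathbf{T}_s\mathbf{T}_w=\mathbf{T}_{sw}$ if $\ell(sw)>\ell(w)$, $\mathbf{T}_s\mathbf{T}_w=\mathbf{T}_{sw}+(v_s-v_s^{-1})\mathbf{T}_w$ if $\ell(sw)<\ell(w)$. The involution $\bar{}$ of $\mathbf{A}$ with $\bar g=g^{-1}$ ($g\in\Gamma$) extends to the ring involution $\overline{\sum a_w\mathbf{T}_w}=\sum\bar a_w\mathbf{T}_{w^{-1}}^{-1}$ of $\mathbf{H}$. A total ordering of $\Gamma$ is fixed, given by a multiplicatively closed subset $\Gamma_+\subset\Gamma-\{1\}$ with $\Gamma=\Gamma_+\sqcup\{1\}\sqcup\Gamma_-$, $\Gamma_-=\{g^{-1}\mid g\in\Gamma_+\}$, and $v_s\in\Gamma_+$ for all $s\in S$. For $w\in W$,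 $\mathbf{C}_w$ is the unique element of $\mathbf{H}$ with $\overline{\mathbf{C}_w}=\mathbf{C}_w$ and $\mathbf{C}_w=\mathbf{T}_w+\sum_{y<w}\mathbf{P}_{y,w}\mathbf{T}_y$ with $\mathbf{P}_{y,w}\in\mathbb{Z}[\Gamma_-]$ (integer combinations of elements of $\Gamma_-$); also $\mathbf{P}_{y,y}=1$ and $\mathbf{P}_{y,w}=0$ if $y\not\leq w$. For $s\in S$ and $w<sw$, the elements $\mathbf{M}^s_{z,w}\in\mathbb{Z}[\Gamma]$ (for $sz<z<w<sw$) are defined by $\mathbf{C}_s\mathbf{C}_w=\mathbf{C}_{sw}+\sum_{z;\,sz<z<w}\mathbf{M}^s_{z,w}\mathbf{C}_z$. *)

theory Defs
  imports "HOL-Analysis.Analysis" "HOL-Algebra.Algebra" "HOL-Library.Poly_Mapping"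
begin

section \<open>Root systems\<close>

text \<open>\<open>coroot_eval \<alpha> x\<close> is the value at \<open>x\<close> of the coroot of \<open>\<alpha>\<close>. Root systems are not
  required to be reduced.\<close>

definition coroot_eval :: "'a::real_inner \<Rightarrow> 'a \<Rightarrow> real" where
  "coroot_eval \<alpha> x = 2 * (x \<bullet> \<alpha>) / (\<alpha> \<bullet> \<alpha>)"

definition root_system :: "'a::euclidean_space set \<Rightarrow> bool" where
  "root_system \<Phi> \<longleftrightarrow> finite \<Phi> \<and> 0 \<notin> \<Phi> \<and> span \<Phi> = UNIV \<and>
    (\<forall>\<alpha>\<in>\<Phi>. \<forall>\<beta>\<in>\<Phi>. \<beta> - coroot_eval \<alpha> \<beta> *\<^sub>R \<alpha> \<in> \<Phi> \<and> coroot_eval \<alpha> \<beta> \<in> \<int>)"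

definition irreducible_root_system :: "'a::euclidean_space set \<Rightarrow> bool" where
  "irreducible_root_system \<Phi> \<longleftrightarrow> root_system \<Phi> \<and> \<Phi> \<noteq> {} \<and>
    \<not> (\<exists>\<Phi>1 \<Phi>2. \<Phi>1 \<noteq> {} \<and> \<Phi>2 \<noteq> {} \<and> \<Phi> = \<Phi>1 \<union> \<Phi>2 \<and> \<Phi>1 \<inter> \<Phi>2 = {} \<and>
         (\<forall>\<alpha>\<in>\<Phi>1. \<forall>\<beta>\<in>\<Phi>2. \<alpha> \<bullet> \<beta> = 0))"

definition positive_roots :: "'a::euclidean_space set \<Rightarrow> 'a set \<Rightarrow> bool" where
  "positive_roots \<Phi> \<Phi>p \<longleftrightarrow>
    (\<exists>\<xi>. (\<forall>\<alpha>\<in>\<Phi>. \<alpha> \<bullet> \<xi> \<noteq> 0) \<and> \<Phi>p = {\<alpha> \<in> \<Phi>. 0 < \<alpha> \<bullet> \<xi>})"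

section \<open>Alcoves and the affine Weyl group\<close>

definition affine_hyperplane :: "'a::euclidean_space \<Rightarrow> int \<Rightarrow> 'a set" where
  "affine_hyperplane \<alpha> k = {x. coroot_eval \<alpha> x = of_int k}"

definition hyperplanes :: "'a::euclidean_space set \<Rightarrow> 'a set set" where
  "hyperplanes \<Phi>p = {affine_hyperplane \<alpha> k | \<alpha> k. \<alpha> \<in> \<Phi>p}"

definition affine_reflection :: "'a::euclidean_space \<Rightarrow> int \<Rightarrow> 'a \<Rightarrow> 'a" where
  "affine_reflection \<alpha> k x = x - (coroot_eval \<alpha> x - of_int k) *\<^sub>R \<alpha>"

text \<open>Elements of \<open>\<Omega>\<close> are functions, so the right action \<open>A \<sigma>\<close> on subsets is the image
  \<open>\<sigma> ` A\<close>. That \<open>BijGroup\<close> composes maps in the opposite order does not affect the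
  underlying set.\<close>

definition Omega :: "'a::euclidean_space set \<Rightarrow> ('a \<Rightarrow> 'a) set" where
  "Omega \<Phi>p = generate (BijGroup UNIV) {affine_reflection \<alpha> k | \<alpha> k. \<alpha> \<in> \<Phi>p}"

definition alcoves :: "'a::euclidean_space set \<Rightarrow> 'a set set" where
  "alcoves \<Phi>p = components (UNIV - \<Union> (hyperplanes \<Phi>p))"

text \<open>Two points lie in the same facet iff, for every hyperplane \<open>H\<close>, both lie on \<open>H\<close> or
  both lie strictly on the same side of \<open>H\<close>.\<close>

definition facets :: "'a::euclidean_space set \<Rightarrow> 'a set set" where
  "facets \<Phi>p = UNIV // {(x, y). \<forall>\<alpha>\<in>\<Phi>p. \<forall>k::int.
     sgn (coroot_eval \<alpha> x - of_int k) = sgn (coroot_eval \<alpha> y - of_int k)}"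

definition face_of_alcove :: "'a::euclidean_space set \<Rightarrow> 'a set \<Rightarrow> 'a set \<Rightarrow> bool" where
  "face_of_alcove \<Phi>p f A \<longleftrightarrow> A \<in> alcoves \<Phi>p \<and> f \<in> facets \<Phi>p \<and>
     aff_dim f = int DIM('a) - 1 \<and> f \<subseteq> closure A"

definition face_types :: "'a::euclidean_space set \<Rightarrow> 'a set set set" where
  "face_types \<Phi>p = {{\<sigma> ` f | \<sigma>. \<sigma> \<in> Omega \<Phi>p} | f. \<exists>A. face_of_alcove \<Phi>p f A}"

definition cross_face ::
  "'a::euclidean_space set \<Rightarrow> 'a set set \<Rightarrow> 'a set \<Rightarrow> 'a set" where
  "cross_face \<Phi>p s = (\<lambda>A \<in> alcoves \<Phi>p.
     THE B. B \<noteq> A \<and> (\<exists>f\<in>s. face_of_alcove \<Phi>p f A \<and> face_of_alcove \<Phi>p f B))"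

text \<open>A face type \<open>s\<close> is identified with the permutation \<open>A \<mapsto> sA\<close> of the set of alcoves;
  \<open>W\<close> is a group of such permutations, so that \<open>w A\<close> is function application.\<close>

definition affine_gens :: "'a::euclidean_space set \<Rightarrow> ('a set \<Rightarrow> 'a set) set" where
  "affine_gens \<Phi>p = cross_face \<Phi>p ` face_types \<Phi>p"

definition affine_weyl_group :: "'a::euclidean_space set \<Rightarrow> ('a set \<Rightarrow> 'a set) monoid" where
  "affine_weyl_group \<Phi>p = subgroup_generated (BijGroup (alcoves \<Phi>p)) (affine_gens \<Phi>p)"

definition fundamental_alcove :: "'a::euclidean_space set \<Rightarrow> 'a set" where
  "fundamental_alcove \<Phi>p = {x. \<forall>\<alpha>\<in>\<Phi>p. 0 < coroot_eval \<alpha> x \<and> coroot_eval \<alpha> x < 1}"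

definition translate :: "'a::euclidean_space \<Rightarrow> 'a \<Rightarrow> 'a" where
  "translate d x = x + d"

definition translation_with ::
  "'a::euclidean_space set \<Rightarrow> ('a set \<Rightarrow> 'a set) \<Rightarrow> 'a \<Rightarrow> bool" where
  "translation_with \<Phi>p u d \<longleftrightarrow> u \<in> carrier (affine_weyl_group \<Phi>p) \<and> d \<noteq> 0 \<and>
     translate d \<in> Omega \<Phi>p \<and>
     u (fundamental_alcove \<Phi>p) = translate d ` fundamental_alcove \<Phi>p"

text \<open>The linear part of an affine map \<open>\<sigma>\<close> is \<open>x \<mapsto> \<sigma> x - \<sigma> 0\<close>.\<close>

definition linear_orbit :: "'a::euclidean_space set \<Rightarrow> 'a \<Rightarrow> 'a set" where
  "linear_orbit \<Phi>p d = {\<sigma> d - \<sigma> 0 | \<sigma>. \<sigma> \<in> Omega \<Phi>p}"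

section \<open>Length and Bruhat order\<close>

definition word_length :: "('w, 'm) monoid_scheme \<Rightarrow> 'w set \<Rightarrow> 'w \<Rightarrow> nat" where
  "word_length W S w =
     (LEAST n. \<exists>ss. length ss = n \<and> set ss \<subseteq> S \<and> w = foldr (\<otimes>\<^bsub>W\<^esub>) ss \<one>\<^bsub>W\<^esub>)"

definition reflections_of :: "('w, 'm) monoid_scheme \<Rightarrow> 'w set \<Rightarrow> 'w set" where
  "reflections_of W S = {w \<otimes>\<^bsub>W\<^esub> s \<otimes>\<^bsub>W\<^esub> inv\<^bsub>W\<^esub> w | w s. w \<in> carrier W \<and> s \<in> S}"

definition bruhat_step :: "('w, 'm) monoid_scheme \<Rightarrow> 'w set \<Rightarrow> 'w \<Rightarrow> 'w \<Rightarrow> bool" where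
  "bruhat_step W S x y \<longleftrightarrow> x \<in> carrier W \<and> (\<exists>t\<in>reflections_of W S. y = t \<otimes>\<^bsub>W\<^esub> x) \<and>
     word_length W S x < word_length W S y"

definition bruhat_less :: "('w, 'm) monoid_scheme \<Rightarrow> 'w set \<Rightarrow> 'w \<Rightarrow> 'w \<Rightarrow> bool" where
  "bruhat_less W S = (bruhat_step W S)\<^sup>+\<^sup>+"

text \<open>\<open>dotted W S x y\<close> is the assertion made by writing the product \<open>xy\<close> as \<open>x.y\<close>.\<close>

definition dotted :: "('w, 'm) monoid_scheme \<Rightarrow> 'w set \<Rightarrow> 'w \<Rightarrow> 'w \<Rightarrow> bool" where
  "dotted W S x y \<longleftrightarrow>
     word_length W S (x \<otimes>\<^bsub>W\<^esub> y) = word_length W S x + word_length W S y"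

section \<open>Hecke algebras and Kazhdan-Lusztig polynomials\<close>

text \<open>The abelian group \<open>\<Gamma>\<close> is a type \<open>'g\<close> written additively, since the group ring
  \<open>\<int>[\<Gamma>]\<close> is then \<open>'g \<Rightarrow>\<^sub>0 int\<close> with its library multiplication. A set \<open>\<Gamma>p\<close> plays the
  role of \<open>\<Gamma>\<^sub>+\<close>, and \<open>uminus ` \<Gamma>p\<close> that of \<open>\<Gamma>\<^sub>-\<close>.\<close>

definition positive_cone :: "'g::ab_group_add set \<Rightarrow> bool" where
  "positive_cone \<Gamma>p \<longleftrightarrow> (\<forall>g\<in>\<Gamma>p. \<forall>h\<in>\<Gamma>p. g + h \<in> \<Gamma>p) \<and> 0 \<notin> \<Gamma>p \<and>
     \<Gamma>p \<inter> uminus ` \<Gamma>p = {} \<and> \<Gamma>p \<union> {0} \<union> uminus ` \<Gamma>p = UNIV"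

definition positive_weights ::
  "('w, 'm) monoid_scheme \<Rightarrow> 'w set \<Rightarrow> 'g::ab_group_add set \<Rightarrow> ('w \<Rightarrow> 'g) \<Rightarrow> bool" where
  "positive_weights W S \<Gamma>p v \<longleftrightarrow> (\<forall>s\<in>S. v s \<in> \<Gamma>p) \<and>
     (\<forall>s\<in>S. \<forall>t\<in>S. (\<exists>w\<in>carrier W. t = w \<otimes>\<^bsub>W\<^esub> s \<otimes>\<^bsub>W\<^esub> inv\<^bsub>W\<^esub> w) \<longrightarrow> v s = v t)"

type_synonym 'g group_ring = "'g \<Rightarrow>\<^sub>0 int"

definition group_elem :: "'g::ab_group_add \<Rightarrow> 'g group_ring" where
  "group_elem g = Poly_Mapping.single g 1"

definition ring_bar :: "'g::ab_group_add group_ring \<Rightarrow> 'g group_ring" where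
  "ring_bar a = Poly_Mapping.map_key uminus a"

text \<open>Elements of the Hecke algebra are written in coordinates with respect to the basis
  \<open>T\<^sub>w\<close>, \<open>w \<in> W\<close>.\<close>

type_synonym ('w, 'g) hecke = "'w \<Rightarrow>\<^sub>0 'g group_ring"

definition hecke_T :: "'w \<Rightarrow> ('w, 'g::ab_group_add) hecke" where
  "hecke_T w = Poly_Mapping.single w 1"

definition hecke_scale ::
  "'g::ab_group_add group_ring \<Rightarrow> ('w, 'g) hecke \<Rightarrow> ('w, 'g) hecke" where
  "hecke_scale a h = Poly_Mapping.map (\<lambda>b. a * b) h"

text \<open>\<open>\<H>\<close> is the Hecke algebra of \<open>(W, S)\<close>: the free \<open>\<int>[\<Gamma>]\<close>-module on the \<open>T\<^sub>w\<close> with an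
  associative bilinear product, unit \<open>T\<^sub>1\<close>, satisfying the defining relations. These determine
  the product, and hence \<open>\<H>\<close> on its carrier, uniquely.\<close>

definition hecke_algebra ::
  "('w, 'm) monoid_scheme \<Rightarrow> 'w set \<Rightarrow> ('w \<Rightarrow> 'g::ab_group_add) \<Rightarrow>
     ('w, 'g) hecke ring \<Rightarrow> bool" where
  "hecke_algebra W S v \<H> \<longleftrightarrow> ring \<H> \<and>
     carrier \<H> = {h. Poly_Mapping.keys h \<subseteq> carrier W} \<and>
     (\<forall>h\<in>carrier \<H>. \<forall>h'\<in>carrier \<H>. h \<oplus>\<^bsub>\<H>\<^esub> h' = h + h') \<and>
     \<one>\<^bsub>\<H>\<^esub> = hecke_T \<one>\<^bsub>W\<^esub> \<and>
     (\<forall>a. \<forall>h\<in>carrier \<H>. \<forall>h'\<in>carrier \<H>.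
        hecke_scale a h \<otimes>\<^bsub>\<H>\<^esub> h' = hecke_scale a (h \<otimes>\<^bsub>\<H>\<^esub> h') \<and>
        h \<otimes>\<^bsub>\<H>\<^esub> hecke_scale a h' = hecke_scale a (h \<otimes>\<^bsub>\<H>\<^esub> h')) \<and>
     (\<forall>s\<in>S. \<forall>w\<in>carrier W.
        (word_length W S w < word_length W S (s \<otimes>\<^bsub>W\<^esub> w) \<longrightarrow>
           hecke_T s \<otimes>\<^bsub>\<H>\<^esub> hecke_T w = hecke_T (s \<otimes>\<^bsub>W\<^esub> w)) \<and>
        (word_length W S (s \<otimes>\<^bsub>W\<^esub> w) < word_length W S w \<longrightarrow>
           hecke_T s \<otimes>\<^bsub>\<H>\<^esub> hecke_T w =
             hecke_T (s \<otimes>\<^bsub>W\<^esub> w) +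
             hecke_scale (group_elem (v s) - group_elem (- v s)) (hecke_T w)))"

definition hecke_bar ::
  "('w, 'm) monoid_scheme \<Rightarrow> ('w, 'g::ab_group_add) hecke ring \<Rightarrow>
     ('w, 'g) hecke \<Rightarrow> ('w, 'g) hecke" where
  "hecke_bar W \<H> h = (\<Sum>w\<in>Poly_Mapping.keys h.
     hecke_scale (ring_bar (Poly_Mapping.lookup h w)) (inv\<^bsub>\<H>\<^esub> (hecke_T (inv\<^bsub>W\<^esub> w))))"

definition kl_C ::
  "('w, 'm) monoid_scheme \<Rightarrow> 'w set \<Rightarrow> 'g::ab_group_add set \<Rightarrow>
     ('w, 'g) hecke ring \<Rightarrow> 'w \<Rightarrow> ('w, 'g) hecke" where
  "kl_C W S \<Gamma>p \<H> w = (THE c. c \<in> carrier \<H> \<and> hecke_bar W \<H> c = c \<and>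
     (\<exists>p. (\<forall>y. Poly_Mapping.keys (p y) \<subseteq> uminus ` \<Gamma>p) \<and>
        c = hecke_T w + (\<Sum>y | bruhat_less W S y w. hecke_scale (p y) (hecke_T y))))"

definition kl_P ::
  "('w, 'm) monoid_scheme \<Rightarrow> 'w set \<Rightarrow> 'g::ab_group_add set \<Rightarrow>
     ('w, 'g) hecke ring \<Rightarrow> 'w \<Rightarrow> 'w \<Rightarrow> 'g group_ring" where
  "kl_P W S \<Gamma>p \<H> y w = Poly_Mapping.lookup (kl_C W S \<Gamma>p \<H> w) y"

text \<open>The elements \<open>M\<^sup>s\<^sub>z\<^sub>,\<^sub>w\<close> are characterised by the expansion below when \<open>w < sw\<close>; then
  \<open>M\<^sup>s\<^sub>z\<^sub>,\<^sub>w = 0\<close> by convention unless \<open>sz < z < w\<close>.\<close>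

definition kl_M ::
  "('w, 'm) monoid_scheme \<Rightarrow> 'w set \<Rightarrow> 'g::ab_group_add set \<Rightarrow>
     ('w, 'g) hecke ring \<Rightarrow> 'w \<Rightarrow> 'w \<Rightarrow> 'w \<Rightarrow> 'g group_ring" where
  "kl_M W S \<Gamma>p \<H> s z w =
     (let I = {y \<in> carrier W. bruhat_less W S (s \<otimes>\<^bsub>W\<^esub> y) y \<and> bruhat_less W S y w} in
      (THE m. (\<forall>y. y \<notin> I \<longrightarrow> m y = 0) \<and>
         kl_C W S \<Gamma>p \<H> s \<otimes>\<^bsub>\<H>\<^esub> kl_C W S \<Gamma>p \<H> w =
           kl_C W S \<Gamma>p \<H> (s \<otimes>\<^bsub>W\<^esub> w) + (\<Sum>y\<in>I. hecke_scale (m y) (kl_C W S \<Gamma>p \<H> y))) z)"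

end

theory Submission
  imports Defs
begin

text \<open>Write \<open>x \<in> E(u,r)\<close> (\<open>deep u r x\<close> below) if \<open>x = z.u\<^sup>r\<close>, where \<open>u\<close> ranges over the conjugacy class of the given
  translation. For \<open>r \<ge> 1\<close> the element \<open>u\<close> is determined by \<open>x\<close>, so that \<open>x \<mapsto> x u\<^sup>k\<close> is a well defined map \<open>shift k\<close>; it
  commutes with multiplication by generators on both sides and preserves descents as long as the depth \<open>r\<close> stays
  positive. The coefficients of \<open>bar T\<^sub>w\<close> satisfy a recursion that removes a last letter of \<open>w\<close>. Removing in this way
  a whole block \<open>u\<close> of \<open>w \<in> E(u,r)\<close> either lowers the difference of lengths, at the cost of at most \<open>M\<close> units of depth,
  or shows that both arguments belong to the same \<open>u\<close>, in which case invariance under \<open>shift k\<close> is immediate.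
  By the subword property an element \<open>N\<close> steps below \<open>w \<in> E(u,r)\<close> has depth at least \<open>r - N\<close>, so \<open>r - N > N M\<close> suffices for
  all coefficients in the relation \<open>P\<^sub>x\<^sub>,\<^sub>w - bar P\<^sub>x\<^sub>,\<^sub>w = \<Sum>\<^sub>x\<^sub><\<^sub>y bar P\<^sub>y\<^sub>,\<^sub>w r\<^sub>x\<^sub>,\<^sub>y\<close> to be shift invariant. This relation determines
  \<open>P\<^sub>x\<^sub>,\<^sub>w\<close> by induction, and \<open>M\<^sup>s\<^sub>x\<^sub>,\<^sub>w\<close> is treated in the same way.

  The group \<open>W\<close> is identified with \<open>\<Omega>\<close> through \<open>w A\<^sub>0 = A\<^sub>0 \<sigma>\<close>. The length of \<open>w\<close> is the number of hyperplanes separating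
  \<open>A\<^sub>0\<close> from \<open>w A\<^sub>0\<close>; since the translation by \<open>d\<close> moves all points the same integral distance transversally to each family
  of parallel hyperplanes, conditions of the form \<open>z.u\<close> become conditions on signs.\<close>


section \<open>Coxeter groups and the Bruhat order\<close>

text \<open>It is not known that \<open>shift k\<close> maps Bruhat intervals to Bruhat intervals,
  and the argument avoids the question. The recursions for \<open>P\<close> and \<open>Mu\<close>
  are summed over the sets \<open>layer\<close>, described by length and depth alone, on which
  \<open>shift k\<close> is visibly a bijection. They contain the relevant part of the interval
  below w, and the surplus terms vanish. The limiting factor is that depth 0 carries no information:
  it determines no u, so that \<open>shift k\<close> has no meaning there. Hence each induction
  keeps account of a depth that has to remain positive, and of x only the depth forced by its
  distance from w is assumed.

  The algebra is done for abstract groups, in the locales \<open>coxeter\<close> and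
  \<open>translation_class\<close>, whose assumptions are read off from hyperplanes. Since
  \<open>kl_C\<close> and \<open>kl_M\<close> are definite descriptions, existence and uniqueness of
  the objects described come first. For weights in an ordered group the corrections in this
  construction are bar-invariant elements of the group ring rather than integers.\<close>

context group begin

text \<open>The side is chosen so that a right factor moves to the left past u at the price of
  conjugating it: \<open>u \<otimes> b = b \<otimes> conj_by b u\<close>.\<close>

definition conj_by where "conj_by b u = inv b \<otimes> u \<otimes> b"

lemma conj_by_closed [simp]: "\<lbrakk>b \<in> carrier G; u \<in> carrier G\<rbrakk> \<Longrightarrow> conj_by b u \<in> carrier G"
  by (simp add: conj_by_def)

lemma inv_mult_cancel [simp]:
  "\<lbrakk>x \<in> carrier G; y \<in> carrier G\<rbrakk> \<Longrightarrow> inv x \<otimes> (x \<otimes> y) = y"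
  "\<lbrakk>x \<in> carrier G; y \<in> carrier G\<rbrakk> \<Longrightarrow> x \<otimes> (inv x \<otimes> y) = y"
  by (simp_all add: m_assoc[symmetric])

lemma conj_by_mult: "\<lbrakk>a \<in> carrier G; b \<in> carrier G; u \<in> carrier G\<rbrakk> \<Longrightarrow> conj_by (a \<otimes> b) u = conj_by b (conj_by a u)"
  by (simp add: conj_by_def m_assoc inv_mult_group)

lemma conj_by_one [simp]: "u \<in> carrier G \<Longrightarrow> conj_by \<one> u = u"
  by (simp add: conj_by_def)

lemma conj_by_self [simp]: "u \<in> carrier G \<Longrightarrow> conj_by u u = u"
  by (simp add: conj_by_def)

lemma pow_conj_by:
  assumes "b \<in> carrier G" "u \<in> carrier G"
  shows "u [^] (n::nat) \<otimes> b = b \<otimes> conj_by b u [^] n"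
proof (induction n)
  case (Suc n)
  have "u [^] Suc n \<otimes> b = u [^] n \<otimes> b \<otimes> conj_by b u" 
    using assms by (simp add: conj_by_def m_assoc)
  also have "\<dots> = b \<otimes> conj_by b u [^] Suc n" using Suc assms by (simp add: m_assoc)
  finally show ?case .
qed (use assms in simp)

lemma mult_pow_conj_by:
  assumes "b \<in> carrier G" "u \<in> carrier G" "x \<in> carrier G"
  shows "x \<otimes> b \<otimes> conj_by b u [^] (n::nat) = x \<otimes> u [^] n \<otimes> b"
  using pow_conj_by[OF assms(1,2), of n] assms by (simp add: m_assoc)

end

text \<open>In place of a presentation, the last two assumptions state what counting hyperplanes
  gives. Call t an inversion of w if \<open>t \<otimes> w\<close> is shorter than w. Then
  \<open>refl_exchange\<close> says, for t different from s, that t is an inversion of w exactly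
  when sts is one of sw, because \<open>s \<otimes> (t \<otimes> w)\<close> is sts times sw.\<close>

locale coxeter = group W for W (structure) +
  fixes S :: "'a set"
  assumes finite_S: "finite S"
    and S_sub: "S \<subseteq> carrier W"
    and S_invol: "s \<in> S \<Longrightarrow> s \<otimes> s = \<one>"
    and S_gen: "w \<in> carrier W \<Longrightarrow> \<exists>ss. set ss \<subseteq> S \<and> w = foldr (\<otimes>) ss \<one>"
    and refl_len_neq: "\<lbrakk>t \<in> reflections_of W S; w \<in> carrier W\<rbrakk> \<Longrightarrow>
          word_length W S (t \<otimes> w) \<noteq> word_length W S w"
    and refl_exchange: "\<lbrakk>s \<in> S; t \<in> reflections_of W S; t \<noteq> s; w \<in> carrier W\<rbrakk> \<Longrightarrow>
          word_length W S (t \<otimes> w) < word_length W S w \<longleftrightarrow>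
          word_length W S (s \<otimes> (t \<otimes> w)) < word_length W S (s \<otimes> w)"
begin

section \<open>Words and length\<close>

abbreviation len :: "'a \<Rightarrow> nat" where "len \<equiv> word_length W S"
abbreviation prodl :: "'a list \<Rightarrow> 'a" where "prodl ss \<equiv> foldr (\<otimes>) ss \<one>"
abbreviation refls :: "'a set" where "refls \<equiv> reflections_of W S"

lemma S_closed [simp, intro]: "s \<in> S \<Longrightarrow> s \<in> carrier W"
  using S_sub by auto

lemma S_cancel [simp]: "\<lbrakk>s \<in> S; x \<in> carrier W\<rbrakk> \<Longrightarrow> s \<otimes> (s \<otimes> x) = x"
  by (simp add: m_assoc[symmetric] S_invol)

lemma S_cancel_right [simp]: "\<lbrakk>s \<in> S; x \<in> carrier W\<rbrakk> \<Longrightarrow> x \<otimes> s \<otimes> s = x"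
  by (simp add: m_assoc S_invol)

lemma inv_S [simp]: "s \<in> S \<Longrightarrow> inv s = s"
  by (simp add: S_invol inv_equality)

lemma prodl_closed [simp]: "set ss \<subseteq> S \<Longrightarrow> prodl ss \<in> carrier W"
  by (induction ss) auto

lemma prodl_append: "\<lbrakk>set ss \<subseteq> S; set ss' \<subseteq> S\<rbrakk> \<Longrightarrow> prodl (ss @ ss') = prodl ss \<otimes> prodl ss'"
  by (induction ss) (auto simp: m_assoc)

lemma inv_prodl: "set ss \<subseteq> S \<Longrightarrow> inv (prodl ss) = prodl (rev ss)"
proof (induction ss)
  case (Cons s ss)
  then show ?case by (simp add: inv_mult_group prodl_append del: foldr_append)
qed simp

lemma len_prodl_le: "set ss \<subseteq> S \<Longrightarrow> len (prodl ss) \<le> length ss"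
  unfolding word_length_def by (rule Least_le) auto

lemma reduced_word:
  assumes "w \<in> carrier W"
  obtains ss where "set ss \<subseteq> S" "w = prodl ss" "length ss = len w"
proof -
  obtain ss where "set ss \<subseteq> S" "w = prodl ss" using S_gen[OF assms] by blast
  then have "\<exists>n ss. length ss = n \<and> set ss \<subseteq> S \<and> w = prodl ss" by blast
  from LeastI_ex[OF this] show ?thesis using that unfolding word_length_def by blast
qed

lemma len_one [simp]: "len \<one> = 0"
  using len_prodl_le[of "[]"] by simp

lemma len_eq_0: "\<lbrakk>w \<in> carrier W; len w = 0\<rbrakk> \<Longrightarrow> w = \<one>"
  by (metis reduced_word foldr.simps(1) id_apply length_0_conv)

lemma len_mult: 
  assumes "x \<in> carrier W" "y \<in> carrier W"
  shows "len (x \<otimes> y) \<le> len x + len y"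
proof -
  obtain xs where xs: "set xs \<subseteq> S" "x = prodl xs" "length xs = len x" using reduced_word assms by metis
  obtain ys where ys: "set ys \<subseteq> S" "y = prodl ys" "length ys = len y" using reduced_word assms by metis
  show ?thesis using len_prodl_le[of "xs @ ys"] xs ys by (simp add: prodl_append del: foldr_append)
qed

lemma len_inv_le: "w \<in> carrier W \<Longrightarrow> len (inv w) \<le> len w"
  by (metis reduced_word inv_prodl len_prodl_le length_rev set_rev)

lemma len_inv [simp]: "w \<in> carrier W \<Longrightarrow> len (inv w) = len w"
  by (metis len_inv_le inv_closed inv_inv le_antisym)

lemma S_refls: "s \<in> S \<Longrightarrow> s \<in> refls"
  unfolding reflections_of_def
  by (intro CollectI exI[of _ \<one>] exI[of _ s]) simp

lemma refls_closed [simp]: "t \<in> refls \<Longrightarrow> t \<in> carrier W"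
  by (auto simp: reflections_of_def)

lemma refls_conj: 
  assumes "t \<in> refls" "x \<in> carrier W"
  shows "x \<otimes> t \<otimes> inv x \<in> refls"
proof -
  obtain w s where ws: "t = w \<otimes> s \<otimes> inv w" "w \<in> carrier W" "s \<in> S"
    using assms(1) unfolding reflections_of_def by blast
  then have "x \<otimes> t \<otimes> inv x = (x \<otimes> w) \<otimes> s \<otimes> inv (x \<otimes> w)"
    using assms(2) by (simp add: inv_mult_group m_assoc)
  then show ?thesis using ws assms(2) unfolding reflections_of_def by blast
qed

lemma refls_invol: "t \<in> refls \<Longrightarrow> t \<otimes> t = \<one>"
  unfolding reflections_of_def by (auto simp: m_assoc)

lemma inv_refls [simp]: "t \<in> refls \<Longrightarrow> inv t = t"
  by (simp add: refls_invol inv_equality)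

lemma len_S: "s \<in> S \<Longrightarrow> len s = 1"
  using refl_len_neq[OF S_refls, of s \<one>] len_prodl_le[of "[s]"] by auto

lemma len_left: 
  assumes "s \<in> S" "w \<in> carrier W"
  shows "len (s \<otimes> w) = len w + 1 \<or> len w = len (s \<otimes> w) + 1"
  using len_mult[of s w] len_mult[of s "s \<otimes> w"] refl_len_neq[OF S_refls, of s w] assms len_S[of s] by auto

lemma len_right: 
  assumes "s \<in> S" "w \<in> carrier W"
  shows "len (w \<otimes> s) = len w + 1 \<or> len w = len (w \<otimes> s) + 1"
proof -
  have "len (s \<otimes> inv w) = len (w \<otimes> s)"
    using assms len_inv[of "w \<otimes> s"] by (simp add: inv_mult_group)
  then show ?thesis using len_left[of s "inv w"] assms by auto
qed

lemma finite_len_le: "finite {w \<in> carrier W. len w \<le> n}"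
proof (rule finite_subset)
  show "{w \<in> carrier W. len w \<le> n} \<subseteq> prodl ` {ss. set ss \<subseteq> S \<and> length ss \<le> n}"
    by (auto elim!: reduced_word)
  show "finite (prodl ` {ss. set ss \<subseteq> S \<and> length ss \<le> n})"
    using finite_lists_length_le[OF finite_S] by simp
qed

lemma last_letter:
  assumes "w \<in> carrier W" "w \<noteq> \<one>"
  obtains s w' where "s \<in> S" "w' \<in> carrier W" "w = w' \<otimes> s" "len w = Suc (len w')"
proof -
  obtain ss where ss: "set ss \<subseteq> S" "w = prodl ss" "length ss = len w" using reduced_word assms by metis
  then obtain ss' s where ss': "ss = ss' @ [s]" using assms by (metis foldr.simps(1) id_apply rev_exhaust)
  then have "w = prodl ss' \<otimes> s" "set ss' \<subseteq> S" "s \<in> S" using ss prodl_append[of ss' "[s]"] by auto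
  moreover have "len w = Suc (len (prodl ss'))" 
    using len_right[of s "prodl ss'"] calculation len_prodl_le[of ss'] ss ss' by auto
  ultimately show ?thesis using that[of s "prodl ss'"] by simp
qed

lemma first_letter:
  assumes "w \<in> carrier W" "w \<noteq> \<one>"
  obtains s w' where "s \<in> S" "w' \<in> carrier W" "w = s \<otimes> w'" "len w = Suc (len w')"
proof -
  obtain s w' where *: "s \<in> S" "w' \<in> carrier W" "inv w = w' \<otimes> s" "len (inv w) = Suc (len w')"
    using last_letter[of "inv w"] assms by (metis inv_closed inv_eq_1_iff)
  then have "w = s \<otimes> inv w'" using assms
    by (metis S_closed inv_S inv_inv inv_mult_group)
  moreover have "len w = Suc (len (inv w'))" using * assms by (metis len_inv)
  ultimately show ?thesis using that[of s "inv w'"] * by simp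
qed

section \<open>The Bruhat order: lifting property and subwords\<close>

abbreviation bstep where "bstep \<equiv> bruhat_step W S"
abbreviation bless where "bless \<equiv> bruhat_less W S"
definition ble where "ble x y \<longleftrightarrow> x \<in> carrier W \<and> (x = y \<or> bless x y)"

lemma bstepD: "bstep x y \<Longrightarrow> x \<in> carrier W \<and> y \<in> carrier W \<and> len x < len y"
  by (auto simp: bruhat_step_def)

lemma bless_induct [consumes 1, case_names step trans]:
  assumes "bless x y" "\<And>x y. bstep x y \<Longrightarrow> P x y" "\<And>x y z. P x y \<Longrightarrow> P y z \<Longrightarrow> P x z"
  shows "P x y"
  using assms(1) unfolding bruhat_less_def
  by (rule tranclp_trans_induct[where P = P]) (use assms(2,3) in blast)+

lemma blessD: "bless x y \<Longrightarrow> x \<in> carrier W \<and> y \<in> carrier W \<and> len x < len y"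
  by (induction rule: bless_induct) (use bstepD in force)+

lemma bless_trans: "bless x y \<Longrightarrow> bless y z \<Longrightarrow> bless x z"
  unfolding bruhat_less_def by (rule tranclp_trans)

lemma bstep_bless: "bstep x y \<Longrightarrow> bless x y"
  unfolding bruhat_less_def by blast

lemma ble_refl [simp]: "x \<in> carrier W \<Longrightarrow> ble x x"
  by (simp add: ble_def)

lemma ble_trans: "ble x y \<Longrightarrow> ble y z \<Longrightarrow> ble x z"
  unfolding ble_def using bless_trans by blast

lemma ble_step: "bstep x y \<Longrightarrow> ble x y"
  using bstepD bstep_bless by (auto simp: ble_def)

lemma bleD: "ble x y \<Longrightarrow> x \<in> carrier W \<and> y \<in> carrier W \<and> len x \<le> len y"
  unfolding ble_def using blessD by (auto simp: order.strict_implies_order)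

lemma ble_len_eq: "ble x y \<Longrightarrow> len x = len y \<Longrightarrow> x = y"
  unfolding ble_def by (auto dest: blessD)

lemma finite_bless: "finite {y. bless y w}"
  by (rule finite_subset[OF _ finite_len_le[of "len w"]]) (use blessD in force)

text \<open>Steps are left multiplications by reflections; a right factor s becomes one through the
  reflection \<open>x \<otimes> s \<otimes> inv x\<close>.\<close>

lemma bstep_right:
  assumes "s \<in> S" "x \<in> carrier W" "len (x \<otimes> s) < len x"
  shows "bstep (x \<otimes> s) x"
proof -
  have "x = (x \<otimes> s \<otimes> inv x) \<otimes> (x \<otimes> s)"
    using assms by (simp add: m_assoc S_invol)
  moreover have "x \<otimes> s \<otimes> inv x \<in> refls" using refls_conj[OF S_refls] assms by simp
  ultimately show ?thesis unfolding bruhat_step_def using assms by (metis S_closed m_closed)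
qed

text \<open>With \<open>y = x \<otimes> t'\<close> for the conjugated reflection \<open>t'\<close>,
  everything is passed to inverses, where \<open>refl_exchange\<close> compares lengths before and
  after left multiplication by s. The excluded case \<open>y = x \<otimes> s\<close> is
  \<open>t' = s\<close>.\<close>

lemma bstep_mult_right:
  assumes "bstep x y" "s \<in> S" "y \<noteq> x \<otimes> s"
  shows "bstep (x \<otimes> s) (y \<otimes> s)"
proof -
  obtain t where t: "t \<in> refls" "y = t \<otimes> x" "x \<in> carrier W" "len x < len y"
    using assms(1) by (auto simp: bruhat_step_def)
  define t' where "t' = inv x \<otimes> t \<otimes> x"
  have t': "t' \<in> refls" unfolding t'_def using refls_conj[OF t(1), of "inv x"] t by simp
  have "t' \<noteq> s"
  proof
    assume "t' = s"
    then have "x \<otimes> s = t \<otimes> x" unfolding t'_def using t 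
      by (metis inv_closed m_assoc m_closed refls_closed r_inv l_one)
    then show False using assms t by simp
  qed
  have 1: "t' \<otimes> inv x = inv y" unfolding t'_def using t by (simp add: m_assoc inv_mult_group)
  have 2: "s \<otimes> (t' \<otimes> inv x) = inv (y \<otimes> s)" unfolding 1 using t assms by (simp add: inv_mult_group)
  have 3: "s \<otimes> inv x = inv (x \<otimes> s)" using t assms by (simp add: inv_mult_group)
  have y: "y \<in> carrier W" using t by simp
  have "\<not> len (y \<otimes> s) < len (x \<otimes> s)"
    using refl_exchange[OF assms(2) t' \<open>t' \<noteq> s\<close>, of "inv x"] unfolding 2 3 unfolding 1
    using t y assms by simp
  moreover have "y \<otimes> s = t \<otimes> (x \<otimes> s)" using t assms by (simp add: m_assoc)
  moreover have "len (t \<otimes> (x \<otimes> s)) \<noteq> len (x \<otimes> s)" using refl_len_neq t assms by simp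
  ultimately show ?thesis unfolding bruhat_step_def using t assms by auto
qed

definition down where "down s x = (if len (x \<otimes> s) < len x then x \<otimes> s else x)"
definition up where "up s x = (if len (x \<otimes> s) < len x then x else x \<otimes> s)"

lemma ble_up: "\<lbrakk>s \<in> S; x \<in> carrier W\<rbrakk> \<Longrightarrow> ble x (up s x) \<and> ble (x \<otimes> s) (up s x)"
  using bstep_right[of s x] bstep_right[of s "x \<otimes> s"] len_right[of s x]
  by (auto simp: up_def intro: ble_step)

lemma ble_down: "\<lbrakk>s \<in> S; x \<in> carrier W\<rbrakk> \<Longrightarrow> ble (down s x) x \<and> ble (down s x) (x \<otimes> s)"
  using bstep_right[of s x] bstep_right[of s "x \<otimes> s"] len_right[of s x]
  by (auto simp: down_def intro: ble_step)

text \<open>The lifting property without case distinctions, for the shorter and the longer element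
  of the coset of x. A step either stays inside one coset, or right multiplication by s carries it
  to a step; in the second case \<open>down s x\<close> lies below both elements of the coset of y,
  and dually for \<open>up\<close>.\<close>

lemma ble_mono:
  assumes "ble x y" "s \<in> S"
  shows "ble (down s x) (down s y) \<and> ble (up s x) (up s y)"
proof -
  have step: "ble (down s x) (down s y) \<and> ble (up s x) (up s y)" if "bstep x y" for x y
  proof (cases "y = x \<otimes> s")
    case True
    then show ?thesis using bstepD[OF that] assms by (auto simp: down_def up_def)
  next
    case False
    have xy: "x \<in> carrier W" "y \<in> carrier W" using bstepD that by auto
    have a: "ble x y" "ble (x \<otimes> s) (y \<otimes> s)" using bstep_mult_right[OF that assms(2) False] that ble_step by auto
    have "ble (down s x) y" "ble (down s x) (y \<otimes> s)"
      using a ble_down[OF assms(2) xy(1)] ble_trans by blast+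
    then have "ble (down s x) (down s y)" by (simp add: down_def[of s y])
    moreover have "ble x (up s y)" "ble (x \<otimes> s) (up s y)"
      using a ble_up[OF assms(2) xy(2)] ble_trans by blast+
    then have "ble (up s x) (up s y)" by (simp add: up_def[of s x])
    ultimately show ?thesis by blast
  qed
  have "ble (down s x) (down s y) \<and> ble (up s x) (up s y)" if "bless x y"
    using that by (induction rule: bless_induct) (use step ble_trans in blast)+
  moreover have "ble (down s x) (down s x)" "ble (up s x) (up s x)" if "x \<in> carrier W"
    using that assms by (auto simp: down_def up_def)
  ultimately show ?thesis using assms by (auto simp: ble_def[of x y])
qed

lemma bstep_inv:
  assumes "bstep x y" shows "bstep (inv x) (inv y)"
proof -
  obtain t where t: "t \<in> refls" "y = t \<otimes> x" "x \<in> carrier W" "len x < len y"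
    using assms(1) by (auto simp: bruhat_step_def)
  have "inv y = (inv x \<otimes> t \<otimes> x) \<otimes> inv x" using t by (simp add: m_assoc inv_mult_group)
  moreover have "inv x \<otimes> t \<otimes> x \<in> refls" using refls_conj[OF t(1), of "inv x"] t by simp
  moreover have "len (inv x) < len (inv y)" using t by simp
  ultimately show ?thesis unfolding bruhat_step_def using t by auto
qed

lemma ble_inv: assumes "ble x y" shows "ble (inv x) (inv y)"
proof -
  have "bless x y \<Longrightarrow> bless (inv x) (inv y)" 
    by (induction rule: bless_induct) (use bstep_inv bstep_bless bless_trans in blast)+
  then show ?thesis using assms by (auto simp: ble_def)
qed

lemma ble_left_up:
  assumes "ble y w" "s \<in> S" "len w < len (s \<otimes> w)"
  shows "ble y (s \<otimes> w)" "ble (s \<otimes> y) (s \<otimes> w)"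
proof -
  have yw: "y \<in> carrier W" "w \<in> carrier W" using bleD assms by auto
  have "len (inv w \<otimes> s) = len (s \<otimes> w)" using yw assms len_inv[of "s \<otimes> w"] by (simp add: inv_mult_group)
  then have "up s (inv w) = inv (s \<otimes> w)" using yw assms by (simp add: up_def inv_mult_group)
  moreover have "ble (up s (inv y)) (up s (inv w))" using ble_mono ble_inv assms by blast
  ultimately have "ble (inv y) (inv (s \<otimes> w))" "ble (inv y \<otimes> s) (inv (s \<otimes> w))"
    using ble_up[of s "inv y"] yw assms ble_trans by auto
  moreover have "inv (inv y \<otimes> s) = s \<otimes> y" using yw assms by (simp add: inv_mult_group)
  ultimately show "ble y (s \<otimes> w)" "ble (s \<otimes> y) (s \<otimes> w)"
    using ble_inv yw assms by (metis inv_inv m_closed S_closed)+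
qed

lemma bless_left:
  assumes "s \<in> S" "x \<in> carrier W" "len (s \<otimes> x) < len x"
  shows "bless (s \<otimes> x) x"
proof -
  have "ble (s \<otimes> x) x" using ble_left_up(1)[of "s \<otimes> x" "s \<otimes> x" s] assms by simp
  then show ?thesis using assms by (auto simp: ble_def)
qed

text \<open>The subword property for a reduced product, proved without choosing words. If s is the
  last letter of b, then \<open>down s y\<close> lies below the product without s and factors by
  induction; if s is a descent of y, it is appended to the second factor again.\<close>

lemma ble_factor:
  assumes "ble y (a \<otimes> b)" "a \<in> carrier W" "b \<in> carrier W" "len (a \<otimes> b) = len a + len b"
  shows "\<exists>a' b'. y = a' \<otimes> b' \<and> len y = len a' + len b' \<and> ble a' a \<and> ble b' b"
  using assms
proof (induction "len b" arbitrary: b y)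
  case 0
  then have "b = \<one>" using len_eq_0 by auto
  with 0 show ?case by (intro exI[of _ y] exI[of _ \<one>]) (auto simp: bleD)
next
  case (Suc n)
  then have "b \<noteq> \<one>" by auto
  then obtain s b1 where b1: "s \<in> S" "b1 \<in> carrier W" "b = b1 \<otimes> s" "len b = Suc (len b1)"
    using last_letter Suc by metis
  have ab: "a \<otimes> b = a \<otimes> b1 \<otimes> s" using b1 Suc by (simp add: m_assoc)
  have len1: "len (a \<otimes> b1) = len a + len b1" "len (a \<otimes> b) = len (a \<otimes> b1) + 1"
    using len_mult[of a b1] len_right[of s "a \<otimes> b1"] ab b1 Suc by auto
  have "down s (a \<otimes> b) = a \<otimes> b1" using ab b1 Suc len1 by (simp add: down_def)
  then have dn: "ble (down s y) (a \<otimes> b1)" using ble_mono[OF Suc.prems(1) b1(1)] by simp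
  have y: "y \<in> carrier W" using Suc bleD by blast
  obtain a' b' where *: "down s y = a' \<otimes> b'" "len (down s y) = len a' + len b'" "ble a' a" "ble b' b1"
    using Suc.hyps(1)[OF _ dn] Suc.hyps(2) Suc.prems len1 b1 by force
  have c: "a' \<in> carrier W" "b' \<in> carrier W" using * bleD by auto
  have b1b: "ble b1 b" using b1 ble_up[of s b1] by (simp add: up_def)
  show ?case
  proof (cases "len (y \<otimes> s) < len y")
    case True
    then have ys: "y \<otimes> s = a' \<otimes> b'" "len (y \<otimes> s) = len a' + len b'" using * by (auto simp: down_def)
    then have yeq: "y = a' \<otimes> (b' \<otimes> s)" using b1 y c by (metis S_cancel_right S_closed m_assoc)
    have len2: "len y = len a' + len b' + 1" using len_right[of s y] ys True b1 y by auto
    then have len3: "len (b' \<otimes> s) = len b' + 1" 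
      using len_mult[of a' "b' \<otimes> s"] len_right[of s b'] yeq b1 c by auto
    have "ble (b' \<otimes> s) b" using ble_mono[OF *(4) b1(1)] len3 b1 by (simp add: up_def)
    then show ?thesis using yeq len2 len3 * by (intro exI[of _ a'] exI[of _ "b' \<otimes> s"]) auto
  next
    case False
    then have "down s y = y" by (simp add: down_def)
    moreover have "ble b' b" using * b1b ble_trans by blast
    ultimately show ?thesis using * by metis
  qed
qed

end

section \<open>Straight conjugacy classes\<close>

text \<open>These are the only properties of translations that the algebraic part sees.
  \<open>U_straight\<close> propagates z.u to z.u.u, and \<open>U_unique\<close> makes u recoverable
  from z.u, because z.u can be prolonged straight by no other element of U.\<close>

locale translation_class = coxeter W S for W (structure) and S +
  fixes U :: "'a set" and M :: nat
  assumes U_sub: "U \<subseteq> carrier W"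
    and U_conj_S: "\<lbrakk>u \<in> U; s \<in> S\<rbrakk> \<Longrightarrow> s \<otimes> u \<otimes> s \<in> U"
    and U_len: "u \<in> U \<Longrightarrow> len u = M"
    and U_straight: "\<lbrakk>z \<in> carrier W; u \<in> U; len (z \<otimes> u) = len z + M\<rbrakk> \<Longrightarrow>
           len (z \<otimes> u \<otimes> u) = len z + 2 * M"
    and U_unique: "\<lbrakk>z \<in> carrier W; u \<in> U; u' \<in> U; len (z \<otimes> u) = len z + M;
           len (z \<otimes> u \<otimes> u') = len z + 2 * M\<rbrakk> \<Longrightarrow> u = u'"
begin

lemma U_closed [simp, intro]: "u \<in> U \<Longrightarrow> u \<in> carrier W"
  using U_sub by auto

lemma U_conj:
  assumes "u \<in> U" "b \<in> carrier W" shows "conj_by b u \<in> U"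
proof -
  have "set ss \<subseteq> S \<Longrightarrow> u \<in> U \<Longrightarrow> conj_by (prodl ss) u \<in> U" for ss u
  proof (induction ss arbitrary: u)
    case (Cons s ss)
    then have "conj_by s u \<in> U" using U_conj_S by (simp add: conj_by_def)
    then show ?case using Cons by (simp add: conj_by_mult)
  qed simp
  then show ?thesis using assms S_gen by metis
qed

lemma len_pow_le: 
  assumes "u \<in> U" "x \<in> carrier W" shows "len (x \<otimes> u [^] (n::nat)) \<le> len x + n * M"
proof (induction n)
  case (Suc n)
  have "len (x \<otimes> u [^] n \<otimes> u) \<le> len (x \<otimes> u [^] n) + M"
    using len_mult[of "x \<otimes> u [^] n" u] assms U_len by simp
  then show ?case using Suc assms by (simp add: m_assoc)
qed (use assms in simp)

text \<open>The two-step induction serves to know that the last factor is straight, which is what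
  \<open>U_straight\<close> takes as input.\<close>

lemma straight_pow:
  assumes "z \<in> carrier W" "u \<in> U" "len (z \<otimes> u) = len z + M"
  shows "len (z \<otimes> u [^] (n::nat)) = len z + n * M"
proof (induction n rule: induct_nat_012)
  case (ge2 n)
  let ?w = "z \<otimes> u [^] n"
  have "len (?w \<otimes> u) = len ?w + M" using ge2 assms by (simp add: m_assoc)
  then have "len (?w \<otimes> u \<otimes> u) = len ?w + 2 * M" using U_straight assms by simp
  then show ?case using ge2 assms by (simp add: m_assoc)
qed (use assms in auto)

lemma straight_from_pow:
  assumes "z \<in> carrier W" "u \<in> U" "len (z \<otimes> u [^] (r::nat)) = len z + r * M" "1 \<le> r"
  shows "len (z \<otimes> u) = len z + M"
proof -
  obtain r' where r: "r = Suc r'" using assms(4) by (cases r) auto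
  have "z \<otimes> u [^] r = z \<otimes> u \<otimes> u [^] r'"
    unfolding r using assms nat_pow_mult[of u 1 r'] by (simp add: m_assoc del: nat_pow_Suc)
  then have "len z + r * M \<le> len (z \<otimes> u) + r' * M" 
    using len_pow_le[of u "z \<otimes> u" r'] assms by simp
  then have "len z + M \<le> len (z \<otimes> u)" unfolding r by simp
  moreover have "len (z \<otimes> u) \<le> len z + M" using len_mult[of z u] assms U_len by simp
  ultimately show ?thesis by simp
qed

lemma straight_pow_iff:
  assumes "z \<in> carrier W" "u \<in> U" "len (z \<otimes> u [^] (r::nat)) = len z + r * M" "1 \<le> r"
  shows "len (z \<otimes> u [^] (n::nat)) = len z + n * M"
  using straight_pow[OF assms(1,2) straight_from_pow[OF assms]] .

lemma len_U_pow: "u \<in> U \<Longrightarrow> len (u [^] (n::nat)) = n * M"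
  using straight_pow[of \<one> u n] U_len by simp

definition deep where
  "deep u r x \<longleftrightarrow> u \<in> U \<and> (\<exists>z\<in>carrier W. x = z \<otimes> u [^] r \<and> len x = len z + r * M)"

lemma deepD: "deep u r x \<Longrightarrow> u \<in> U \<and> x \<in> carrier W"
  by (auto simp: deep_def)

lemma deepI:
  assumes "z \<in> carrier W" "u \<in> U" "len z + r * M \<le> len (z \<otimes> u [^] r)"
  shows "deep u r (z \<otimes> u [^] r)"
  using assms len_pow_le[of u z r] unfolding deep_def by (auto intro!: bexI[of _ z])

lemma deep_0: "u \<in> U \<Longrightarrow> x \<in> carrier W \<Longrightarrow> deep u 0 x"
  using deepI[of x u 0] by simp

lemma deep_split:
  assumes "deep u (r + k) y"
  obtains x where "deep u r x" "y = x \<otimes> u [^] k" "len y = len x + k * M"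
proof -
  obtain z where z: "u \<in> U" "z \<in> carrier W" "y = z \<otimes> u [^] (r + k)" "len y = len z + (r + k) * M"
    using assms unfolding deep_def by auto
  let ?x = "z \<otimes> u [^] r"
  have y: "y = ?x \<otimes> u [^] k" using z by (simp add: m_assoc nat_pow_mult)
  have "len y \<le> len ?x + k * M" "len ?x \<le> len z + r * M" using len_pow_le[of u ?x k] len_pow_le[of u z r] y z by auto
  then have "len ?x = len z + r * M" "len y = len ?x + k * M" using z by (auto simp: algebra_simps)
  then show ?thesis using that[of ?x] y z deepI[of z u r] by auto
qed

lemma deep_mono: "deep u r x \<Longrightarrow> r' \<le> r \<Longrightarrow> deep u r' x"
  using deep_split[of u "r - r'" r' x] unfolding deep_def
  by (metis deepD deep_def le_add_diff_inverse2)

lemma deep_straight: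
  assumes "deep u r x" "1 \<le> r"
  shows "len (x \<otimes> u [^] (k::nat)) = len x + k * M"
proof -
  obtain z where z: "u \<in> U" "z \<in> carrier W" "x = z \<otimes> u [^] r" "len x = len z + r * M"
    using assms unfolding deep_def by auto
  then show ?thesis using straight_pow_iff[OF z(2,1), of r "r + k"] assms
    by (simp add: m_assoc nat_pow_mult algebra_simps)
qed

lemma deep_shift:
  assumes "deep u r x" "1 \<le> r"
  shows "deep u (r + k) (x \<otimes> u [^] k)"
proof -
  obtain z where z: "u \<in> U" "z \<in> carrier W" "x = z \<otimes> u [^] r" "len x = len z + r * M"
    using assms unfolding deep_def by auto
  then have "x \<otimes> u [^] k = z \<otimes> u [^] (r + k)" by (simp add: m_assoc nat_pow_mult)
  then show ?thesis using deep_straight[OF assms, of k] z deepI[of z u "r + k"] by (simp add: algebra_simps)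
qed

text \<open>If x ends in u and also in u', then x can be prolonged straight by u'. With x = z.u this
  reads z.u.u', and \<open>U_unique\<close> applies.\<close>

lemma deep_unique:
  assumes "deep u r x" "deep u' r' x" "1 \<le> r" "1 \<le> r'"
  shows "u = u'"
proof -
  have "deep u 1 x" "deep u' 1 x" using assms deep_mono by blast+
  then have "len (x \<otimes> u' [^] (1::nat)) = len x + 1 * M" using deep_straight by blast
  moreover obtain z where z: "u \<in> U" "z \<in> carrier W" "x = z \<otimes> u" "len x = len z + M"
    using \<open>deep u 1 x\<close> unfolding deep_def by auto
  ultimately show ?thesis using U_unique[of z u u'] assms(2) deepD by auto
qed

text \<open>The factor b is carried to the left of the power of u, which becomes a power of the
  conjugate. As the length of zb is at most the sum of the lengths of z and b, no depth is
  lost.\<close>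

lemma deep_mult:
  assumes "deep u r x" "b \<in> carrier W" "len (x \<otimes> b) = len x + len b"
  shows "deep (conj_by b u) r (x \<otimes> b)"
proof -
  obtain z where z: "u \<in> U" "z \<in> carrier W" "x = z \<otimes> u [^] r" "len x = len z + r * M"
    using assms unfolding deep_def by auto
  have "x \<otimes> b = z \<otimes> b \<otimes> conj_by b u [^] r"
    using z assms mult_pow_conj_by[of b u z r] by simp
  moreover have "len (z \<otimes> b) \<le> len z + len b" using len_mult z assms by blast
  ultimately show ?thesis using z assms deepI[of "z \<otimes> b" "conj_by b u" r] U_conj by simp
qed

lemma deep_up:
  assumes "deep u r x" "s \<in> S" "len x < len (x \<otimes> s)"
  shows "deep (conj_by s u) r (x \<otimes> s)"
  using deep_mult[OF assms(1), of s] len_right[of s x] assms len_S deepD[OF assms(1)] by auto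

text \<open>A right descent costs at most one block. For x = z.u.u^r the descent already occurs at
  zu: otherwise zs would be longer than z and straight along the conjugate v of u, and xs = zs
  v^(r+1) would be longer than x. So r blocks survive behind zus.\<close>

lemma deep_down:
  assumes "deep u (Suc r) x" "s \<in> S" "len (x \<otimes> s) < len x"
  shows "deep (conj_by s u) r (x \<otimes> s)"
proof -
  obtain z where z: "u \<in> U" "z \<in> carrier W" "x = z \<otimes> u [^] Suc r" "len x = len z + Suc r * M"
    using assms unfolding deep_def by auto
  let ?v = "conj_by s u" 
  have v: "?v \<in> U" using U_conj z assms by simp
  let ?y = "z \<otimes> u"
  have xs: "x \<otimes> s = ?y \<otimes> s \<otimes> ?v [^] r"
  proof -
    have "x = ?y \<otimes> u [^] r" using z nat_pow_mult[of u 1 r] by (simp add: m_assoc del: nat_pow_Suc)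
    then show ?thesis using z assms mult_pow_conj_by[of s u ?y r] by simp
  qed
  have xs': "x \<otimes> s = z \<otimes> s \<otimes> ?v [^] Suc r"
    using z assms mult_pow_conj_by[of s u z "Suc r"] by simp
  have leny: "len ?y = len z + M" using straight_from_pow[of z u "Suc r"] z by simp
  have lenxs: "len x = len (x \<otimes> s) + 1" using len_right[of s x] assms deepD[OF assms(1)] by auto
  have ys: "?y \<otimes> s = z \<otimes> s \<otimes> ?v" using mult_pow_conj_by[of s u z 1] z assms by simp
  have "len (?y \<otimes> s) < len ?y"
  proof (rule ccontr)
    assume "\<not> ?thesis"
    then have a: "len (z \<otimes> s \<otimes> ?v) = len z + M + 1" using len_right[of s ?y] z assms leny ys by auto
    have "len (z \<otimes> s \<otimes> ?v) \<le> len (z \<otimes> s) + M" 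
      using len_mult[of "z \<otimes> s" ?v] U_len[OF v] z v assms by auto
    then have "len (z \<otimes> s) = len z + 1" using len_right[of s z] z assms a by auto
    with a have "len (z \<otimes> s \<otimes> ?v [^] Suc r) = len z + 1 + Suc r * M"
      using straight_pow[of "z \<otimes> s" ?v "Suc r"] z assms v by simp
    then show False using xs' lenxs z by simp
  qed
  then have "len (?y \<otimes> s) + r * M \<le> len (x \<otimes> s)" using len_right[of s ?y] z assms leny lenxs by auto
  then show ?thesis unfolding xs using deepI[of "?y \<otimes> s" ?v r] z assms v by simp
qed

text \<open>At a descent the upper bound for the length of xs times a power suffices. At an ascent
  xs has the depth of x with respect to the conjugate of u, so that lengths after the shift are
  exact.\<close>

lemma deep_right_iff:
  assumes "deep u r x" "1 \<le> r" "s \<in> S"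
  shows "len (x \<otimes> u [^] (k::nat) \<otimes> s) < len (x \<otimes> u [^] k) \<longleftrightarrow> len (x \<otimes> s) < len x"
proof -
  have c: "u \<in> U" "x \<in> carrier W" using deepD[OF assms(1)] by auto
  have v: "conj_by s u \<in> U" using U_conj c assms by simp
  have eq: "x \<otimes> u [^] k \<otimes> s = x \<otimes> s \<otimes> conj_by s u [^] k"
    using mult_pow_conj_by[of s u x k] c assms by simp
  have l: "len (x \<otimes> u [^] k) = len x + k * M" using deep_straight assms by blast
  show ?thesis
  proof (cases "len (x \<otimes> s) < len x")
    case True
    then have "len (x \<otimes> u [^] k \<otimes> s) < len x + k * M" unfolding eq
      using len_pow_le[OF v, of "x \<otimes> s" k] c assms by simp
    then show ?thesis using True l by simp
  next
    case False
    then have "deep (conj_by s u) r (x \<otimes> s)" 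
      using deep_up[of u r x s] len_right[of s x] assms c by auto
    then have "len (x \<otimes> u [^] k \<otimes> s) = len (x \<otimes> s) + k * M" unfolding eq using deep_straight assms by blast
    then show ?thesis using False l by simp
  qed
qed

lemma deep_left_iff:
  assumes "deep u r x" "1 \<le> r" "s \<in> S"
  shows "len (s \<otimes> (x \<otimes> u [^] (k::nat))) < len (x \<otimes> u [^] k) \<longleftrightarrow> len (s \<otimes> x) < len x"
proof -
  have c: "u \<in> U" "x \<in> carrier W" using deepD[OF assms(1)] by auto
  have eq: "s \<otimes> (x \<otimes> u [^] k) = s \<otimes> x \<otimes> u [^] k"
    using c assms by (simp add: m_assoc)
  have l: "len (x \<otimes> u [^] k) = len x + k * M" using deep_straight assms by blast
  show ?thesis
  proof (cases "len (s \<otimes> x) < len x")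
    case True
    then have "len (s \<otimes> (x \<otimes> u [^] k)) < len x + k * M" unfolding eq
      using len_pow_le[OF c(1), of "s \<otimes> x" k] c assms by simp
    then show ?thesis using True l by simp
  next
    case False
    obtain z where z: "z \<in> carrier W" "x = z \<otimes> u [^] r" "len x = len z + r * M"
      using assms unfolding deep_def by auto
    have "len (s \<otimes> x) = len x + 1" using False len_left[of s x] assms c by auto
    moreover have "s \<otimes> x = s \<otimes> z \<otimes> u [^] r" using z c assms by (simp add: m_assoc)
    moreover have "len (s \<otimes> z) \<le> len z + 1" using len_mult[of s z] len_S assms z by auto
    ultimately have "deep u r (s \<otimes> x)" using deepI[of "s \<otimes> z" u r] z c assms by simp
    then have "len (s \<otimes> (x \<otimes> u [^] k)) = len (s \<otimes> x) + k * M" unfolding eq using deep_straight assms by blast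
    then show ?thesis using False l by simp
  qed
qed

text \<open>Each unit of length costs at most one block. Factor y = a.b along w = w0.u. If b is not
  u, it is shorter than u, and this pays for the lost block. If b is u, the block is kept, and the
  element of U that belongs to a must be u by uniqueness.\<close>

lemma deep_ble:
  assumes "ble y w" "deep u r w"
  shows "\<exists>v. deep v (r - (len w - len y)) y"
  using assms
proof (induction r arbitrary: y w)
  case 0
  then show ?case using deep_0 deepD bleD by (metis diff_0_eq_0)
next
  case (Suc r)
  have "deep u (r + 1) w" using Suc.prems by simp
  then obtain w0 where w0: "deep u r w0" "w = w0 \<otimes> u [^] (1::nat)" "len w = len w0 + 1 * M"
    using deep_split by blast
  have u: "u \<in> U" "w0 \<in> carrier W" using w0 deepD by auto
  then have w: "w = w0 \<otimes> u" using w0 by simp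
  then obtain a b where ab: "y = a \<otimes> b" "len y = len a + len b" "ble a w0" "ble b u"
    using ble_factor[of y w0 u] Suc.prems u w0 U_len by auto
  define q where "q = r - (len w0 - len a)"
  obtain v where v: "deep v q a" unfolding q_def using Suc.IH[OF ab(3) w0(1)] by blast
  have len: "len a \<le> len w0" "len b \<le> M" using bleD ab U_len[OF u(1)] by force+
  have c: "a \<in> carrier W" "b \<in> carrier W" using ab bleD by auto
  show ?case
  proof (cases "b = u")
    case True
    then have la: "len (a \<otimes> u) = len a + M" using ab U_len u by simp
    have deep1: "deep u 1 y" using deepI[of a u 1] la c u ab True by simp
    have lw: "len w - len y = len w0 - len a" using w0(3) ab True U_len u by simp
    show ?thesis
    \<comment> \<open>Depth 0 of a says nothing about v, but then at most depth 1 is claimed for y,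
      and y = a.u has it.\<close>
    proof (cases "q = 0")
      case True
      then have "Suc r - (len w - len y) \<le> 1" unfolding lw q_def by simp
      then show ?thesis using deep1 deep_mono by blast
    next
      case False
      have "deep v 1 a" using deep_mono[OF v] False by simp
      then obtain z where z: "v \<in> U" "z \<in> carrier W" "a = z \<otimes> v" "len a = len z + M"
        unfolding deep_def by auto
      then have "v = u" using U_unique[of z v u] la u by simp
      then have "deep u (q + 1) (a \<otimes> u [^] (1::nat))" using deep_shift[OF v, of 1] False \<open>v = u\<close> by simp
      then have "deep u (q + 1) y" using ab True u by simp
      moreover have "Suc r - (len w - len y) \<le> q + 1" unfolding lw q_def by simp
      ultimately show ?thesis using deep_mono by blast
    qed
  next
    case False
    then have "len b < M" using ble_len_eq[OF ab(4)] U_len u len by fastforce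
    then have "Suc r - (len w - len y) \<le> q" unfolding q_def using w0(3) ab len by simp
    moreover have "deep (conj_by b v) q y" using deep_mult[OF v c(2)] ab by simp
    ultimately show ?thesis using deep_mono by blast
  qed
qed

end

section \<open>The Hecke algebra\<close>

lemma poly_mapping_add_induct [case_names zero single add]:
  fixes f :: "'k \<Rightarrow>\<^sub>0 'b::comm_monoid_add"
  assumes "P 0" "\<And>k c. P (Poly_Mapping.single k c)" "\<And>f g. P f \<Longrightarrow> P g \<Longrightarrow> P (f + g)"
  shows "P f"
proof (induction f rule: update_induct)
  case (update f a b)
  have "Poly_Mapping.update a b f = Poly_Mapping.single a b + f"
    using update(1) by (intro poly_mapping_eqI) (auto simp: lookup_update lookup_add lookup_single when_def in_keys_iff)
  then show ?case using update assms by simp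
qed (rule assms(1))

section \<open>The group ring: bar involution and negative elements\<close>

lemma lookup_ring_bar: "Poly_Mapping.lookup (ring_bar a) g = Poly_Mapping.lookup a (- g)"
  unfolding ring_bar_def by (simp add: map_key.rep_eq)

lemma ring_bar_0 [simp]: "ring_bar 0 = 0"
  by (simp add: ring_bar_def)

lemma ring_bar_add: "ring_bar (a + b) = ring_bar a + ring_bar b"
  by (rule poly_mapping_eqI) (simp add: lookup_ring_bar lookup_add)

lemma ring_bar_diff: "ring_bar (a - b) = ring_bar a - ring_bar b"
  by (rule poly_mapping_eqI) (simp add: lookup_ring_bar lookup_minus)

lemma ring_bar_single [simp]: "ring_bar (Poly_Mapping.single g c) = Poly_Mapping.single (- g) c"
  by (rule poly_mapping_eqI) (auto simp: lookup_ring_bar lookup_single when_def)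

lemma ring_bar_1 [simp]: "ring_bar 1 = 1"
  using ring_bar_single[of 0 1] by (simp del: ring_bar_single)

lemma ring_bar_mult: "ring_bar (a * b) = ring_bar a * ring_bar b"
proof (induction a rule: poly_mapping_add_induct)
  case (single k c)
  show ?case
    by (induction b rule: poly_mapping_add_induct)
      (auto simp: mult_single ring_bar_add distrib_left add.commute)
qed (auto simp: ring_bar_add distrib_right)

lemma ring_bar_group_elem [simp]: "ring_bar (group_elem g) = group_elem (- g)"
  by (simp add: group_elem_def)

lemma group_elem_mult: "group_elem g * group_elem h = group_elem (g + h)"
  by (simp add: group_elem_def mult_single)

lemma group_elem_0 [simp]: "group_elem 0 = 1"
  by (simp add: group_elem_def)

definition negative :: "'g::ab_group_add set \<Rightarrow> 'g group_ring \<Rightarrow> bool" where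
  "negative \<Gamma>p a \<longleftrightarrow> Poly_Mapping.keys a \<subseteq> uminus ` \<Gamma>p"

lemma negative_0 [simp]: "negative \<Gamma>p 0"
  by (simp add: negative_def)

lemma negative_add: "negative \<Gamma>p a \<Longrightarrow> negative \<Gamma>p b \<Longrightarrow> negative \<Gamma>p (a + b)"
  unfolding negative_def using keys_add[of a b] by blast

lemma negative_diff: "negative \<Gamma>p a \<Longrightarrow> negative \<Gamma>p b \<Longrightarrow> negative \<Gamma>p (a - b)"
  unfolding negative_def using keys_diff[of a b] by blast

lemma negative_group_elem: "g \<in> \<Gamma>p \<Longrightarrow> negative \<Gamma>p (group_elem (- g))"
  by (auto simp: negative_def group_elem_def)

lemma negative_mult:
  assumes "positive_cone \<Gamma>p" "negative \<Gamma>p a" "negative \<Gamma>p b"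
  shows "negative \<Gamma>p (a * b)"
proof -
  have "x + y \<in> uminus ` \<Gamma>p" if xy: "x \<in> uminus ` \<Gamma>p" "y \<in> uminus ` \<Gamma>p" for x y
  proof -
    obtain g h where "g \<in> \<Gamma>p" "h \<in> \<Gamma>p" "x = - g" "y = - h" using xy by blast
    then show ?thesis using assms(1) unfolding positive_cone_def
      by (intro image_eqI[of _ _ "g + h"]) auto
  qed
  then show ?thesis using assms(2,3) keys_mult[of a b] unfolding negative_def
    by (smt (verit, best) mem_Collect_eq subset_eq)
qed

text \<open>The support of a bar-invariant element is symmetric, while that of a negative one lies
  strictly on one side of the neutral element.\<close>

lemma negative_bar_eq_0:
  assumes "positive_cone \<Gamma>p" "negative \<Gamma>p a" "ring_bar a = a"
  shows "a = 0"
proof (rule ccontr)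
  assume "a \<noteq> 0"
  then obtain g where g: "g \<in> Poly_Mapping.keys a" by (metis keys_eq_empty ex_in_conv)
  then have "- g \<in> Poly_Mapping.keys a" using assms(3) lookup_ring_bar[of a g] by (simp add: in_keys_iff)
  then have "g \<in> uminus ` \<Gamma>p" "- g \<in> uminus ` \<Gamma>p" using assms(2) g by (auto simp: negative_def)
  then show False using assms(1) unfolding positive_cone_def by (auto simp: image_iff)
qed

text \<open>This is how \<open>P\<close> is recovered from the difference between itself and its
  image under bar.\<close>

lemma negative_antisym_unique:
  assumes "positive_cone \<Gamma>p" "negative \<Gamma>p a" "negative \<Gamma>p b" "a - ring_bar a = b - ring_bar b"
  shows "a = b"
proof -
  have "ring_bar (a - b) = a - b" using assms(4) by (simp add: ring_bar_diff algebra_simps)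
  then show ?thesis using negative_bar_eq_0[OF assms(1) negative_diff] assms by fastforce
qed

text \<open>This is how \<open>Mu\<close> is recovered: it is bar-invariant and known modulo
  negative elements.\<close>

lemma negative_sym_unique:
  assumes "positive_cone \<Gamma>p" "negative \<Gamma>p (a - m)" "negative \<Gamma>p (a - m')" "ring_bar m = m" "ring_bar m' = m'"
  shows "m = m'"
proof -
  have "negative \<Gamma>p (m - m')" using negative_diff[OF assms(3,2)] by simp
  then show ?thesis using negative_bar_eq_0[OF assms(1)] assms(4,5) by (metis ring_bar_diff eq_iff_diff_eq_0)
qed

text \<open>By additivity one monomial is treated at a time: a positive one is completed by its
  inverse, which is a negative error; the neutral one is kept; a negative one is dropped.\<close>

lemma symmetric_part:
  assumes "positive_cone \<Gamma>p"
  shows "\<exists>m. ring_bar m = m \<and> negative \<Gamma>p (a - m)"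
proof (induction a rule: poly_mapping_add_induct)
  case zero
  show ?case by (intro exI[of _ 0]) simp
next
  case (single g c)
  consider "g \<in> \<Gamma>p" | "g = 0" | "g \<in> uminus ` \<Gamma>p" using assms unfolding positive_cone_def by blast
  then show ?case
  proof cases
    case 1
    then show ?thesis
      by (intro exI[of _ "Poly_Mapping.single g c + Poly_Mapping.single (- g) c"])
        (auto simp: ring_bar_add negative_def single_uminus[symmetric])
  next
    case 2
    then show ?thesis by (intro exI[of _ "Poly_Mapping.single g c"]) auto
  next
    case 3
    then show ?thesis by (intro exI[of _ 0]) (auto simp: negative_def)
  qed
next
  case (add f g)
  then obtain m n where "ring_bar m = m" "negative \<Gamma>p (f - m)" "ring_bar n = n" "negative \<Gamma>p (g - n)" by blast
  then show ?case using negative_add[of \<Gamma>p "f - m" "g - n"]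
    by (intro exI[of _ "m + n"]) (auto simp: ring_bar_add algebra_simps)
qed

section \<open>Coordinates in the Hecke module\<close>

lemma lookup_hecke_scale [simp]: "Poly_Mapping.lookup (hecke_scale a h) y = a * Poly_Mapping.lookup h y"
  by (simp add: hecke_scale_def map.rep_eq when_def)

lemma lookup_hecke_T: "Poly_Mapping.lookup (hecke_T w) y = (if y = w then 1 else 0)"
  by (auto simp: hecke_T_def lookup_single)

lemma keys_hecke_T [simp]: "Poly_Mapping.keys (hecke_T w :: ('w, 'g::ab_group_add) hecke) = {w}"
  by (simp add: hecke_T_def)

lemma keys_hecke_scale: "Poly_Mapping.keys (hecke_scale a h) \<subseteq> Poly_Mapping.keys h"
  by (auto simp: in_keys_iff)

lemma hecke_scale_add: "hecke_scale a (h + h') = hecke_scale a h + hecke_scale a h'"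
  by (rule poly_mapping_eqI) (simp add: lookup_add distrib_left)

lemma hecke_scale_diff: "hecke_scale a (h - h') = hecke_scale a h - hecke_scale a h'"
  by (rule poly_mapping_eqI) (simp add: lookup_minus right_diff_distrib)

lemma hecke_scale_add_left: "hecke_scale (a + b) h = hecke_scale a h + hecke_scale b h"
  by (rule poly_mapping_eqI) (simp add: lookup_add distrib_right)

lemma hecke_scale_diff_left: "hecke_scale (a - b) h = hecke_scale a h - hecke_scale b h"
  by (rule poly_mapping_eqI) (simp add: lookup_minus left_diff_distrib)

lemma hecke_scale_scale: "hecke_scale a (hecke_scale b h) = hecke_scale (a * b) h"
  by (rule poly_mapping_eqI) (simp add: mult.assoc)

lemma hecke_scale_0 [simp]: "hecke_scale a 0 = 0" "hecke_scale 0 h = 0"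
  by (auto intro: poly_mapping_eqI)

lemma hecke_scale_1 [simp]: "hecke_scale 1 h = h"
  by (auto intro: poly_mapping_eqI)

lemma hecke_scale_sum: "hecke_scale a (sum f A) = (\<Sum>x\<in>A. hecke_scale a (f x))"
  by (rule poly_mapping_eqI) (simp add: lookup_sum sum_distrib_left)

lemma (in monoid) inv_mult_Units:
  assumes "x \<in> Units G" "y \<in> Units G"
  shows "inv (x \<otimes> y) = inv y \<otimes> inv x"
proof -
  have c: "x \<in> carrier G" "y \<in> carrier G" "inv x \<in> carrier G" "inv y \<in> carrier G" using assms by auto
  have "(x \<otimes> y) \<otimes> (inv y \<otimes> inv x) = x \<otimes> (y \<otimes> inv y) \<otimes> inv x" using c by (simp add: m_assoc)
  then have 1: "(x \<otimes> y) \<otimes> (inv y \<otimes> inv x) = \<one>" using assms c by simp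
  have "(inv y \<otimes> inv x) \<otimes> (x \<otimes> y) = inv y \<otimes> (inv x \<otimes> x) \<otimes> y" using c by (simp add: m_assoc)
  then have 2: "(inv y \<otimes> inv x) \<otimes> (x \<otimes> y) = \<one>" using assms c by simp
  show ?thesis using inv_unique'[OF _ _ 1 2] c by simp
qed

section \<open>Products and the image of the basis under bar\<close>

locale kl_setting = coxeter W S for W (structure) and S +
  fixes \<Gamma>p :: "'g::ab_group_add set" and v :: "'a \<Rightarrow> 'g" and \<H> :: "('a, 'g) hecke ring"
  assumes cone: "positive_cone \<Gamma>p"
    and v_pos: "s \<in> S \<Longrightarrow> v s \<in> \<Gamma>p"
    and hecke: "hecke_algebra W S v \<H>"
begin

sublocale H: ring \<H>
  using hecke by (simp add: hecke_algebra_def)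

abbreviation hmult (infixl "\<star>" 70) where "x \<star> y \<equiv> x \<otimes>\<^bsub>\<H>\<^esub> y"
abbreviation T :: "'a \<Rightarrow> ('a, 'g) hecke" where "T \<equiv> hecke_T"
abbreviation lk :: "('a, 'g) hecke \<Rightarrow> 'a \<Rightarrow> 'g group_ring" where "lk \<equiv> Poly_Mapping.lookup"
abbreviation neg :: "'g group_ring \<Rightarrow> bool" where "neg \<equiv> negative \<Gamma>p"
definition Q :: "'a \<Rightarrow> 'g group_ring" where "Q s = group_elem (v s)"
definition q :: "'a \<Rightarrow> 'g group_ring" where "q s = group_elem (- v s)"
abbreviation \<xi> :: "'a \<Rightarrow> 'g group_ring" where "\<xi> s \<equiv> Q s - q s"

lemma Qq [simp]: "Q s * q s = 1" "q s * Q s = 1"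
  by (simp_all add: Q_def q_def group_elem_mult)

lemma bar_Qq [simp]: "ring_bar (Q s) = q s" "ring_bar (q s) = Q s"
  by (simp_all add: Q_def q_def)

lemma neg_q: "s \<in> S \<Longrightarrow> neg (q s)"
  unfolding q_def using negative_group_elem v_pos by blast

lemma carrier_iff: "h \<in> carrier \<H> \<longleftrightarrow> (\<forall>y. lk h y \<noteq> 0 \<longrightarrow> y \<in> carrier W)"
  using hecke by (auto simp: hecke_algebra_def in_keys_iff)

lemma T_closed [simp]: "w \<in> carrier W \<Longrightarrow> T w \<in> carrier \<H>"
  by (auto simp: carrier_iff lookup_hecke_T)

lemma scale_closed [simp]: "h \<in> carrier \<H> \<Longrightarrow> hecke_scale a h \<in> carrier \<H>"
  by (auto simp: carrier_iff) (metis mult_zero_right)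

lemma add_closed [simp]: "h \<in> carrier \<H> \<Longrightarrow> h' \<in> carrier \<H> \<Longrightarrow> h + h' \<in> carrier \<H>"
  by (auto simp: carrier_iff lookup_add) (metis add.left_neutral)

lemma diff_closed [simp]: "h \<in> carrier \<H> \<Longrightarrow> h' \<in> carrier \<H> \<Longrightarrow> h - h' \<in> carrier \<H>"
  by (auto simp: carrier_iff lookup_minus) (metis diff_0_right)

lemma zero_closed [simp]: "0 \<in> carrier \<H>"
  by (auto simp: carrier_iff)

lemma sum_closed [simp]: "(\<And>x. x \<in> A \<Longrightarrow> f x \<in> carrier \<H>) \<Longrightarrow> sum f A \<in> carrier \<H>"
  by (induction A rule: infinite_finite_induct) auto

lemma H_add: "h \<in> carrier \<H> \<Longrightarrow> h' \<in> carrier \<H> \<Longrightarrow> h \<oplus>\<^bsub>\<H>\<^esub> h' = h + h'"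
  using hecke by (auto simp: hecke_algebra_def)

lemma H_one: "\<one>\<^bsub>\<H>\<^esub> = T \<one>"
  using hecke by (auto simp: hecke_algebra_def)

lemma T_one [simp]: "h \<in> carrier \<H> \<Longrightarrow> T \<one> \<star> h = h" "h \<in> carrier \<H> \<Longrightarrow> h \<star> T \<one> = h"
  by (simp_all add: H_one[symmetric])

lemma star_closed [simp]: "h \<in> carrier \<H> \<Longrightarrow> h' \<in> carrier \<H> \<Longrightarrow> h \<star> h' \<in> carrier \<H>"
  by (rule H.m_closed)

lemma scale_star: 
  "h \<in> carrier \<H> \<Longrightarrow> h' \<in> carrier \<H> \<Longrightarrow> hecke_scale a h \<star> h' = hecke_scale a (h \<star> h')"
  "h \<in> carrier \<H> \<Longrightarrow> h' \<in> carrier \<H> \<Longrightarrow> h \<star> hecke_scale a h' = hecke_scale a (h \<star> h')"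
  using hecke unfolding hecke_algebra_def by blast+

lemma star_add:
  assumes "x \<in> carrier \<H>" "y \<in> carrier \<H>" "z \<in> carrier \<H>"
  shows "(x + y) \<star> z = x \<star> z + y \<star> z" "x \<star> (y + z) = x \<star> y + x \<star> z"
  using H.l_distr[OF assms] H.r_distr[OF assms(2,3,1)] assms by (simp_all add: H_add)

lemma star_diff:
  assumes "x \<in> carrier \<H>" "y \<in> carrier \<H>" "z \<in> carrier \<H>"
  shows "(x - y) \<star> z = x \<star> z - y \<star> z" "x \<star> (y - z) = x \<star> y - x \<star> z"
  using star_add(1)[of "x - y" y z] star_add(2)[of x "y - z" z] assms by (simp_all add: algebra_simps)

lemma star_zero: "h \<in> carrier \<H> \<Longrightarrow> h \<star> 0 = 0"
  using star_add(2)[of h 0 0] by simp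

lemma star_sum:
  assumes "h \<in> carrier \<H>" "\<And>x. x \<in> A \<Longrightarrow> f x \<in> carrier \<H>"
  shows "h \<star> sum f A = (\<Sum>x\<in>A. h \<star> f x)"
  using assms by (induction A rule: infinite_finite_induct) (auto simp: star_add star_zero)

lemma T_left_up: "\<lbrakk>s \<in> S; w \<in> carrier W; len w < len (s \<otimes> w)\<rbrakk> \<Longrightarrow> T s \<star> T w = T (s \<otimes> w)"
  using hecke unfolding hecke_algebra_def by blast

lemma T_left_down: "\<lbrakk>s \<in> S; w \<in> carrier W; len (s \<otimes> w) < len w\<rbrakk> \<Longrightarrow> 
    T s \<star> T w = T (s \<otimes> w) + hecke_scale (\<xi> s) (T w)"
  using hecke unfolding hecke_algebra_def Q_def q_def by blast

lemma T_mult: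
  assumes "x \<in> carrier W" "y \<in> carrier W" "len (x \<otimes> y) = len x + len y"
  shows "T x \<star> T y = T (x \<otimes> y)"
  using assms
proof (induction "len x" arbitrary: x)
  case 0
  then have "x = \<one>" using len_eq_0 by auto
  then show ?case using 0 by simp
next
  case (Suc n)
  then have "x \<noteq> \<one>" by auto
  then obtain s x' where x': "s \<in> S" "x' \<in> carrier W" "x = s \<otimes> x'" "len x = Suc (len x')"
    using first_letter Suc by metis
  have xy: "x \<otimes> y = s \<otimes> (x' \<otimes> y)" using x' Suc by (simp add: m_assoc)
  have l: "len (x' \<otimes> y) = len x' + len y" "len (x' \<otimes> y) < len (s \<otimes> (x' \<otimes> y))"
    using len_mult[of x' y] len_left[of s "x' \<otimes> y"] xy x' Suc by auto
  have "T x = T s \<star> T x'" using T_left_up[of s x'] x' by simp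
  then have "T x \<star> T y = T s \<star> (T x' \<star> T y)" using x' Suc by (simp add: H.m_assoc)
  also have "T x' \<star> T y = T (x' \<otimes> y)" using Suc.hyps(1)[of x'] Suc x' l by simp
  also have "T s \<star> T (x' \<otimes> y) = T (x \<otimes> y)" unfolding xy using T_left_up[of s "x' \<otimes> y"] x' Suc l by simp
  finally show ?case .
qed

lemma T_sq: "s \<in> S \<Longrightarrow> T s \<star> T s = T \<one> + hecke_scale (\<xi> s) (T s)"
  using T_left_down[of s s] by (simp add: S_invol len_S)

lemma T_right_up: "\<lbrakk>s \<in> S; w \<in> carrier W; len w < len (w \<otimes> s)\<rbrakk> \<Longrightarrow> T w \<star> T s = T (w \<otimes> s)"
  using T_mult[of w s] len_right[of s w] len_S by auto

text \<open>The defining relations concern left multiplication only. On the right,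
  \<open>T w\<close> is split as \<open>T (w \<otimes> s) \<star> T s\<close>, and the quadratic
  relation for \<open>T s\<close> is applied.\<close>

lemma T_right_down:
  assumes "s \<in> S" "w \<in> carrier W" "len (w \<otimes> s) < len w"
  shows "T w \<star> T s = T (w \<otimes> s) + hecke_scale (\<xi> s) (T w)"
proof -
  have w: "T w = T (w \<otimes> s) \<star> T s" using T_right_up[of s "w \<otimes> s"] assms by simp
  have "T w \<star> T s = T (w \<otimes> s) \<star> (T s \<star> T s)" using w assms by (metis H.m_assoc S_closed T_closed m_closed)
  also have "\<dots> = T (w \<otimes> s) + hecke_scale (\<xi> s) (T w)"
    using assms by (simp add: T_sq star_add scale_star w[symmetric])
  finally show ?thesis .
qed

definition Tinv where "Tinv s = T s - hecke_scale (\<xi> s) (T \<one>)"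

lemma Tinv_closed [simp]: "s \<in> S \<Longrightarrow> Tinv s \<in> carrier \<H>"
  by (simp add: Tinv_def)

lemma Tinv_star: "s \<in> S \<Longrightarrow> h \<in> carrier \<H> \<Longrightarrow> Tinv s \<star> h = T s \<star> h - hecke_scale (\<xi> s) h"
  by (simp add: Tinv_def star_diff scale_star)

lemma star_Tinv: "s \<in> S \<Longrightarrow> h \<in> carrier \<H> \<Longrightarrow> h \<star> Tinv s = h \<star> T s - hecke_scale (\<xi> s) h"
  by (simp add: Tinv_def star_diff scale_star)

lemma T_Tinv: "s \<in> S \<Longrightarrow> T s \<star> Tinv s = \<one>\<^bsub>\<H>\<^esub>" "s \<in> S \<Longrightarrow> Tinv s \<star> T s = \<one>\<^bsub>\<H>\<^esub>"
  by (simp_all add: star_Tinv Tinv_star T_sq H_one)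

lemma T_S_Units: "s \<in> S \<Longrightarrow> T s \<in> Units \<H>"
  unfolding Units_def using T_Tinv[of s] Tinv_closed[of s] by auto

lemma inv_T_S: "s \<in> S \<Longrightarrow> inv\<^bsub>\<H>\<^esub> (T s) = Tinv s"
  using H.inv_unique'[OF _ _ T_Tinv] by simp

lemma T_Units: "w \<in> carrier W \<Longrightarrow> T w \<in> Units \<H>"
proof (induction "len w" arbitrary: w)
  case 0
  then have "w = \<one>" using len_eq_0 by auto
  then show ?case using H_one by (metis H.Units_one_closed)
next
  case (Suc n)
  then have "w \<noteq> \<one>" by auto
  then obtain s x' where x': "s \<in> S" "x' \<in> carrier W" "w = s \<otimes> x'" "len w = Suc (len x')"
    using first_letter Suc by metis
  then have "T w = T s \<star> T x'" using T_left_up[of s x'] by simp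
  then show ?case using Suc x' T_S_Units by simp
qed

definition barT where "barT w = inv\<^bsub>\<H>\<^esub> (T (inv w))"

lemma barT_closed [simp]: "w \<in> carrier W \<Longrightarrow> barT w \<in> carrier \<H>"
  by (simp add: barT_def T_Units)

lemma barT_mult:
  assumes "x \<in> carrier W" "y \<in> carrier W" "len (x \<otimes> y) = len x + len y"
  shows "barT (x \<otimes> y) = barT x \<star> barT y"
proof -
  have "T (inv (x \<otimes> y)) = T (inv y) \<star> T (inv x)"
    using T_mult[of "inv y" "inv x"] len_inv[of "x \<otimes> y"] assms by (simp add: inv_mult_group)
  then show ?thesis unfolding barT_def using assms by (simp add: H.inv_mult_Units T_Units)
qed

lemma barT_S: "s \<in> S \<Longrightarrow> barT s = Tinv s"
  by (simp add: barT_def inv_T_S)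

lemma barT_one: "barT \<one> = T \<one>"
  unfolding barT_def by (simp add: H_one[symmetric])

lemma barT_right: "\<lbrakk>s \<in> S; w \<in> carrier W; len w < len (w \<otimes> s)\<rbrakk> \<Longrightarrow> barT (w \<otimes> s) = barT w \<star> Tinv s"
  using barT_mult[of w s] len_right[of s w] len_S barT_S by auto

lemma barT_left: "\<lbrakk>s \<in> S; w \<in> carrier W; len w < len (s \<otimes> w)\<rbrakk> \<Longrightarrow> barT (s \<otimes> w) = Tinv s \<star> barT w"
  using barT_mult[of s w] len_left[of s w] len_S barT_S by auto

lemma hecke_induct [consumes 1, case_names scale add]:
  assumes "h \<in> carrier \<H>" 
    and base: "\<And>a w. w \<in> carrier W \<Longrightarrow> P (hecke_scale a (T w))"
    and add: "\<And>h h'. \<lbrakk>h \<in> carrier \<H>; h' \<in> carrier \<H>; P h; P h'\<rbrakk> \<Longrightarrow> P (h + h')"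
  shows "P h"
proof -
  have "h \<in> carrier \<H> \<longrightarrow> P h"
  proof (induction h rule: update_induct)
    case const
    show ?case using base[of \<one> 0] by simp
  next
    case (update f a b)
    have eq: "Poly_Mapping.update a b f = hecke_scale b (T a) + f"
      using update(1) by (intro poly_mapping_eqI) (auto simp: lookup_update lookup_add lookup_hecke_T in_keys_iff)
    show ?case
    proof
      assume c: "Poly_Mapping.update a b f \<in> carrier \<H>"
      have "a \<in> carrier W" using c update(2) by (auto simp: carrier_iff lookup_update)
      moreover have "f \<in> carrier \<H>" using c update(1,2) 
        by (auto simp: carrier_iff lookup_update in_keys_iff split: if_splits)
      ultimately show "P (Poly_Mapping.update a b f)" unfolding eq using update(3) by (intro add base) auto
    qed
  qed
  then show ?thesis using assms(1) by simp
qed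

lemma lk_T_left:
  assumes "h \<in> carrier \<H>" "s \<in> S" "y \<in> carrier W"
  shows "lk (T s \<star> h) y = (if len (s \<otimes> y) < len y then lk h (s \<otimes> y) + \<xi> s * lk h y else lk h (s \<otimes> y))"
  using assms(1)
proof (induction h rule: hecke_induct)
  case (scale a w)
  have e: "y = s \<otimes> w \<longleftrightarrow> s \<otimes> y = w" using assms scale by auto
  show ?case
  proof (cases "len w < len (s \<otimes> w)")
    case True
    then show ?thesis using T_left_up[of s w] assms scale e
      by (auto simp: scale_star lookup_hecke_T)
  next
    case False
    then have "len (s \<otimes> w) < len w" using len_left[of s w] assms scale by auto
    then show ?thesis using T_left_down[of s w] assms scale e
      by (auto simp: scale_star lookup_hecke_T lookup_add algebra_simps)
  qed
next
  case (add h h')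
  then show ?case using assms by (simp add: star_add lookup_add algebra_simps)
qed

lemma lk_star_Tinv:
  assumes "h \<in> carrier \<H>" "s \<in> S" "y \<in> carrier W"
  shows "lk (h \<star> Tinv s) y = (if len (y \<otimes> s) < len y then lk h (y \<otimes> s) else lk h (y \<otimes> s) - \<xi> s * lk h y)"
  using assms(1)
proof (induction h rule: hecke_induct)
  case (scale a w)
  have e: "y = w \<otimes> s \<longleftrightarrow> y \<otimes> s = w" using assms scale by auto
  show ?case
  proof (cases "len w < len (w \<otimes> s)")
    case True
    then show ?thesis using T_right_up[of s w] assms scale e
      by (auto simp: star_Tinv scale_star lookup_hecke_T lookup_minus algebra_simps)
  next
    case False
    then have "len (w \<otimes> s) < len w" using len_right[of s w] assms scale by auto
    then show ?thesis using T_right_down[of s w] assms scale e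
      by (auto simp: star_Tinv scale_star lookup_hecke_T lookup_add lookup_minus algebra_simps)
  qed
next
  case (add h h')
  then show ?case using assms by (simp add: star_add lookup_add algebra_simps)
qed

text \<open>The analogue of the R-polynomials for unequal weights, up to normalisation.\<close>

definition bar_coeff where "bar_coeff x y = lk (barT y) x"

text \<open>At a descent of y both lengths drop and their difference is unchanged; at an ascent the
  difference is smaller by 2 in the first term and by 1 in the second. The induction on the
  difference of lengths rests on this.\<close>

lemma bar_coeff_right:
  assumes "s \<in> S" "w \<in> carrier W" "y \<in> carrier W" "len (w \<otimes> s) < len w"
  shows "bar_coeff y w = (if len (y \<otimes> s) < len y then bar_coeff (y \<otimes> s) (w \<otimes> s)
     else bar_coeff (y \<otimes> s) (w \<otimes> s) - \<xi> s * bar_coeff y (w \<otimes> s))"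
proof -
  have "barT w = barT (w \<otimes> s) \<star> Tinv s" using barT_right[of s "w \<otimes> s"] assms by simp
  then show ?thesis unfolding bar_coeff_def using lk_star_Tinv[of "barT (w \<otimes> s)" s y] assms by simp
qed

text \<open>Triangularity is stated by length instead of the Bruhat order: this suits arguments with
  a longest element of a support, and shifts control lengths directly.\<close>

lemma bar_coeff_triangular:
  assumes "w \<in> carrier W" "y \<in> carrier W" "len w \<le> len y"
  shows "bar_coeff y w = (if y = w then 1 else 0)"
  using assms
proof (induction "len w" arbitrary: w y)
  case 0
  then have "w = \<one>" using len_eq_0 by auto
  then show ?case by (simp add: bar_coeff_def barT_one lookup_hecke_T)
next
  case (Suc n)
  then have "w \<noteq> \<one>" by auto
  then obtain s w' where w': "s \<in> S" "w' \<in> carrier W" "w = w' \<otimes> s" "len w = Suc (len w')"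
    using last_letter Suc by metis
  have ws: "w \<otimes> s = w'" using w' by simp
  have IH: "bar_coeff y' w' = (if y' = w' then 1 else 0)" if "y' \<in> carrier W" "len w' \<le> len y'" for y'
    using Suc.hyps(1)[of w' y'] Suc.hyps(2) w' that by simp
  have e: "y \<otimes> s = w' \<longleftrightarrow> y = w" using w' Suc.prems by auto
  show ?case
  proof (cases "len (y \<otimes> s) < len y")
    case True
    then have "bar_coeff y w = bar_coeff (y \<otimes> s) w'" using bar_coeff_right[of s w y] w' Suc.prems ws by simp
    moreover have "len w' \<le> len (y \<otimes> s)" using len_right[of s y] w' Suc.prems by auto
    ultimately show ?thesis using IH[of "y \<otimes> s"] w' Suc.prems e by simp
  next
    case False
    then have "bar_coeff y w = bar_coeff (y \<otimes> s) w' - \<xi> s * bar_coeff y w'" using bar_coeff_right[of s w y] w' Suc.prems ws by simp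
    moreover have "len w' \<le> len (y \<otimes> s)" "y \<otimes> s \<noteq> w'" "y \<noteq> w'" "y \<noteq> w" 
      using len_right[of s y] w' Suc.prems False by auto
    ultimately show ?thesis using IH[of "y \<otimes> s"] IH[of y] w' Suc.prems by simp
  qed
qed

text \<open>Each letter of b, removed from the right, is a descent of both arguments, so that only
  the first branch of \<open>bar_coeff_right\<close> occurs.\<close>

lemma bar_coeff_mult_right:
  assumes "x \<in> carrier W" "w \<in> carrier W" "b \<in> carrier W" 
    "len (x \<otimes> b) = len x + len b" "len (w \<otimes> b) = len w + len b"
  shows "bar_coeff (x \<otimes> b) (w \<otimes> b) = bar_coeff x w"
  using assms
proof (induction "len b" arbitrary: b)
  case 0
  then have "b = \<one>" using len_eq_0 by auto
  with 0 show ?case by simp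
next
  case (Suc n)
  then have "b \<noteq> \<one>" by auto
  then obtain s b' where b': "s \<in> S" "b' \<in> carrier W" "b = b' \<otimes> s" "len b = Suc (len b')"
    using last_letter Suc by metis
  have e: "x \<otimes> b \<otimes> s = x \<otimes> b'" "w \<otimes> b \<otimes> s = w \<otimes> b'" using b' Suc by (simp_all add: m_assoc S_invol)
  have x: "len (x \<otimes> b') = len x + len b'" "len (x \<otimes> b) = Suc (len (x \<otimes> b'))" 
    using len_mult[of x b'] len_right[of s "x \<otimes> b'"] b' Suc by (auto simp: m_assoc)
  have w: "len (w \<otimes> b') = len w + len b'" "len (w \<otimes> b) = Suc (len (w \<otimes> b'))" 
    using len_mult[of w b'] len_right[of s "w \<otimes> b'"] b' Suc by (auto simp: m_assoc)
  have "bar_coeff (x \<otimes> b) (w \<otimes> b) = bar_coeff (x \<otimes> b') (w \<otimes> b')"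
    using bar_coeff_right[of s "w \<otimes> b" "x \<otimes> b"] e x w b' Suc by simp
  also have "\<dots> = bar_coeff x w" using Suc.hyps(1)[of b'] Suc.hyps(2) Suc.prems b' x w by simp
  finally show ?case .
qed

end

section \<open>Kazhdan-Lusztig elements\<close>

lemma ex_arg_max:
  fixes f :: "'a \<Rightarrow> nat"
  assumes "finite A" "A \<noteq> {}"
  obtains z where "z \<in> A" "\<And>w. w \<in> A \<Longrightarrow> f w \<le> f z"
proof -
  have "Max (f ` A) \<in> f ` A" using assms by simp
  then obtain z where "z \<in> A" "f z = Max (f ` A)" by auto
  then show ?thesis using that assms by simp
qed

context kl_setting begin

abbreviation hb where "hb \<equiv> hecke_bar W \<H>"

lemma hb_superset:
  assumes "finite A" "Poly_Mapping.keys h \<subseteq> A"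
  shows "hb h = (\<Sum>w\<in>A. hecke_scale (ring_bar (lk h w)) (barT w))"
  unfolding hecke_bar_def barT_def
  by (rule sum.mono_neutral_left) (use assms in \<open>auto simp: in_keys_iff\<close>)

lemma hb_add: "hb (h + h') = hb h + hb h'"
proof -
  let ?A = "Poly_Mapping.keys h \<union> Poly_Mapping.keys h'"
  have "Poly_Mapping.keys (h + h') \<subseteq> ?A" by (rule keys_add)
  then show ?thesis
    by (simp add: hb_superset[of ?A] lookup_add ring_bar_add hecke_scale_add_left sum.distrib)
qed

lemma hb_scale: "hb (hecke_scale a h) = hecke_scale (ring_bar a) (hb h)"
  by (simp add: hb_superset[of "Poly_Mapping.keys h"] keys_hecke_scale ring_bar_mult
        hecke_scale_sum hecke_scale_scale)

lemma hb_diff: "hb (h - h') = hb h - hb h'"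
  using hb_add[of "h - h'" h'] by (simp add: algebra_simps)

lemma hb_sum: "hb (sum f A) = (\<Sum>x\<in>A. hb (f x))"
proof -
  have "hb 0 = 0" by (simp add: hecke_bar_def)
  then show ?thesis by (induction A rule: infinite_finite_induct) (auto simp: hb_add)
qed

lemma hb_T: "hb (T w) = barT w"
  by (simp add: hb_superset[of "{w}"] lookup_hecke_T)

lemma hb_closed [simp]: "h \<in> carrier \<H> \<Longrightarrow> hb h \<in> carrier \<H>"
  unfolding hecke_bar_def barT_def[symmetric]
  by (intro sum_closed scale_closed barT_closed) (auto simp: carrier_iff in_keys_iff)

lemma lk_hb: "lk (hb h) x = (\<Sum>w\<in>Poly_Mapping.keys h. ring_bar (lk h w) * bar_coeff x w)"
  by (simp add: hb_superset[of "Poly_Mapping.keys h"] lookup_sum bar_coeff_def)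

lemma Tinv_sq: 
  assumes "s \<in> S" "h \<in> carrier \<H>"
  shows "Tinv s \<star> (Tinv s \<star> h) = h - hecke_scale (\<xi> s) (Tinv s \<star> h)"
proof -
  have "T s \<star> (Tinv s \<star> h) = h" using assms T_Tinv(1)[of s] by (simp add: H.m_assoc[symmetric])
  then show ?thesis using assms Tinv_star[of s "Tinv s \<star> h"] by simp
qed

text \<open>The multiplicativity of bar on which the construction relies. At a descent, bar sends
  \<open>\<xi> s\<close> to its negative, which matches the quadratic relation for the inverse of
  \<open>T s\<close>.\<close>

lemma hb_T_left:
  assumes "h \<in> carrier \<H>" "s \<in> S"
  shows "hb (T s \<star> h) = Tinv s \<star> hb h"
  using assms(1)
proof (induction h rule: hecke_induct)
  case (scale a w)
  have "hb (T s \<star> T w) = Tinv s \<star> barT w"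
  proof (cases "len w < len (s \<otimes> w)")
    case True
    then show ?thesis using T_left_up[of s w] barT_left[of s w] assms scale by (simp add: hb_T)
  next
    case False
    then have l: "len (s \<otimes> w) < len w" using len_left[of s w] assms scale by auto
    have b: "barT w = Tinv s \<star> barT (s \<otimes> w)" using barT_left[of s "s \<otimes> w"] l assms scale by simp
    have "hb (T s \<star> T w) = barT (s \<otimes> w) + hecke_scale (q s - Q s) (barT w)"
      using T_left_down[of s w] l assms scale by (simp add: hb_T hb_add hb_scale ring_bar_diff)
    also have "\<dots> = Tinv s \<star> (Tinv s \<star> barT (s \<otimes> w))"
      using Tinv_sq[of s "barT (s \<otimes> w)"] assms scale b by (simp add: hecke_scale_diff_left algebra_simps)
    finally show ?thesis using b by simp
  qed
  then show ?case using assms scale by (simp add: scale_star hb_scale hb_T)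
next
  case (add h h')
  then show ?case using assms by (simp add: star_add hb_add)
qed

text \<open>Left multiplication by \<open>C s\<close>, in a form that is available before
  \<open>C s\<close> has been constructed; see \<open>C_S_mult\<close>.\<close>

definition Ls where "Ls s h = T s \<star> h + hecke_scale (q s) h"

lemma Ls_closed [simp]: "s \<in> S \<Longrightarrow> h \<in> carrier \<H> \<Longrightarrow> Ls s h \<in> carrier \<H>"
  by (simp add: Ls_def)

lemma hb_Ls: "s \<in> S \<Longrightarrow> h \<in> carrier \<H> \<Longrightarrow> hb (Ls s h) = Ls s (hb h)"
  by (simp add: Ls_def hb_add hb_T_left hb_scale Tinv_star hecke_scale_diff_left)

lemma lk_Ls:
  assumes "h \<in> carrier \<H>" "s \<in> S" "y \<in> carrier W"
  shows "lk (Ls s h) y = lk h (s \<otimes> y) + (if len (s \<otimes> y) < len y then Q s else q s) * lk h y"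
  using lk_T_left[OF assms] by (simp add: Ls_def lookup_add algebra_simps)

definition Ts_eigen where "Ts_eigen s h \<longleftrightarrow> T s \<star> h = hecke_scale (Q s) h"

lemma Ts_eigen_Ls: 
  assumes "s \<in> S" "h \<in> carrier \<H>"
  shows "Ts_eigen s (Ls s h)"
proof -
  have "T s \<star> (T s \<star> h) = (T s \<star> T s) \<star> h" using assms by (simp add: H.m_assoc)
  then have "T s \<star> (T s \<star> h) = h + hecke_scale (\<xi> s) (T s \<star> h)"
    using assms by (simp add: T_sq star_add scale_star)
  then have "T s \<star> Ls s h = h + hecke_scale (Q s) (T s \<star> h)"
    unfolding Ls_def using assms by (simp add: star_add scale_star hecke_scale_diff_left)
  also have "\<dots> = hecke_scale (Q s) (Ls s h)" 
    by (simp add: Ls_def hecke_scale_add hecke_scale_scale)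
  finally show ?thesis unfolding Ts_eigen_def .
qed

lemma Ts_eigen_lk:
  assumes "Ts_eigen s h" "h \<in> carrier \<H>" "s \<in> S" "y \<in> carrier W" "len y < len (s \<otimes> y)"
  shows "lk h y = q s * lk h (s \<otimes> y)"
proof -
  have "lk h (s \<otimes> y) = Q s * lk h y"
    using assms lk_T_left[of h s y] unfolding Ts_eigen_def by simp
  then have "q s * lk h (s \<otimes> y) = (q s * Q s) * lk h y" by (simp only: mult.assoc)
  then show ?thesis by simp
qed

lemma Ts_eigen_diff: "\<lbrakk>Ts_eigen s h; Ts_eigen s h'; s \<in> S; h \<in> carrier \<H>; h' \<in> carrier \<H>\<rbrakk> \<Longrightarrow> Ts_eigen s (h - h')"
  by (simp add: Ts_eigen_def star_diff hecke_scale_diff)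

lemma Ts_eigen_scale: "\<lbrakk>Ts_eigen s h; s \<in> S; h \<in> carrier \<H>\<rbrakk> \<Longrightarrow> Ts_eigen s (hecke_scale a h)"
  by (simp add: Ts_eigen_def scale_star hecke_scale_scale mult.commute)

lemma Ts_eigen_sum: "\<lbrakk>\<And>x. x \<in> A \<Longrightarrow> Ts_eigen s (f x) \<and> f x \<in> carrier \<H>; s \<in> S\<rbrakk> \<Longrightarrow> Ts_eigen s (sum f A)"
  by (simp add: Ts_eigen_def star_sum hecke_scale_sum)

text \<open>Coordinatewise form of the description in \<open>kl_C\<close>; by
  \<open>kl_element_iff\<close> the two agree for w in W.\<close>

definition kl_element where "kl_element w c \<longleftrightarrow> c \<in> carrier \<H> \<and> hb c = c \<and> lk c w = 1 \<and>
   (\<forall>y. y \<noteq> w \<longrightarrow> neg (lk c y)) \<and> (\<forall>y. lk c y \<noteq> 0 \<longrightarrow> ble y w)"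

text \<open>At a longest element of the support, triangularity makes the coefficient itself
  bar-invariant, hence zero.\<close>

lemma neg_bar_invariant_eq_0:
  assumes "d \<in> carrier \<H>" "hb d = d" "\<And>y. neg (lk d y)"
  shows "d = 0"
proof (rule ccontr)
  assume "d \<noteq> 0"
  then have "Poly_Mapping.keys d \<noteq> {}" by simp
  then obtain y where y: "y \<in> Poly_Mapping.keys d" "\<And>w. w \<in> Poly_Mapping.keys d \<Longrightarrow> len w \<le> len y"
    using ex_arg_max[OF finite_keys, of d len] by blast
  have c: "w \<in> carrier W" if "w \<in> Poly_Mapping.keys d" for w 
    using assms(1) that by (auto simp: carrier_iff in_keys_iff)
  have "lk d y = (\<Sum>w\<in>Poly_Mapping.keys d. ring_bar (lk d w) * bar_coeff y w)"
    using lk_hb[of d y] assms(2) by simp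
  also have "\<dots> = (\<Sum>w\<in>Poly_Mapping.keys d. if w = y then ring_bar (lk d y) else 0)"
    by (rule sum.cong) (use bar_coeff_triangular c y in auto)
  also have "\<dots> = ring_bar (lk d y)" using y(1) by simp
  finally have "lk d y = 0" using negative_bar_eq_0[OF cone assms(3)] by metis
  then show False using y(1) by (simp add: in_keys_iff)
qed

lemma kl_element_unique:
  assumes "kl_element w c" "kl_element w c'" shows "c = c'"
proof -
  have "neg (lk (c - c') y)" for y
  proof (cases "y = w")
    case True
    then show ?thesis using assms by (simp add: kl_element_def lookup_minus)
  next
    case False
    then show ?thesis using assms by (auto simp: kl_element_def lookup_minus intro: negative_diff)
  qed
  then have "c - c' = 0" using assms by (intro neg_bar_invariant_eq_0) (auto simp: kl_element_def hb_diff)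
  then show ?thesis by simp
qed

lemma kl_element_D:
  assumes "kl_element w c"
  shows "c \<in> carrier \<H>" "hb c = c" "lk c w = 1" "y \<noteq> w \<Longrightarrow> neg (lk c y)" "lk c y \<noteq> 0 \<Longrightarrow> ble y w"
  using assms by (auto simp: kl_element_def)

lemma lookup_KL_sum:
  "Poly_Mapping.lookup (T w + (\<Sum>y | bless y w. hecke_scale (p y) (T y))) x =
     (if x = w then 1 else if bless x w then p x else 0)"
proof -
  have "(\<Sum>y | bless y w. p y * (if x = y then 1 else 0)) = (if bless x w then p x else 0)"
    using finite_bless[of w] by (simp add: if_distrib[of "\<lambda>z. _ * z"] cong: if_cong)
  moreover have "\<not> bless w w" using blessD by blast
  ultimately show ?thesis by (auto simp: lookup_add lookup_sum lookup_hecke_T)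
qed

lemma kl_element_iff:
  assumes "w \<in> carrier W"
  shows "kl_element w c \<longleftrightarrow> c \<in> carrier \<H> \<and> hb c = c \<and>
     (\<exists>p. (\<forall>y. Poly_Mapping.keys (p y) \<subseteq> uminus ` \<Gamma>p) \<and>
        c = T w + (\<Sum>y | bless y w. hecke_scale (p y) (T y)))" (is "?L \<longleftrightarrow> ?R")
proof
  assume L: ?L
  let ?p = "\<lambda>y. if bless y w then lk c y else 0"
  have "\<not> bless w w" using blessD by blast
  then have "Poly_Mapping.keys (?p y) \<subseteq> uminus ` \<Gamma>p" for y
    using L by (auto simp: kl_element_def negative_def dest: blessD)
  moreover have "c = T w + (\<Sum>y | bless y w. hecke_scale (?p y) (T y))"
    by (rule poly_mapping_eqI, subst lookup_KL_sum) (use L in \<open>auto simp: kl_element_def ble_def\<close>)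
  ultimately have "(\<forall>y. Poly_Mapping.keys (?p y) \<subseteq> uminus ` \<Gamma>p) \<and>
        c = T w + (\<Sum>y | bless y w. hecke_scale (?p y) (T y))" by (intro conjI allI)
  then have "\<exists>p. (\<forall>y. Poly_Mapping.keys (p y) \<subseteq> uminus ` \<Gamma>p) \<and>
        c = T w + (\<Sum>y | bless y w. hecke_scale (p y) (T y))" by (rule exI[where x = ?p])
  then show ?R using kl_element_D(1,2)[OF L] by simp
next
  assume R: ?R
  then obtain p where p: "\<forall>y. neg (p y)" "c = T w + (\<Sum>y | bless y w. hecke_scale (p y) (T y))"
    unfolding negative_def by auto
  have c: "c \<in> carrier \<H>" "hb c = c" using R by simp_all
  have lk: "lk c x = (if x = w then 1 else if bless x w then p x else 0)" for x
    unfolding p(2) by (rule lookup_KL_sum)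
  show ?L unfolding kl_element_def
  proof (intro conjI allI impI)
    show "lk c w = 1" by (simp add: lk)
    fix y
    show "neg (lk c y)" if "y \<noteq> w" using p(1) that by (simp add: lk)
    show "ble y w" if "lk c y \<noteq> 0"
      using that assms blessD[of y w] unfolding lk ble_def by (auto split: if_splits)
  qed (fact c)+
qed

text \<open>The multipliers are chosen from the longest index downwards: the multiple of
  \<open>C z\<close> for a longest z repairs the coefficient at z, and the \<open>C y\<close> for
  the remaining y have none there.\<close>

lemma triangular_correction:
  assumes "finite I" "\<And>z. z \<in> I \<Longrightarrow> kl_element z (C z)"
  shows "\<exists>m. (\<forall>z. z \<notin> I \<longrightarrow> m z = 0) \<and> (\<forall>z. ring_bar (m z) = m z) \<and>
     (\<forall>z\<in>I. neg (lk (h - (\<Sum>y\<in>I. hecke_scale (m y) (C y))) z))"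
  using assms
proof (induction "card I" arbitrary: I h)
  case 0
  then show ?case by (intro exI[of _ "\<lambda>_. 0"]) auto
next
  case (Suc n)
  then have "I \<noteq> {}" by auto
  then obtain z where z: "z \<in> I" "\<And>w. w \<in> I \<Longrightarrow> len w \<le> len z"
    using ex_arg_max[OF Suc.prems(1), of len] by blast
  obtain m0 where m0: "ring_bar m0 = m0" "neg (lk h z - m0)" using symmetric_part[OF cone] by blast
  let ?I = "I - {z}" and ?h = "h - hecke_scale m0 (C z)"
  have "n = card ?I" using Suc z by simp
  then have "\<exists>m. (\<forall>z. z \<notin> ?I \<longrightarrow> m z = 0) \<and> (\<forall>z. ring_bar (m z) = m z) \<and>
     (\<forall>x\<in>?I. neg (lk (?h - (\<Sum>y\<in>?I. hecke_scale (m y) (C y))) x))"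
    by (rule Suc.hyps(1)) (use Suc.prems in auto)
  then obtain m where m: "\<forall>z. z \<notin> ?I \<longrightarrow> m z = 0" "\<forall>z. ring_bar (m z) = m z"
     "\<forall>x\<in>?I. neg (lk (?h - (\<Sum>y\<in>?I. hecke_scale (m y) (C y))) x)"
    by (elim exE conjE)
  let ?m = "m(z := m0)"
  have sum: "h - (\<Sum>y\<in>I. hecke_scale (?m y) (C y)) = ?h - (\<Sum>y\<in>?I. hecke_scale (m y) (C y))"
    using sum.remove[OF Suc.prems(1) z(1), of "\<lambda>y. hecke_scale (?m y) (C y)"] by (simp add: algebra_simps)
  have "lk (C y) z = 0" if "y \<in> ?I" for y
  proof (rule ccontr)
    assume "lk (C y) z \<noteq> 0"
    then have "ble z y" using Suc.prems(2) that kl_element_D(5) by blast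
    then show False using z(2)[of y] that bleD[of z y] ble_len_eq[of z y] by auto
  qed
  then have "lk (?h - (\<Sum>y\<in>?I. hecke_scale (m y) (C y))) z = lk h z - m0"
    using kl_element_D(3)[OF Suc.prems(2)[OF z(1)]] by (simp add: lookup_minus lookup_sum)
  then have "\<forall>x\<in>I. neg (lk (h - (\<Sum>y\<in>I. hecke_scale (?m y) (C y))) x)"
    unfolding sum using m(3) m0(2) by auto
  then show ?case using m m0 z(1) by (intro exI[of _ ?m]) auto
qed

definition descents_below where
  "descents_below s w = {y \<in> carrier W. bless (s \<otimes> y) y \<and> bless y w}"

lemma finite_descents_below: "finite (descents_below s w)"
  by (rule finite_subset[OF _ finite_bless[of w]]) (auto simp: descents_below_def)

lemma descents_below_iff: "s \<in> S \<Longrightarrow> y \<in> descents_below s w \<longleftrightarrow> len (s \<otimes> y) < len y \<and> bless y w"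
  unfolding descents_below_def using bless_left[of s y] blessD by blast

text \<open>Only the coefficients at the left descents of \<open>s\<close> need a correction: by the eigenvector property, those at
  ascents are multiples of them by \<open>q s\<close>, which is negative.\<close>

lemma C_step:
  assumes s: "s \<in> S" and w: "w \<in> carrier W" and sw: "len w < len (s \<otimes> w)" and c: "kl_element w c"
    and C: "\<And>z. z \<in> descents_below s w \<Longrightarrow> kl_element z (C z) \<and> Ts_eigen s (C z)"
  shows "\<exists>m. (\<forall>z. z \<notin> descents_below s w \<longrightarrow> m z = 0) \<and> (\<forall>z. ring_bar (m z) = m z) \<and>
     kl_element (s \<otimes> w) (Ls s c - (\<Sum>z\<in>descents_below s w. hecke_scale (m z) (C z))) \<and>
     Ts_eigen s (Ls s c - (\<Sum>z\<in>descents_below s w. hecke_scale (m z) (C z)))"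
proof -
  let ?I = "descents_below s w" 
  have "\<exists>m. (\<forall>z. z \<notin> ?I \<longrightarrow> m z = 0) \<and> (\<forall>z. ring_bar (m z) = m z) \<and>
     (\<forall>z\<in>?I. neg (lk (Ls s c - (\<Sum>y\<in>?I. hecke_scale (m y) (C y))) z))"
    by (rule triangular_correction[OF finite_descents_below]) (use C in simp)
  then obtain m where m: "\<forall>z. z \<notin> ?I \<longrightarrow> m z = 0" "\<forall>z. ring_bar (m z) = m z"
     "\<forall>z\<in>?I. neg (lk (Ls s c - (\<Sum>y\<in>?I. hecke_scale (m y) (C y))) z)"
    by (elim exE conjE)
  define h where "h = Ls s c - (\<Sum>y\<in>?I. hecke_scale (m y) (C y))"
  have cc: "c \<in> carrier \<H>" "\<And>z. z \<in> ?I \<Longrightarrow> C z \<in> carrier \<H>" using c C kl_element_D by blast+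
  have h_closed: "h \<in> carrier \<H>" unfolding h_def using cc s by simp
  have "hb h = Ls s (hb c) - (\<Sum>z\<in>?I. hecke_scale (ring_bar (m z)) (hb (C z)))"
    unfolding h_def using s cc by (simp add: hb_diff hb_Ls hb_sum hb_scale)
  also have "(\<Sum>z\<in>?I. hecke_scale (ring_bar (m z)) (hb (C z))) = (\<Sum>z\<in>?I. hecke_scale (m z) (C z))"
    using m(2) kl_element_D(2)[OF conjunct1[OF C]] by (intro sum.cong) simp_all
  also have "Ls s (hb c) - (\<Sum>z\<in>?I. hecke_scale (m z) (C z)) = h"
    by (simp only: h_def kl_element_D(2)[OF c])
  finally have hb_h: "hb h = h" .
  have Ts_eigen_h: "Ts_eigen s h" unfolding h_def using s cc C by (intro Ts_eigen_diff Ts_eigen_Ls Ts_eigen_sum conjI Ts_eigen_scale) auto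
  have lk_h: "lk h y = lk c (s \<otimes> y) + (if len (s \<otimes> y) < len y then Q s else q s) * lk c y -
      (\<Sum>z\<in>?I. m z * lk (C z) y)" if "y \<in> carrier W" for y
    unfolding h_def using lk_Ls[OF cc(1) s that] by (simp add: lookup_minus lookup_sum)
  have Cz0: "lk (C z) y = 0" if "z \<in> ?I" "\<not> bless y w" for z y
  proof (rule ccontr)
    assume "lk (C z) y \<noteq> 0"
    then have "ble y z" using C that(1) kl_element_D(5) by blast
    moreover have "bless z w" using that(1) s descents_below_iff by blast
    ultimately show False using that(2) bless_trans by (auto simp: ble_def)
  qed
  have c0: "lk c y = 0" if "\<not> ble y w" for y using kl_element_D(5)[OF c] that by blast
  have nbl: "\<not> ble (s \<otimes> w) w" "\<not> bless (s \<otimes> w) w" using bleD blessD sw by (metis not_le, metis not_less_iff_gr_or_eq)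
  have at_sw: "lk h (s \<otimes> w) = 1"
    using lk_h[of "s \<otimes> w"] s w sw Cz0[OF _ nbl(2)] c0[OF nbl(1)] kl_element_D(3)[OF c] by simp
  have down: "neg (lk h y)" if y: "y \<in> carrier W" "y \<noteq> s \<otimes> w" "len (s \<otimes> y) < len y" for y
  proof (cases "y \<in> ?I")
    case True
    then show ?thesis using m(3) unfolding h_def by blast
  next
    case False
    \<comment> \<open>A descent outside the correction set is not below w, so that of all terms only
      the coefficient of c at sy is left.\<close>
    then have nb: "\<not> bless y w" using descents_below_iff s y by blast
    moreover have "y \<noteq> w" using y sw by auto
    ultimately have "lk h y = lk c (s \<otimes> y)" using lk_h[OF y(1)] Cz0 c0[of y] by (simp add: ble_def)
    moreover have "s \<otimes> y \<noteq> w" using y s by auto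
    ultimately show ?thesis using kl_element_D(4)[OF c] by simp
  qed
  have "neg (lk h y)" if y: "y \<noteq> s \<otimes> w" for y
  proof (cases "y \<in> carrier W")
    case False
    then have "lk h y = 0" using h_closed carrier_iff by blast
    then show ?thesis by simp
  next
    case True
    show ?thesis
    proof (cases "len (s \<otimes> y) < len y")
      case True
      then show ?thesis using down y \<open>y \<in> carrier W\<close> by blast
    next
      case False
      then have l: "len y < len (s \<otimes> y)" using len_left[of s y] s \<open>y \<in> carrier W\<close> by auto
      then have eq: "lk h y = q s * lk h (s \<otimes> y)" using Ts_eigen_lk[OF Ts_eigen_h h_closed s] \<open>y \<in> carrier W\<close> by blast
      show ?thesis
      proof (cases "s \<otimes> y = s \<otimes> w")
        case True
        then show ?thesis using eq at_sw neg_q[OF s] by simp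
      next
        case False
        then have "neg (lk h (s \<otimes> y))" using down[of "s \<otimes> y"] s \<open>y \<in> carrier W\<close> l by simp
        then show ?thesis unfolding eq using negative_mult[OF cone neg_q[OF s]] by blast
      qed
    qed
  qed
  moreover have "ble y (s \<otimes> w)" if "lk h y \<noteq> 0" for y
  proof (rule ccontr)
    assume nb: "\<not> ble y (s \<otimes> w)"
    have y: "y \<in> carrier W" using that h_closed carrier_iff by blast
    have "\<not> ble y w" using nb ble_left_up(1)[OF _ s sw] by blast
    moreover have "\<not> ble (s \<otimes> y) w"
    proof
      assume "ble (s \<otimes> y) w"
      from ble_left_up(2)[OF this s sw] show False using nb s y by simp
    qed
    moreover have "\<not> bless y w" using \<open>\<not> ble y w\<close> y by (simp add: ble_def)
    ultimately show False using that lk_h[OF y] c0 Cz0 by simp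
  qed
  ultimately have "kl_element (s \<otimes> w) h" unfolding kl_element_def using h_closed hb_h at_sw by blast
  then show ?thesis using m(1,2) Ts_eigen_h unfolding h_def by (intro exI[of _ m] conjI)
qed

text \<open>The eigenvector property at all left descents is carried along because
  \<open>C_step\<close> requires it of the shorter elements. The construction through one descent s
  gives it for this s, and uniqueness of the element transfers it to the other descents.\<close>

lemma kl_element_exists:
  assumes "w \<in> carrier W"
  shows "\<exists>c. kl_element w c \<and> (\<forall>s\<in>S. len (s \<otimes> w) < len w \<longrightarrow> Ts_eigen s c)"
  using assms
proof (induction "len w" arbitrary: w rule: less_induct)
  case less
  show ?case
  proof (cases "w = \<one>")
    case True
    have "kl_element \<one> (T \<one>)" unfolding kl_element_def by (simp add: hb_T barT_one lookup_hecke_T)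
    then show ?thesis unfolding True by auto
  next
    case False
    have step: "\<exists>c. kl_element w c \<and> Ts_eigen s c" if s: "s \<in> S" "len (s \<otimes> w) < len w" for s
    proof -
      let ?w = "s \<otimes> w"
      have w: "?w \<in> carrier W" "s \<otimes> ?w = w" using s less by auto
      obtain c where c: "kl_element ?w c" using less.hyps s(2) w by blast
      have "\<forall>z\<in>descents_below s ?w. \<exists>c. kl_element z c \<and> Ts_eigen s c"
      proof
        fix z assume "z \<in> descents_below s ?w"
        then have "len (s \<otimes> z) < len z" "bless z ?w" using descents_below_iff s by auto
        then show "\<exists>c. kl_element z c \<and> Ts_eigen s c" using less.hyps[of z] blessD[of z ?w] s by auto
      qed
      then obtain C where "\<forall>z\<in>descents_below s ?w. kl_element z (C z) \<and> Ts_eigen s (C z)" by metis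
      then show ?thesis using C_step[OF s(1) w(1) _ c, of C] s w by auto
    qed
    obtain s where s: "s \<in> S" "len (s \<otimes> w) < len w"
      using first_letter[OF less.prems False] by (metis S_cancel lessI)
    then obtain c where c: "kl_element w c" using step by blast
    then have "Ts_eigen s' c" if "s' \<in> S" "len (s' \<otimes> w) < len w" for s' 
      using step[OF that] kl_element_unique by blast
    then show ?thesis using c by blast
  qed
qed

section \<open>The elements C and the coefficients P and M of the definitions\<close>

abbreviation C where "C \<equiv> kl_C W S \<Gamma>p \<H>"
abbreviation P where "P \<equiv> kl_P W S \<Gamma>p \<H>"

lemma kl_element_C: assumes "w \<in> carrier W" shows "kl_element w (C w)"
proof -
  obtain c where c: "kl_element w c" using kl_element_exists assms by blast
  have "C w = (THE c. kl_element w c)" unfolding kl_C_def kl_element_iff[OF assms] ..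
  also have "\<dots> = c" using c kl_element_unique by blast
  finally show ?thesis using c by simp
qed

lemma Ts_eigen_C: "\<lbrakk>w \<in> carrier W; s \<in> S; len (s \<otimes> w) < len w\<rbrakk> \<Longrightarrow> Ts_eigen s (C w)"
  using kl_element_exists[of w] kl_element_unique kl_element_C by blast

lemma C_S: assumes "s \<in> S" shows "C s = Ls s (T \<one>)"
proof -
  have one: "kl_element \<one> (T \<one>)" unfolding kl_element_def by (simp add: hb_T barT_one lookup_hecke_T)
  have "descents_below s \<one> = {}" using blessD by (fastforce simp: descents_below_def)
  then have "kl_element s (Ls s (T \<one>))" 
    using C_step[OF assms one_closed _ one, of "\<lambda>_. 0"] assms len_S by auto
  then show ?thesis using kl_element_unique kl_element_C assms by blast
qed

lemma C_S_mult: assumes "s \<in> S" "h \<in> carrier \<H>" shows "C s \<star> h = Ls s h"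
  using assms by (simp add: C_S Ls_def star_add scale_star)

lemma P_self: "w \<in> carrier W \<Longrightarrow> P w w = 1"
  unfolding kl_P_def using kl_element_D(3)[OF kl_element_C] .

lemma P_neg: "w \<in> carrier W \<Longrightarrow> y \<noteq> w \<Longrightarrow> neg (P y w)"
  unfolding kl_P_def using kl_element_D(4)[OF kl_element_C] .

lemma P_ble: "w \<in> carrier W \<Longrightarrow> P y w \<noteq> 0 \<Longrightarrow> ble y w"
  unfolding kl_P_def using kl_element_D(5)[OF kl_element_C] .

lemma P_bar:
  assumes w: "w \<in> carrier W" and x: "x \<in> carrier W" and "x \<noteq> w" and A: "finite A" "x \<notin> A" "A \<subseteq> carrier W"
    "\<And>y. \<lbrakk>ble y w; len x < len y\<rbrakk> \<Longrightarrow> y \<in> A"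
  shows "P x w - ring_bar (P x w) = (\<Sum>y\<in>A. ring_bar (P y w) * bar_coeff x y)"
proof -
  let ?K = "Poly_Mapping.keys (C w)"
  have "P x w = (\<Sum>y\<in>?K. ring_bar (P y w) * bar_coeff x y)"
    using lk_hb[of "C w" x] kl_element_D(2)[OF kl_element_C[OF w]] by (simp add: kl_P_def)
  also have "\<dots> = (\<Sum>y\<in>?K \<union> insert x A. ring_bar (P y w) * bar_coeff x y)"
    by (rule sum.mono_neutral_left) (use A in \<open>auto simp: kl_P_def in_keys_iff\<close>)
  also have "\<dots> = (\<Sum>y\<in>insert x A. ring_bar (P y w) * bar_coeff x y)"
  proof (rule sum.mono_neutral_right)
    show "\<forall>y\<in>?K \<union> insert x A - insert x A. ring_bar (P y w) * bar_coeff x y = 0"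
    proof
      fix y assume y: "y \<in> ?K \<union> insert x A - insert x A"
      then have "ble y w" using P_ble[OF w, of y] by (auto simp: kl_P_def in_keys_iff)
      then have "len y \<le> len x" "y \<in> carrier W" using A(4)[of y] y bleD[of y w] by force+
      then have "bar_coeff x y = 0" using bar_coeff_triangular[of y x] x y by auto
      then show "ring_bar (P y w) * bar_coeff x y = 0" by simp
    qed
  qed (use A in auto)
  also have "\<dots> = ring_bar (P x w) + (\<Sum>y\<in>A. ring_bar (P y w) * bar_coeff x y)"
    using A bar_coeff_triangular[of x x] x by simp
  finally show ?thesis by (simp add: algebra_simps)
qed

text \<open>At a longest index with nonzero multiplier no other term of the sum has a
  coefficient.\<close>

lemma C_independent:
  assumes "finite I" "I \<subseteq> carrier W" "(\<Sum>y\<in>I. hecke_scale (m y) (C y)) = 0" "y \<in> I"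
  shows "m y = 0"
proof (rule ccontr)
  assume "m y \<noteq> 0"
  let ?J = "{y \<in> I. m y \<noteq> 0}"
  have "?J \<noteq> {}" "finite ?J" using assms \<open>m y \<noteq> 0\<close> by auto
  then obtain z where z: "z \<in> ?J" "\<And>w. w \<in> ?J \<Longrightarrow> len w \<le> len z"
    using ex_arg_max[of ?J len] by blast
  have "0 = (\<Sum>y\<in>I. m y * lk (C y) z)" using assms(3) by (metis (no_types, lifting) lookup_hecke_scale lookup_sum lookup_zero sum.cong)
  also have "\<dots> = (\<Sum>y\<in>I. if y = z then m z else 0)"
  proof (rule sum.cong)
    fix y assume y: "y \<in> I"
    then have yc: "y \<in> carrier W" using assms by blast
    show "m y * lk (C y) z = (if y = z then m z else 0)"
    proof (cases "y = z \<or> m y = 0")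
      case True
      then show ?thesis using kl_element_D(3)[OF kl_element_C[OF yc]] by auto
    next
      case False
      then have "len y \<le> len z" using z(2) y by auto
      then have "\<not> ble z y" using bleD[of z y] ble_len_eq[of z y] False by auto
      then have "lk (C y) z = 0" using kl_element_D(5)[OF kl_element_C[OF yc]] by blast
      then show ?thesis using False by simp
    qed
  qed simp
  also have "\<dots> = m z" using z(1) assms(1) by simp
  finally show False using z(1) by simp
qed

abbreviation Mu where "Mu \<equiv> kl_M W S \<Gamma>p \<H>"

text \<open>The definite description in \<open>kl_M\<close> is resolved here: \<open>C_step\<close>
  supplies a solution, and linear independence of the \<open>C y\<close> its uniqueness.\<close>

lemma Mu_properties:
  assumes s: "s \<in> S" and w: "w \<in> carrier W" and sw: "len w < len (s \<otimes> w)"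
  shows "z \<notin> descents_below s w \<Longrightarrow> Mu s z w = 0" "ring_bar (Mu s z w) = Mu s z w"
    "Ls s (C w) = C (s \<otimes> w) + (\<Sum>y\<in>descents_below s w. hecke_scale (Mu s y w) (C y))"
proof -
  let ?I = "descents_below s w"
  have I: "?I \<subseteq> carrier W" by (auto simp: descents_below_def)
  have ex: "\<And>z. z \<in> ?I \<Longrightarrow> kl_element z (C z) \<and> Ts_eigen s (C z)"
    using kl_element_C Ts_eigen_C I s descents_below_iff by blast
  have "\<exists>m. (\<forall>z. z \<notin> ?I \<longrightarrow> m z = 0) \<and> (\<forall>z. ring_bar (m z) = m z) \<and>
     kl_element (s \<otimes> w) (Ls s (C w) - (\<Sum>z\<in>?I. hecke_scale (m z) (C z))) \<and>
     Ts_eigen s (Ls s (C w) - (\<Sum>z\<in>?I. hecke_scale (m z) (C z)))"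
    by (rule C_step[OF s w sw kl_element_C[OF w] ex])
  then obtain m where
    m: "\<forall>z. z \<notin> ?I \<longrightarrow> m z = 0" "\<forall>z. ring_bar (m z) = m z"
     "kl_element (s \<otimes> w) (Ls s (C w) - (\<Sum>z\<in>?I. hecke_scale (m z) (C z)))" by (elim exE conjE)
  have "Ls s (C w) - (\<Sum>z\<in>?I. hecke_scale (m z) (C z)) = C (s \<otimes> w)"
    using kl_element_unique[OF m(3)] kl_element_C s w by simp
  then have m3: "Ls s (C w) = C (s \<otimes> w) + (\<Sum>z\<in>?I. hecke_scale (m z) (C z))" by (simp add: algebra_simps)
  let ?R = "\<lambda>m. (\<forall>y. y \<notin> ?I \<longrightarrow> m y = 0) \<and>
         C s \<star> C w = C (s \<otimes> w) + (\<Sum>y\<in>?I. hecke_scale (m y) (C y))"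
  have "(THE m. ?R m) = m"
  proof (rule the_equality)
    show "?R m" using m m3 C_S_mult[OF s kl_element_D(1)[OF kl_element_C[OF w]]] by simp
    fix m' assume m': "?R m'"
    then have "(\<Sum>y\<in>?I. hecke_scale (m y) (C y)) = (\<Sum>y\<in>?I. hecke_scale (m' y) (C y))"
      using m3 C_S_mult[OF s kl_element_D(1)[OF kl_element_C[OF w]]] by simp
    then have "(\<Sum>y\<in>?I. hecke_scale (m y - m' y) (C y)) = 0"
      by (simp add: hecke_scale_diff_left sum_subtractf)
    then have "m y - m' y = 0" if "y \<in> ?I" for y
      using C_independent[OF finite_descents_below I, of "\<lambda>y. m y - m' y"] that by blast
    then show "m' = m" using m m' by (intro ext) (metis eq_iff_diff_eq_0)
  qed
  then have "Mu s z w = m z" for z unfolding kl_M_def descents_below_def Let_def by metis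
  then show "z \<notin> ?I \<Longrightarrow> Mu s z w = 0" "ring_bar (Mu s z w) = Mu s z w"
    "Ls s (C w) = C (s \<otimes> w) + (\<Sum>y\<in>?I. hecke_scale (Mu s y w) (C y))" using m m3 by auto
qed

text \<open>Comparing coefficients at z in the expansion of C s times C w turns the expression into
  \<open>P z (s \<otimes> w) - P (s \<otimes> z) w\<close>, a difference of two negative elements.
  Being bar-invariant, \<open>Mu s z w\<close> is thereby determined by \<open>P\<close> and by the
  \<open>Mu s y w\<close> with y longer than z. The set A is free as in
  \<open>P_bar\<close>.\<close>

lemma Mu_negative:
  assumes s: "s \<in> S" and w: "w \<in> carrier W" and sw: "len w < len (s \<otimes> w)"
    and z: "z \<in> carrier W" "len (s \<otimes> z) < len z" "z \<noteq> s \<otimes> w"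
    and A: "finite A" "z \<notin> A" "\<And>y. \<lbrakk>y \<in> descents_below s w; len z < len y\<rbrakk> \<Longrightarrow> y \<in> A"
  shows "neg (Q s * P z w - (\<Sum>y\<in>A. Mu s y w * P z y) - Mu s z w)"
proof -
  let ?I = "descents_below s w"
  have "lk (Ls s (C w)) z = P (s \<otimes> z) w + Q s * P z w"
    using lk_Ls[OF kl_element_D(1)[OF kl_element_C[OF w]] s z(1)] z by (simp add: kl_P_def)
  moreover have "lk (Ls s (C w)) z = P z (s \<otimes> w) + (\<Sum>y\<in>?I. Mu s y w * P z y)"
    unfolding Mu_properties(3)[OF s w sw] by (simp add: lookup_add lookup_sum kl_P_def)
  moreover have "(\<Sum>y\<in>?I. Mu s y w * P z y) = (\<Sum>y\<in>insert z A. Mu s y w * P z y)"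
  proof -
    have 0: "P z y = 0" if y: "y \<in> ?I" "y \<notin> insert z A" for y
    proof -
      have "\<not> len z < len y" using A(3)[OF y(1)] y(2) by blast
      then have "y \<in> carrier W" "len y \<le> len z" using y(1) by (auto simp: descents_below_def)
      then show ?thesis using P_ble[of y z] ble_len_eq[of z y] bleD[of z y] y by force
    qed
    have "(\<Sum>y\<in>?I. Mu s y w * P z y) = (\<Sum>y\<in>?I \<union> insert z A. Mu s y w * P z y)"
      by (rule sum.mono_neutral_left)
        (use A finite_descents_below Mu_properties(1)[OF s w sw] in auto)
    also have "\<dots> = (\<Sum>y\<in>insert z A. Mu s y w * P z y)"
    proof (rule sum.mono_neutral_right)
      show "\<forall>y\<in>?I \<union> insert z A - insert z A. Mu s y w * P z y = 0"
      proof
        fix y assume "y \<in> ?I \<union> insert z A - insert z A"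
        then have "P z y = 0" using 0[of y] by blast
        then show "Mu s y w * P z y = 0" by simp
      qed
    qed (use A(1) finite_descents_below in auto)
    finally show ?thesis .
  qed
  moreover have "(\<Sum>y\<in>insert z A. Mu s y w * P z y) = Mu s z w + (\<Sum>y\<in>A. Mu s y w * P z y)"
    using A P_self z by simp
  ultimately have eq: "Q s * P z w - (\<Sum>y\<in>A. Mu s y w * P z y) - Mu s z w = P z (s \<otimes> w) - P (s \<otimes> z) w"
    by (simp add: algebra_simps)
  have "s \<otimes> z \<noteq> w" using s z by auto
  then show ?thesis unfolding eq using P_neg s w z by (intro negative_diff) auto
qed

end

section \<open>Periodicity\<close>

context translation_class begin

text \<open>For x of positive depth the choice is forced by \<open>deep_unique\<close>; elsewhere
  the value has no meaning.\<close>

definition shift where "shift k x = x \<otimes> (SOME u. deep u 1 x) [^] (k::nat)"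

lemma shift_eq:
  assumes "deep u r x" "1 \<le> r"
  shows "shift k x = x \<otimes> u [^] k"
proof -
  have "deep u 1 x" using assms deep_mono by blast
  then have "deep (SOME u. deep u 1 x) 1 x" by (rule someI)
  then show ?thesis unfolding shift_def using deep_unique[OF _ assms(1) _ assms(2)] by auto
qed

lemma deep_shift':
  assumes "deep u r x" "1 \<le> r"
  shows "deep u (r + k) (shift k x)" "len (shift k x) = len x + k * M"
  using deep_shift[OF assms] deep_straight[OF assms] shift_eq[OF assms] by simp_all

text \<open>The common image has positive depth and so belongs to only one element of U; the same
  power is then cancelled.\<close>

lemma shift_inj:
  assumes "deep u r x" "1 \<le> r" "deep u' r' x'" "1 \<le> r'" "shift k x = shift k x'"
  shows "x = x'"
proof -
  have "deep u (r + k) (shift k x)" "deep u' (r' + k) (shift k x)"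
    using deep_shift'(1)[of u r x k] deep_shift'(1)[of u' r' x' k] assms by auto
  then have "u = u'" using deep_unique assms by (meson trans_le_add1)
  then show ?thesis using assms shift_eq[of u r x k] shift_eq[of u' r' x' k] deepD by auto
qed

text \<open>The depth required of y is the one that \<open>deep_ble\<close> guarantees for elements
  below w.\<close>

definition layer where
  "layer r w lo = {y. (\<exists>u. deep u (r - (len w - len y)) y) \<and> lo < len y \<and> len y \<le> len w}"

lemma finite_layer: "finite (layer r w lo)"
  by (rule finite_subset[OF _ finite_len_le[of "len w"]]) (auto simp: layer_def dest: deepD)

text \<open>The condition \<open>n < r\<close> keeps the depth positive throughout the layer, so
  that shifts are injective there; conversely k blocks can be split off from every element of the
  second layer.\<close>

lemma bij_betw_layer:
  assumes "deep u r w" "len w = lo + n" "n < r"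
  shows "bij_betw (shift k) (layer r w lo) (layer (r + k) (shift k w) (lo + k * M))"
proof (rule bij_betw_imageI)
  have d: "1 \<le> r - (len w - len y)" if "lo < len y" for y using that assms by simp
  show "inj_on (shift k) (layer r w lo)"
  proof (rule inj_onI)
    fix x y assume xy: "x \<in> layer r w lo" "y \<in> layer r w lo" "shift k x = shift k y"
    then obtain u v where "deep u (r - (len w - len x)) x" "deep v (r - (len w - len y)) y" "lo < len x" "lo < len y"
      unfolding layer_def by blast
    then show "x = y" using shift_inj d xy(3) by blast
  qed
  have lw: "len (shift k w) = len w + k * M" using deep_shift'(2)[OF assms(1)] assms by simp
  show "shift k ` layer r w lo = layer (r + k) (shift k w) (lo + k * M)"
  proof (intro equalityI subsetI)
    fix y' assume "y' \<in> shift k ` layer r w lo"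
    then obtain y v where y: "y' = shift k y" "deep v (r - (len w - len y)) y" "lo < len y" "len y \<le> len w"
      by (auto simp: layer_def)
    have "deep v (r - (len w - len y) + k) y'" "len y' = len y + k * M"
      using deep_shift'[OF y(2) d[OF y(3)]] y(1) by auto
    \<comment> \<open>Truncated subtraction: the equation is valid because the depth is positive
      before k is added.\<close>
    moreover have "r - (len w - len y) + k = r + k - (len w + k * M - (len y + k * M))"
      using d[OF y(3)] by simp
    ultimately show "y' \<in> layer (r + k) (shift k w) (lo + k * M)"
      using y lw by (auto simp: layer_def)
  next
    fix y' assume "y' \<in> layer (r + k) (shift k w) (lo + k * M)"
    then obtain v where v: "deep v (r + k - (len w + k * M - len y')) y'" "lo + k * M < len y'" "len y' \<le> len w + k * M"
      by (auto simp: layer_def lw)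
    let ?q = "r - (len w + k * M - len y')"
    have q: "r + k - (len w + k * M - len y') = ?q + k" "1 \<le> ?q" using v assms by auto
    then obtain y where y: "deep v ?q y" "y' = y \<otimes> v [^] k" "len y' = len y + k * M"
      using deep_split v by metis
    have "y' = shift k y" using y q shift_eq by simp
    moreover have "y \<in> layer r w lo" using y v by (auto simp: layer_def)
    ultimately show "y' \<in> shift k ` layer r w lo" by blast
  qed
qed

end

locale kl_translation = kl_setting W S \<Gamma>p v \<H> + translation_class W S U M
  for W (structure) and S and \<Gamma>p :: "'g::ab_group_add set" and v \<H> U M
begin

text \<open>By triangularity the coefficient only records whether the two arguments are equal, which
  an injective shift respects.\<close>

lemma bar_coeff_shift_le:
  assumes "deep u r x" "deep u' r w" "1 \<le> r" "len w \<le> len x"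
  shows "bar_coeff (shift k x) (shift k w) = bar_coeff x w"
proof -
  have "shift k x = shift k w \<longleftrightarrow> x = w" using assms shift_inj by blast
  moreover have "len (shift k w) \<le> len (shift k x)" using assms deep_shift'(2) by simp
  moreover have "shift k x \<in> carrier W" "shift k w \<in> carrier W" "x \<in> carrier W" "w \<in> carrier W"
    using assms deep_shift'(1) deepD by blast+
  ultimately show ?thesis using assms bar_coeff_triangular by simp
qed

text \<open>Letters are removed from the right of \<open>w = w0 u'\<close>: \<open>a\<close> is the prefix of \<open>u'\<close> still to be treated, and as long as
  all letters of \<open>b\<close> were descents of \<open>x\<close>, the other argument is \<open>x1 = x b\<inverse>\<close>. The first ascent lowers \<open>N\<close>; if there is none, then
  \<open>u = u'\<close>.\<close>

lemma bar_coeff_shift_block: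
  assumes IH: "\<And>u u' r x w. \<lbrakk>deep u r x; deep u' r w; len w \<le> len x + N; N * M < r\<rbrakk> \<Longrightarrow>
        bar_coeff (shift k x) (shift k w) = bar_coeff x w"
    and x: "deep u r x" and r: "Suc N * M < r"
    and w0: "deep u' (r - 1) w0" and w: "len (w0 \<otimes> u') = len w0 + M" "len w0 + M \<le> len x + Suc N"
    and a: "a \<in> carrier W" "b \<in> carrier W" "a \<otimes> b = u'" "len a + len b = M"
    and x1: "x1 \<otimes> b = x" "len x = len x1 + len b" "deep t (r - len b) x1" 
  shows "bar_coeff (shift k x1) (w0 \<otimes> u' [^] k \<otimes> a) = bar_coeff x1 (w0 \<otimes> a)"
  using a x1
proof (induction "len a" arbitrary: a b x1 t)
  case 0
  then have a: "a = \<one>" using len_eq_0 by auto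
  have c: "w0 \<in> carrier W" "u' \<in> U" "x1 \<in> carrier W" using deepD[OF w0] deepD[OF 0(8)] by auto
  have b: "b = u'" using 0 a by simp
  have lx: "len (x1 \<otimes> u') = len x1 + M" using 0 b U_len c by simp
  then have "deep u' 1 x" using deepI[of x1 u' 1] c 0(6) b by simp
  moreover have "1 \<le> r" using r by simp
  ultimately have u: "u = u'" using deep_unique[OF x] by simp
  have "deep (conj_by b t) (r - len b) (x1 \<otimes> b)" using deep_mult[OF 0(8) 0(3)] 0 by simp
  moreover have rb: "1 \<le> r - len b" using r 0 by simp
  ultimately have "conj_by b t = u'" using deep_unique x 0(6) u \<open>1 \<le> r\<close> by metis
  \<comment> \<open>The conjugate of t by u' is u' itself, so t = u'. Both arguments thus acquire
    the same right factor \<open>u' [^] k\<close>, which \<open>bar_coeff_mult_right\<close>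
    removes.\<close>
  then have "t \<otimes> u' = u' \<otimes> u'" using b c deepD[OF 0(8)] 
    by (metis U_closed conj_by_def inv_mult_cancel(2) m_assoc m_closed inv_closed)
  then have "t = u'" using c deepD[OF 0(8)] by simp
  then have "shift k x1 = x1 \<otimes> u' [^] k" using shift_eq[OF 0(8) rb] by simp
  moreover have "bar_coeff (x1 \<otimes> u' [^] k) (w0 \<otimes> u' [^] k) = bar_coeff x1 w0"
    using straight_pow[OF c(3,2) lx, of k] straight_pow[OF c(1,2) w(1), of k] len_U_pow[OF c(2), of k] c
    by (intro bar_coeff_mult_right) auto
  ultimately show ?case using a c by simp
next
  case (Suc m)
  then have "a \<noteq> \<one>" by auto
  then obtain s a' where a': "s \<in> S" "a' \<in> carrier W" "a = a' \<otimes> s" "len a = Suc (len a')"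
    using last_letter[OF Suc.prems(1)] by metis
  have c: "w0 \<in> carrier W" "u' \<in> U" "x1 \<in> carrier W" "t \<in> U" "b \<in> carrier W" 
    using deepD[OF w0] deepD[OF Suc.prems(7)] Suc.prems by auto
  have c': "u' [^] k \<in> carrier W" using c by simp
  have M: "1 \<le> M" using Suc.prems a' by simp
  have rb: "1 \<le> r - len b" "M < r" using r Suc.prems(4) a' by auto
  have as: "a \<otimes> s = a'" "w0 \<otimes> a \<otimes> s = w0 \<otimes> a'" "w0 \<otimes> u' [^] k \<otimes> a \<otimes> s = w0 \<otimes> u' [^] k \<otimes> a'"
    using a' c c' by (simp_all add: m_assoc S_invol)
  have "w0 \<otimes> a \<otimes> b = w0 \<otimes> u'" using Suc.prems c by (simp add: m_assoc)
  then have lw: "len (w0 \<otimes> a) = len w0 + len a" "len (w0 \<otimes> a') = len w0 + len a'"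
    using len_mult[of "w0 \<otimes> a" b] len_mult[of w0 a] len_mult[of w0 a'] len_right[of s "w0 \<otimes> a'"] w(1) c Suc.prems a'
    by (auto simp: m_assoc)
  have "w0 \<otimes> u' [^] k \<otimes> a \<otimes> b = w0 \<otimes> u' [^] Suc k" using Suc.prems c by (simp add: m_assoc)
  then have "len w0 + Suc k * M \<le> len (w0 \<otimes> u' [^] k \<otimes> a) + len b"
    using len_mult[of "w0 \<otimes> u' [^] k \<otimes> a" b] straight_pow[OF c(1,2) w(1), of "Suc k"] c Suc.prems by simp
  moreover have "len (w0 \<otimes> u' [^] k \<otimes> a') \<le> len w0 + k * M + len a'"
    using len_mult[of "w0 \<otimes> u' [^] k" a'] len_pow_le[OF c(2,1), of k] c a' by simp
  ultimately have lw': "len (w0 \<otimes> u' [^] k \<otimes> a') < len (w0 \<otimes> u' [^] k \<otimes> a)" using Suc.prems a' by simp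
  note deep = Suc.prems(7)
  have X: "shift k x1 = x1 \<otimes> t [^] k" using shift_eq[OF deep rb(1)] .
  have Xs: "shift k x1 \<otimes> s = x1 \<otimes> s \<otimes> conj_by s t [^] k"
    unfolding X using mult_pow_conj_by[of s t x1 k] c a' by simp
  have iff: "len (shift k x1 \<otimes> s) < len (shift k x1) \<longleftrightarrow> len (x1 \<otimes> s) < len x1"
    unfolding X using deep_right_iff[OF deep rb(1) a'(1)] .
  have Xc: "shift k x1 \<in> carrier W" unfolding X using c by simp
  have R: "bar_coeff x1 (w0 \<otimes> a) = (if len (x1 \<otimes> s) < len x1 then bar_coeff (x1 \<otimes> s) (w0 \<otimes> a')
       else bar_coeff (x1 \<otimes> s) (w0 \<otimes> a') - \<xi> s * bar_coeff x1 (w0 \<otimes> a'))"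
    using bar_coeff_right[of s "w0 \<otimes> a" x1] as lw a' c Suc.prems by simp
  have R': "bar_coeff (shift k x1) (w0 \<otimes> u' [^] k \<otimes> a) = (if len (x1 \<otimes> s) < len x1 
       then bar_coeff (shift k x1 \<otimes> s) (w0 \<otimes> u' [^] k \<otimes> a')
       else bar_coeff (shift k x1 \<otimes> s) (w0 \<otimes> u' [^] k \<otimes> a') - \<xi> s * bar_coeff (shift k x1) (w0 \<otimes> u' [^] k \<otimes> a'))"
    using bar_coeff_right[of s "w0 \<otimes> u' [^] k \<otimes> a" "shift k x1"] as lw' iff a' c c' Xc Suc.prems by simp
  show ?case
  proof (cases "len (x1 \<otimes> s) < len x1")
    case True
    have ab: "a' \<otimes> (s \<otimes> b) = u'" using a' Suc.prems c by (simp add: m_assoc)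
    \<comment> \<open>As u' has full length M, prefixing s to b lengthens it, and the enlarged b is
      again a reduced suffix of u'.\<close>
    have "M \<le> len a' + len (s \<otimes> b)" using len_mult[of a' "s \<otimes> b"] ab a' c U_len by simp
    then have lsb: "len (s \<otimes> b) = Suc (len b)" using len_left[of s b] a' c Suc.prems by auto
    have "r - len b = Suc (r - len (s \<otimes> b))" unfolding lsb using rb by simp
    then have d: "deep (conj_by s t) (r - len (s \<otimes> b)) (x1 \<otimes> s)" using deep_down[OF _ a'(1) True] deep by metis
    have "x1 \<otimes> s \<otimes> (s \<otimes> b) = x" using Suc.prems a' c by (simp add: m_assoc)
    moreover have "len x = len (x1 \<otimes> s) + len (s \<otimes> b)" using len_right[of s x1] True lsb Suc.prems a' c by auto
    ultimately have "bar_coeff (shift k (x1 \<otimes> s)) (w0 \<otimes> u' [^] k \<otimes> a') = bar_coeff (x1 \<otimes> s) (w0 \<otimes> a')"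
      using Suc.hyps(1)[of a' "s \<otimes> b" "x1 \<otimes> s" "conj_by s t"] Suc.hyps(2) a' c ab lsb Suc.prems d by simp
    moreover have "1 \<le> r - len (s \<otimes> b)" unfolding lsb using r Suc.prems(4) a' by auto
    then have "shift k (x1 \<otimes> s) = shift k x1 \<otimes> s" unfolding Xs using shift_eq[OF d] by blast
    ultimately show ?thesis using R R' True by simp
  next
    case False
    then have up: "len x1 < len (x1 \<otimes> s)" using len_right[of s x1] a' c by auto
    \<comment> \<open>The ascent lowers the difference of lengths, so that the hypothesis for N
      covers both terms. Fewer than M letters have been removed before this one; all depths are
      lowered to the common value r - M, which still exceeds N M.\<close>
    have d1: "deep (conj_by s t) (r - M) (x1 \<otimes> s)" "deep t (r - M) x1"
      using deep_up[OF deep a'(1) up] deep deep_mono[of _ "r - len b" _ "r - M"] Suc.prems(4) by auto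
    have "deep (conj_by a' u') (r - 1) (w0 \<otimes> a')" using deep_mult[OF w0 a'(2) lw(2)] .
    then have d2: "deep (conj_by a' u') (r - M) (w0 \<otimes> a')" using deep_mono M by (meson diff_le_mono2)
    have rM: "1 \<le> r - M" using rb by simp
    have Wk: "shift k (w0 \<otimes> a') = w0 \<otimes> u' [^] k \<otimes> a'"
      using shift_eq[OF d2 rM] mult_pow_conj_by[of a' u' w0 k] a' c by simp
    have Xk: "shift k (x1 \<otimes> s) = shift k x1 \<otimes> s" unfolding Xs using shift_eq[OF d1(1) rM] .
    have NM: "N * M < r - M" using r by simp
    have l: "len (w0 \<otimes> a') \<le> len x1 + N" using lw w(2) a' Suc.prems by simp
    then have l': "len (w0 \<otimes> a') \<le> len (x1 \<otimes> s) + N" using up by simp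
    show ?thesis using R R' False IH[OF d1(1) d2 l' NM] IH[OF d1(2) d2 l NM] Wk Xk by simp
  qed
qed

text \<open>The difference is bounded by N instead of being fixed, since in one of the terms it
  drops by 2. Each step of the induction treats a whole last block, with nothing removed at the
  start.\<close>

lemma bar_coeff_shift:
  assumes "deep u r x" "deep u' r w" "len w \<le> len x + N" "N * M < r"
  shows "bar_coeff (shift k x) (shift k w) = bar_coeff x w"
  using assms
proof (induction N arbitrary: u u' r x w)
  case 0
  then show ?case using bar_coeff_shift_le[of u r x u' w k] by simp
next
  case (Suc N)
  have "deep u' (r - 1 + 1) w" using Suc.prems by simp
  then obtain w0 where w0: "deep u' (r - 1) w0" "w = w0 \<otimes> u' [^] (1::nat)" "len w = len w0 + 1 * M"
    using deep_split by blast
  have u': "u' \<in> U" "w0 \<in> carrier W" using deepD[OF w0(1)] by auto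
  then have w: "w = w0 \<otimes> u'" "len (w0 \<otimes> u') = len w0 + M" using w0 by auto
  have "shift k w = w0 \<otimes> u' \<otimes> u' [^] k" using shift_eq[OF Suc.prems(2), of k] Suc.prems(4) w by simp
  also have "\<dots> = w0 \<otimes> u' [^] k \<otimes> u'" using mult_pow_conj_by[of u' u' w0 k] u' by simp
  finally have W: "shift k w = w0 \<otimes> u' [^] k \<otimes> u'" .
  have "bar_coeff (shift k x) (w0 \<otimes> u' [^] k \<otimes> u') = bar_coeff x (w0 \<otimes> u')"
    by (rule bar_coeff_shift_block[where b = \<one> and t = u, OF Suc.IH Suc.prems(1) Suc.prems(4) w0(1) w(2)])
      (use u' w Suc.prems deepD[OF Suc.prems(1)] U_len in auto)
  then show ?case using W w by simp
qed

text \<open>Of x only the depth r - n is assumed, and no relation between u and u': an element y of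
  the layer, to which the induction is applied, comes with no more than that.\<close>

lemma P_shift:
  assumes w: "deep u' r w" and "len w = len x + n" "deep u (r - n) x" "n * (M + 1) < r"
  shows "P (shift k x) (shift k w) = P x w"
  using assms(2-)
proof (induction n arbitrary: x u rule: less_induct)
  case (less n)
  have nr: "n < r" using less.prems(3) by (metis le_add2 le_less_trans mult.right_neutral mult_le_mono2)
  have r1: "1 \<le> r" "1 \<le> r - n" using nr by auto
  have c: "w \<in> carrier W" "x \<in> carrier W" using w less.prems deepD by blast+
  have c': "shift k w \<in> carrier W" "shift k x \<in> carrier W"
    using deep_shift'(1)[OF w r1(1)] deep_shift'(1)[OF less.prems(2) r1(2)] deepD by blast+
  have lw: "len (shift k w) = len w + k * M" "len (shift k x) = len x + k * M"
    using deep_shift'(2)[OF w r1(1)] deep_shift'(2)[OF less.prems(2) r1(2)] by blast+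
  have eq: "shift k x = shift k w \<longleftrightarrow> x = w" using shift_inj[OF w r1(1) less.prems(2) r1(2)] by metis
  show ?case
  proof (cases "x = w")
    case True
    then show ?thesis using P_self c c' by simp
  next
    case False
    let ?A = "layer r w (len x)" and ?A' = "layer (r + k) (shift k w) (len (shift k x))"
    have A: "y \<in> layer r w (len x)" if "ble y w" "len x < len y" "deep u' r w" for r w x y u'
      using deep_ble[OF that(1,3)] bleD[OF that(1)] that(2) unfolding layer_def by blast
    have Ac: "layer r w lo \<subseteq> carrier W" for r w lo by (auto simp: layer_def dest: deepD)
    have notin: "x \<notin> layer r w (len x)" for r w x by (simp add: layer_def)
    have bij: "bij_betw (shift k) ?A ?A'"
      using bij_betw_layer[OF w less.prems(1) nr] lw by simp
    have "(\<Sum>y\<in>?A. ring_bar (P y w) * bar_coeff x y) =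
        (\<Sum>y\<in>?A. ring_bar (P (shift k y) (shift k w)) * bar_coeff (shift k x) (shift k y))"
    proof (rule sum.cong)
      fix y assume "y \<in> ?A"
      then obtain t where t: "deep t (r - (len w - len y)) y" "len x < len y" "len y \<le> len w"
        by (auto simp: layer_def)
      let ?m = "len w - len y"
      have m: "?m < n" "len w = len y + ?m" using t less.prems by auto
      have "?m * (M + 1) \<le> n * (M + 1)" using m by (intro mult_le_mono1) simp
      then have 1: "P (shift k y) (shift k w) = P y w" using less.IH[OF m(1,2) t(1)] less.prems by simp
      have "deep t (r - n) y" using deep_mono[OF t(1)] m by simp
      \<comment> \<open>Both x and y have depth r - n, and their lengths differ by at most n; the
        bound is the hypothesis rearranged.\<close>
      moreover have "n * M < r - n" using less.prems(3) nr by (simp add: algebra_simps)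
      ultimately have 2: "bar_coeff (shift k x) (shift k y) = bar_coeff x y"
        using bar_coeff_shift[OF less.prems(2)] t less.prems(1) by simp
      show "ring_bar (P y w) * bar_coeff x y = ring_bar (P (shift k y) (shift k w)) * bar_coeff (shift k x) (shift k y)"
        using 1 2 by simp
    qed simp
    also have "\<dots> = (\<Sum>y\<in>?A'. ring_bar (P y (shift k w)) * bar_coeff (shift k x) y)"
      using sum.reindex_bij_betw[OF bij] .
    finally have sum: "(\<Sum>y\<in>?A. ring_bar (P y w) * bar_coeff x y) = (\<Sum>y\<in>?A'. ring_bar (P y (shift k w)) * bar_coeff (shift k x) y)" .
    have "P x w - ring_bar (P x w) = (\<Sum>y\<in>?A. ring_bar (P y w) * bar_coeff x y)"
      by (rule P_bar[OF c False finite_layer notin Ac]) (use A[OF _ _ w] in blast)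
    moreover have "P (shift k x) (shift k w) - ring_bar (P (shift k x) (shift k w)) =
       (\<Sum>y\<in>?A'. ring_bar (P y (shift k w)) * bar_coeff (shift k x) y)"
      by (rule P_bar[OF c' _ finite_layer notin Ac]) (use False eq A[OF _ _ deep_shift'(1)[OF w r1(1)]] in blast)+
    ultimately show ?thesis using negative_antisym_unique[OF cone] P_neg c c' False eq sum by metis
  qed
qed

text \<open>Apart from the wanted element, the expression in \<open>Mu_negative\<close> is invariant
  term by term, and a bar-invariant element is unique modulo negative ones. The sums run over the
  part of a layer on which s is a left descent; shifts preserve this part by
  \<open>deep_left_iff\<close>.\<close>

lemma Mu_shift:
  assumes s: "s \<in> S" and w: "deep u' r w" and sw: "len w < len (s \<otimes> w)"
    and "len w = len x + n" "deep u (r - n) x" "n * (M + 1) < r" "len (s \<otimes> x) < len x"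
  shows "Mu s (shift k x) (shift k w) = Mu s x w"
  using assms(4-)
proof (induction n arbitrary: x u rule: less_induct)
  case (less n)
  have nr: "n < r" using less.prems(3) by (metis le_add2 le_less_trans mult.right_neutral mult_le_mono2)
  have r1: "1 \<le> r" "1 \<le> r - n" using nr by auto
  have c: "w \<in> carrier W" "x \<in> carrier W" using w less.prems deepD by blast+
  have c': "shift k w \<in> carrier W" "shift k x \<in> carrier W"
    using deep_shift'(1)[OF w r1(1)] deep_shift'(1)[OF less.prems(2) r1(2)] deepD by blast+
  have lw: "len (shift k w) = len w + k * M" "len (shift k x) = len x + k * M"
    using deep_shift'(2)[OF w r1(1)] deep_shift'(2)[OF less.prems(2) r1(2)] by blast+
  have left_iff: "len (s \<otimes> shift k y) < len (shift k y) \<longleftrightarrow> len (s \<otimes> y) < len y"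
    if "deep t q y" "1 \<le> q" for t q y
    using deep_left_iff[OF that s] shift_eq[OF that] by simp
  have sw': "len (shift k w) < len (s \<otimes> shift k w)"
    using left_iff[OF w r1(1)] sw len_left[OF s c'(1)] by auto
  have sx': "len (s \<otimes> shift k x) < len (shift k x)"
    using left_iff[OF less.prems(2) r1(2)] less.prems(4) by blast
  have ne: "x \<noteq> s \<otimes> w" "shift k x \<noteq> s \<otimes> shift k w" using sw sw' lw less.prems(1) by auto
  let ?d = "\<lambda>y. len (s \<otimes> y) < len y"
  let ?A = "{y \<in> layer r w (len x). ?d y}" 
  let ?A' = "{y \<in> layer (r + k) (shift k w) (len (shift k x)). ?d y}"
  have A: "y \<in> {y \<in> layer r w (len x). ?d y}" if "y \<in> descents_below s w" "len x < len y" "deep u' r w" for r w x y u'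
  proof -
    have "?d y" "bless y w" using descents_below_iff[OF s] that by auto
    then have "ble y w" by (auto simp: ble_def dest: blessD)
    then show ?thesis using deep_ble[OF _ that(3)] bleD[of y w] that(2) \<open>?d y\<close> unfolding layer_def by blast
  qed
  have fin: "finite {y \<in> layer r w lo. ?d y}" for r w lo
    by (rule finite_subset[OF _ finite_layer]) auto
  have notin: "x \<notin> {y \<in> layer r w (len x). ?d y}" for r w x by (simp add: layer_def)
  have bij0: "bij_betw (shift k) (layer r w (len x)) (layer (r + k) (shift k w) (len (shift k x)))"
    using bij_betw_layer[OF w less.prems(1) nr] lw by simp
  have d_iff: "?d (shift k y) \<longleftrightarrow> ?d y" if y: "y \<in> layer r w (len x)" for y
  proof -
    obtain t where t: "deep t (r - (len w - len y)) y" "len x < len y"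
      using y unfolding layer_def by blast
    have "1 \<le> r - (len w - len y)" using t(2) less.prems(1) nr by simp
    from left_iff[OF t(1) this] show ?thesis .
  qed
  have bij: "bij_betw (shift k) ?A ?A'"
  proof (rule bij_betw_imageI)
    show "inj_on (shift k) ?A" using bij0 by (auto simp: bij_betw_def inj_on_def)
    note surj = bij_betw_imp_surj_on[OF bij0]
    show "shift k ` ?A = ?A'"
    proof (intro equalityI subsetI)
      fix y' assume "y' \<in> shift k ` ?A"
      then obtain y where y: "y' = shift k y" "y \<in> layer r w (len x)" "?d y" by blast
      then have "y' \<in> layer (r + k) (shift k w) (len (shift k x))" using surj by blast
      then show "y' \<in> ?A'" using y(3) d_iff[OF y(2)] by (simp add: y(1))
    next
      fix y' assume y': "y' \<in> ?A'"
      then obtain y where y: "y' = shift k y" "y \<in> layer r w (len x)" using surj by blast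
      then have "y \<in> ?A" using y' d_iff[OF y(2)] by simp
      then show "y' \<in> shift k ` ?A" using y(1) by blast
    qed
  qed
  have "(\<Sum>y\<in>?A. Mu s y w * P x y) =
      (\<Sum>y\<in>?A. Mu s (shift k y) (shift k w) * P (shift k x) (shift k y))"
  proof (rule sum.cong)
    fix y assume y: "y \<in> ?A"
    then obtain t where t: "deep t (r - (len w - len y)) y" "len x < len y" "len y \<le> len w"
      by (auto simp: layer_def)
    let ?m = "len w - len y" and ?l = "len y - len x"
    have m: "?m < n" "len w = len y + ?m" "len y = len x + ?l" "n = ?m + ?l" using t less.prems by auto
    have "?m * (M + 1) \<le> n * (M + 1)" using m by (intro mult_le_mono1) simp
    then have 1: "Mu s (shift k y) (shift k w) = Mu s y w" using less.IH[OF m(1,2) t(1)] less.prems y by simp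
    \<comment> \<open>In \<open>P x y\<close> the element y takes the part of w, at depth
      \<open>r - ?m\<close> and distance \<open>?l\<close>. The budget for n pays for both, the loss
      of depth \<open>?m\<close> being at most \<open>?m * (M + 1)\<close>.\<close>
    have "n * (M + 1) = ?m * (M + 1) + ?l * (M + 1)" using m(4) by (metis add_mult_distrib)
    moreover have "?m \<le> ?m * (M + 1)" by simp
    ultimately have "?l * (M + 1) < r - ?m" using less.prems(3) by linarith
    moreover have "r - ?m - ?l = r - n" using m(4) by simp
    ultimately have 2: "P (shift k x) (shift k y) = P x y"
      using P_shift[OF t(1) m(3)] less.prems(2) by simp
    show "Mu s y w * P x y = Mu s (shift k y) (shift k w) * P (shift k x) (shift k y)"
      using 1 2 by simp
  qed simp
  also have "\<dots> = (\<Sum>y\<in>?A'. Mu s y (shift k w) * P (shift k x) y)"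
    using sum.reindex_bij_betw[OF bij] .
  finally have sum: "(\<Sum>y\<in>?A. Mu s y w * P x y) = (\<Sum>y\<in>?A'. Mu s y (shift k w) * P (shift k x) y)" .
  have n1: "neg (Q s * P x w - (\<Sum>y\<in>?A. Mu s y w * P x y) - Mu s x w)"
    by (rule Mu_negative[OF s c(1) sw c(2) less.prems(4) ne(1) fin notin A[OF _ _ w]])
  have n2: "neg (Q s * P (shift k x) (shift k w) - (\<Sum>y\<in>?A'. Mu s y (shift k w) * P (shift k x) y) - Mu s (shift k x) (shift k w))"
    by (rule Mu_negative[OF s c'(1) sw' c'(2) sx' ne(2) fin notin A[OF _ _ deep_shift'(1)[OF w r1(1)]]])
  have p: "P (shift k x) (shift k w) = P x w" using P_shift[OF w less.prems(1-3)] .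
  have n2': "neg (Q s * P x w - (\<Sum>y\<in>?A. Mu s y w * P x y) - Mu s (shift k x) (shift k w))"
    using n2 unfolding sum p .
  show ?case
    by (rule negative_sym_unique[OF cone n2' n1 Mu_properties(2)[OF s c'(1) sw'] Mu_properties(2)[OF s c(1) sw]])
qed

end

section \<open>Alcove geometry\<close>

lemma coroot_eval_linear: "linear (coroot_eval \<alpha>)"
  by (rule linearI) (simp_all add: coroot_eval_def inner_add_left add_divide_distrib distrib_left)

lemmas coroot_eval_simps [simp] = 
  linear_add[OF coroot_eval_linear] linear_diff[OF coroot_eval_linear]
  linear_neg[OF coroot_eval_linear] linear_0[OF coroot_eval_linear]

lemma coroot_eval_scaleR [simp]: "coroot_eval \<alpha> (r *\<^sub>R x) = r * coroot_eval \<alpha> x"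
  using linear_scale[OF coroot_eval_linear] by simp

lemma coroot_eval_self [simp]: "\<alpha> \<noteq> 0 \<Longrightarrow> coroot_eval \<alpha> \<alpha> = 2"
  by (simp add: coroot_eval_def)

lemma coroot_eval_minus_left: "coroot_eval (- \<alpha>) x = - coroot_eval \<alpha> x"
  by (simp add: coroot_eval_def)

lemma coroot_eval_inner: "coroot_eval \<alpha> x = ((2 / (\<alpha> \<bullet> \<alpha>)) *\<^sub>R \<alpha>) \<bullet> x"
  by (simp add: coroot_eval_def inner_commute)

lemma continuous_coroot_eval [continuous_intros]:
  fixes \<alpha> :: "'a::euclidean_space"
  shows "continuous_on A (coroot_eval \<alpha>)"
  by (rule linear_continuous_on[OF linear_conv_bounded_linear[THEN iffD1, OF coroot_eval_linear]])

text \<open>The linear reflection is a self-adjoint isometry, so it can be moved from x to the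
  root.\<close>

lemma coroot_eval_reflect:
  fixes \<alpha> \<beta> :: "'a::euclidean_space"
  assumes "\<alpha> \<noteq> 0"
  shows "coroot_eval \<beta> (x - coroot_eval \<alpha> x *\<^sub>R \<alpha>) = coroot_eval (\<beta> - coroot_eval \<alpha> \<beta> *\<^sub>R \<alpha>) x"
proof -
  let ?b = "\<beta> - coroot_eval \<alpha> \<beta> *\<^sub>R \<alpha>"
  have a: "\<alpha> \<bullet> \<alpha> \<noteq> 0" using assms by simp
  have "?b \<bullet> ?b = \<beta> \<bullet> \<beta>"
    using a by (simp add: coroot_eval_def inner_diff_left inner_diff_right inner_commute field_simps)
  moreover have "x \<bullet> ?b = (x - coroot_eval \<alpha> x *\<^sub>R \<alpha>) \<bullet> \<beta>"
    using a by (simp add: coroot_eval_def inner_diff_left inner_diff_right inner_commute field_simps)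
  ultimately show ?thesis by (simp only: coroot_eval_def[of \<beta>] coroot_eval_def[of ?b])
qed

lemma mem_affine_hyperplane: "x \<in> affine_hyperplane \<alpha> k \<longleftrightarrow> coroot_eval \<alpha> x = of_int k"
  by (simp add: affine_hyperplane_def)

lemma coroot_eval_affine_reflection:
  "\<alpha> \<noteq> 0 \<Longrightarrow> coroot_eval \<alpha> (affine_reflection \<alpha> k x) = 2 * of_int k - coroot_eval \<alpha> x"
  by (simp add: affine_reflection_def algebra_simps)

lemma affine_reflection_invol [simp]:
  assumes "\<alpha> \<noteq> 0" shows "affine_reflection \<alpha> k (affine_reflection \<alpha> k x) = x"
  unfolding affine_reflection_def[of \<alpha> k "affine_reflection \<alpha> k x"] coroot_eval_affine_reflection[OF assms]
  by (simp add: affine_reflection_def algebra_simps)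

definition is_mirror_image :: "'a::euclidean_space set \<Rightarrow> 'a \<Rightarrow> 'a \<Rightarrow> bool" where
  "is_mirror_image H x y \<longleftrightarrow> midpoint x y \<in> H \<and> (\<forall>a\<in>H. \<forall>b\<in>H. (x - y) \<bullet> (a - b) = 0)"

lemma is_mirror_image_unique:
  assumes "is_mirror_image H x y" "is_mirror_image H x z"
  shows "y = z"
proof -
  have "midpoint x y - midpoint x z = (1/2) *\<^sub>R (y - z)"
    by (simp add: midpoint_def algebra_simps)
  moreover have "(x - y) \<bullet> (midpoint x y - midpoint x z) = 0" "(x - z) \<bullet> (midpoint x y - midpoint x z) = 0"
    using assms unfolding is_mirror_image_def by blast+
  ultimately have "(x - y) \<bullet> (y - z) = 0" "(x - z) \<bullet> (y - z) = 0" by simp_all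
  then have "(y - z) \<bullet> (y - z) = 0" by (simp add: inner_diff_left)
  then show ?thesis by simp
qed

lemma is_mirror_image_affine_reflection:
  assumes "\<alpha> \<noteq> 0" shows "is_mirror_image (affine_hyperplane \<alpha> k) x (affine_reflection \<alpha> k x)"
proof -
  have "coroot_eval \<alpha> (midpoint x (affine_reflection \<alpha> k x)) = of_int k"
    using assms by (simp add: midpoint_def coroot_eval_affine_reflection)
  moreover have "(x - affine_reflection \<alpha> k x) \<bullet> (a - b) = 0"
    if "coroot_eval \<alpha> a = of_int k" "coroot_eval \<alpha> b = of_int k" for a b
  proof -
    have "coroot_eval \<alpha> (a - b) = 0" using that by simp
    then have "\<alpha> \<bullet> (a - b) = 0" using assms by (simp add: coroot_eval_def inner_commute)
    then show ?thesis by (simp add: affine_reflection_def)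
  qed
  ultimately show ?thesis by (simp add: is_mirror_image_def mem_affine_hyperplane)
qed

definition hrefl :: "'a::euclidean_space set \<Rightarrow> 'a \<Rightarrow> 'a" where
  "hrefl H x = (THE y. is_mirror_image H x y)"

lemma hrefl_eqI: "is_mirror_image H x y \<Longrightarrow> hrefl H x = y"
  unfolding hrefl_def using is_mirror_image_unique by blast

lemma hrefl_affine_hyperplane: "\<alpha> \<noteq> 0 \<Longrightarrow> hrefl (affine_hyperplane \<alpha> k) = affine_reflection \<alpha> k"
  using hrefl_eqI is_mirror_image_affine_reflection by blast

section \<open>The group Omega and its action on hyperplanes\<close>

locale affine_arrangement =
  fixes \<Phi> \<Phi>p :: "'a::euclidean_space set"
  assumes rs: "root_system \<Phi>" and pos: "positive_roots \<Phi> \<Phi>p"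
begin

abbreviation invf :: "('a \<Rightarrow> 'a) \<Rightarrow> 'a \<Rightarrow> 'a" where "invf \<equiv> inv_into UNIV"
abbreviation c where "c \<equiv> coroot_eval"
abbreviation hyps where "hyps \<equiv> hyperplanes \<Phi>p"
abbreviation Om where "Om \<equiv> Omega \<Phi>p"

lemma finite_pos: "finite \<Phi>p"
  using rs pos unfolding root_system_def positive_roots_def by auto

lemma pos_subset: "\<Phi>p \<subseteq> \<Phi>"
  using pos unfolding positive_roots_def by auto

lemma pos_nonzero [simp]: "\<alpha> \<in> \<Phi>p \<Longrightarrow> \<alpha> \<noteq> 0"
  using rs pos_subset unfolding root_system_def by auto

lemma root_pos_or_neg:
  assumes "\<alpha> \<in> \<Phi>" shows "\<alpha> \<in> \<Phi>p \<or> - \<alpha> \<in> \<Phi>p"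
proof -
  obtain \<xi> where \<xi>: "\<forall>\<alpha>\<in>\<Phi>. \<alpha> \<bullet> \<xi> \<noteq> 0" "\<Phi>p = {\<alpha> \<in> \<Phi>. 0 < \<alpha> \<bullet> \<xi>}"
    using pos unfolding positive_roots_def by blast
  have nz: "\<alpha> \<noteq> 0" using assms rs unfolding root_system_def by auto
  have "\<alpha> - c \<alpha> \<alpha> *\<^sub>R \<alpha> \<in> \<Phi>" using assms rs unfolding root_system_def by blast
  moreover have "\<alpha> - c \<alpha> \<alpha> *\<^sub>R \<alpha> = - \<alpha>" using nz by (simp add: scaleR_2)
  ultimately have "- \<alpha> \<in> \<Phi>" by simp
  moreover have "\<alpha> \<bullet> \<xi> > 0 \<or> (- \<alpha>) \<bullet> \<xi> > 0" using \<xi>(1) assms by (auto simp: neq_iff)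
  ultimately show ?thesis using \<xi>(2) assms by blast
qed

lemma hypsI [simp]: "\<alpha> \<in> \<Phi>p \<Longrightarrow> affine_hyperplane \<alpha> k \<in> hyps"
  unfolding hyperplanes_def by blast

lemma hypsE:
  assumes "H \<in> hyps" obtains \<alpha> k where "\<alpha> \<in> \<Phi>p" "H = affine_hyperplane \<alpha> k"
  using assms unfolding hyperplanes_def by blast

lemma reflection_form:
  assumes "\<alpha> \<in> \<Phi>p" "\<beta> \<in> \<Phi>p"
  shows "\<exists>\<gamma>\<in>\<Phi>p. \<exists>e\<in>{1, -1::real}. \<exists>m::int. \<forall>x. c \<beta> (affine_reflection \<alpha> k x) = e * c \<gamma> x + of_int m"
proof -
  let ?b = "\<beta> - c \<alpha> \<beta> *\<^sub>R \<alpha>"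
  have b: "?b \<in> \<Phi>" "c \<beta> \<alpha> \<in> \<int>" using assms pos_subset rs unfolding root_system_def by blast+
  obtain i where i: "c \<beta> \<alpha> = of_int i" using b(2) by (auto elim: Ints_cases)
  have "affine_reflection \<alpha> k x = (x - c \<alpha> x *\<^sub>R \<alpha>) + of_int k *\<^sub>R \<alpha>" for x
    by (simp add: affine_reflection_def algebra_simps)
  then have "c \<beta> (affine_reflection \<alpha> k x) = c ?b x + of_int (k * i)" for x
    using coroot_eval_reflect[of \<alpha> \<beta> x] assms i by (simp del: coroot_eval_simps(2) add: coroot_eval_simps(1))
  moreover have "\<exists>\<gamma>\<in>\<Phi>p. \<exists>e\<in>{1, -1::real}. \<forall>x. c ?b x = e * c \<gamma> x"
  proof (cases "?b \<in> \<Phi>p")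
    case True
    then show ?thesis by (intro bexI[of _ ?b] bexI[of _ 1]) auto
  next
    case False
    then have "- ?b \<in> \<Phi>p" using root_pos_or_neg b by blast
    moreover have "c ?b x = (-1) * c (- ?b) x" for x using coroot_eval_minus_left[of ?b x] by simp
    ultimately show ?thesis by (intro bexI[of _ "- ?b"] bexI[of _ "-1"]) auto
  qed
  ultimately show ?thesis by metis
qed

lemma BijGroup_simps: "carrier (BijGroup (UNIV::'a set)) = {f. bij f}" 
  "bij f \<Longrightarrow> bij g \<Longrightarrow> f \<otimes>\<^bsub>BijGroup (UNIV::'a set)\<^esub> g = f \<circ> g" "\<one>\<^bsub>BijGroup (UNIV::'a set)\<^esub> = id"
  by (auto simp: BijGroup_def Bij_def compose_def)

lemma bij_affine_reflection: "\<alpha> \<in> \<Phi>p \<Longrightarrow> bij (affine_reflection \<alpha> k)"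
  by (rule o_bij[of "affine_reflection \<alpha> k"]) (auto simp: fun_eq_iff)

lemma Om_subgroup: "subgroup Om (BijGroup UNIV)"
  unfolding Omega_def by (rule group.generate_is_subgroup[OF group_BijGroup])
    (auto simp: BijGroup_simps bij_affine_reflection)

lemma Om_bij: "\<sigma> \<in> Om \<Longrightarrow> bij \<sigma>"
  using subgroup.subset[OF Om_subgroup] by (auto simp: BijGroup_simps)

lemma Om_id [simp]: "id \<in> Om"
  using subgroup.one_closed[OF Om_subgroup] by (simp add: BijGroup_simps)

lemma Om_comp [simp]: "\<sigma> \<in> Om \<Longrightarrow> \<tau> \<in> Om \<Longrightarrow> \<sigma> \<circ> \<tau> \<in> Om"
  using subgroup.m_closed[OF Om_subgroup, of \<sigma> \<tau>] by (simp add: BijGroup_simps Om_bij)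

lemma Om_reflection [simp]: "\<alpha> \<in> \<Phi>p \<Longrightarrow> affine_reflection \<alpha> k \<in> Om"
  unfolding Omega_def by (rule generate.incl) blast

lemma Om_inv [simp]:
  assumes "\<sigma> \<in> Om" shows "invf \<sigma> \<in> Om"
proof -
  have "restrict (invf \<sigma>) UNIV \<in> Om"
    using subgroup.m_inv_closed[OF Om_subgroup assms] inv_BijGroup[of \<sigma> UNIV] Om_bij[OF assms]
    by (simp add: Bij_def)
  moreover have "restrict (invf \<sigma>) UNIV = invf \<sigma>" by (auto simp: fun_eq_iff)
  ultimately show ?thesis by simp
qed

lemma Om_induct [consumes 1, case_names id refl]:
  assumes "\<sigma> \<in> Om" "P id" 
    "\<And>\<alpha> k \<sigma>. \<lbrakk>\<alpha> \<in> \<Phi>p; \<sigma> \<in> Om; P \<sigma>\<rbrakk> \<Longrightarrow> P (affine_reflection \<alpha> k \<circ> \<sigma>)"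
  shows "P \<sigma>"
proof -
  let ?G = "BijGroup (UNIV::'a set)" and ?R = "{affine_reflection \<alpha> k | \<alpha> k. \<alpha> \<in> \<Phi>p}"
  have "\<forall>\<tau>. \<tau> \<in> Om \<and> P \<tau> \<longrightarrow> P (\<rho> \<circ> \<tau>)" if "\<rho> \<in> generate ?G ?R" for \<rho>
    using that
  proof (induction rule: generate.induct)
    case one
    then show ?case by (simp add: BijGroup_simps)
  next
    case (incl h)
    then obtain \<alpha> k where "h = affine_reflection \<alpha> k" "\<alpha> \<in> \<Phi>p" by blast
    then show ?case using assms(3) by blast
  next
    case (inv h)
    then obtain \<alpha> k where h: "h = affine_reflection \<alpha> k" "\<alpha> \<in> \<Phi>p" by blast
    have "inv\<^bsub>?G\<^esub> h = h"
      by (rule group.inv_equality[OF group_BijGroup])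
        (auto simp: h BijGroup_simps bij_affine_reflection fun_eq_iff)
    then show ?case using assms(3) h by metis
  next
    case (eng h1 h2)
    have h: "h1 \<in> Om" "h2 \<in> Om" using eng(1,2) unfolding Omega_def by blast+
    then have "h1 \<otimes>\<^bsub>?G\<^esub> h2 = h1 \<circ> h2" using BijGroup_simps(2) Om_bij by blast
    then show ?case using eng(3,4) h Om_comp by (metis comp_assoc)
  qed
  from this[of \<sigma>] have "P (\<sigma> \<circ> id)" using assms(1,2) unfolding Omega_def[symmetric] using Om_id by blast
  then show ?thesis by simp
qed

text \<open>Linear parts stay in Omega because the reflections of level 0 belong to it: composing
  with a reflection of level k composes the linear part with the one of level 0.\<close>

lemma Om_linear_part:
  assumes "\<sigma> \<in> Om"
  shows "(\<lambda>x. \<sigma> x - \<sigma> 0) \<in> Om \<and> orthogonal_transformation (\<lambda>x. \<sigma> x - \<sigma> 0)"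
  using assms
proof (induction rule: Om_induct)
  case id
  show ?case using Om_id by (simp add: id_def)
next
  case (refl \<alpha> k \<sigma>)
  let ?r = "affine_reflection \<alpha> 0" and ?L = "\<lambda>x. \<sigma> x - \<sigma> 0"
  have lin: "linear ?r" unfolding affine_reflection_def
    by (rule linearI) (simp_all add: algebra_simps)
  have nr: "?r x \<bullet> ?r y = x \<bullet> y" for x y
  proof -
    have "\<alpha> \<bullet> \<alpha> \<noteq> 0" using refl(1) by simp
    then show ?thesis unfolding affine_reflection_def coroot_eval_def
      by (simp add: inner_diff_left inner_diff_right inner_commute field_simps)
  qed
  have "(\<lambda>x. (affine_reflection \<alpha> k \<circ> \<sigma>) x - (affine_reflection \<alpha> k \<circ> \<sigma>) 0) = ?r \<circ> ?L"
    by (auto simp: affine_reflection_def algebra_simps fun_eq_iff)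
  moreover have "?r \<circ> ?L \<in> Om" using refl Om_comp[of ?r ?L] by simp
  moreover have "orthogonal_transformation (?r \<circ> ?L)"
    using refl lin nr by (intro orthogonal_transformation_compose) (auto simp: orthogonal_transformation_def)
  ultimately show ?case by simp
qed

lemma Om_inner: "\<sigma> \<in> Om \<Longrightarrow> (\<sigma> a - \<sigma> b) \<bullet> (\<sigma> x - \<sigma> y) = (a - b) \<bullet> (x - y)"
proof -
  assume s: "\<sigma> \<in> Om"
  let ?L = "\<lambda>x. \<sigma> x - \<sigma> 0"
  have o: "orthogonal_transformation ?L" using Om_linear_part[OF s] by blast
  then have l: "linear ?L" by (rule orthogonal_transformation_linear)
  have "\<sigma> a - \<sigma> b = ?L (a - b)" "\<sigma> x - \<sigma> y = ?L (x - y)" 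
    using linear_diff[OF l, of a b] linear_diff[OF l, of x y] by simp_all
  then show ?thesis using o by (simp add: orthogonal_transformation_def)
qed

lemma Om_affine:
  assumes "\<sigma> \<in> Om" shows "\<sigma> ((1 - t) *\<^sub>R x + t *\<^sub>R y) = (1 - t) *\<^sub>R \<sigma> x + t *\<^sub>R \<sigma> y"
proof -
  let ?L = "\<lambda>x. \<sigma> x - \<sigma> 0"
  have l: "linear ?L" using Om_linear_part[OF assms] orthogonal_transformation_linear by blast
  have "?L ((1 - t) *\<^sub>R x + t *\<^sub>R y) = (1 - t) *\<^sub>R ?L x + t *\<^sub>R ?L y"
    using linear_add[OF l] linear_scale[OF l] by simp
  then show ?thesis by (simp add: algebra_simps)
qed

lemma Om_segment: "\<sigma> \<in> Om \<Longrightarrow> \<sigma> ` closed_segment x y = closed_segment (\<sigma> x) (\<sigma> y)"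
  by (auto simp: closed_segment_def image_iff Om_affine) (metis Om_affine)

text \<open>Up to sign and an integer, Omega permutes the functions \<open>c \<beta>\<close>. Hence
  it maps hyperplanes to hyperplanes, and evaluation of a translation at 0 shows that its vector is
  integral (\<open>translate_integral\<close>).\<close>

lemma Om_form:
  assumes "\<sigma> \<in> Om" "\<beta> \<in> \<Phi>p"
  shows "\<exists>\<gamma>\<in>\<Phi>p. \<exists>e\<in>{1, -1::real}. \<exists>m::int. \<forall>x. c \<beta> (\<sigma> x) = e * c \<gamma> x + of_int m"
  using assms
proof (induction arbitrary: \<beta> rule: Om_induct)
  case id
  then show ?case by (intro bexI[of _ \<beta>] bexI[of _ 1] exI[of _ 0]) auto
next
  case (refl \<alpha> k \<sigma>)
  obtain \<gamma> e m where 1: "\<gamma> \<in> \<Phi>p" "e \<in> {1, -1::real}" "\<And>x. c \<beta> (affine_reflection \<alpha> k x) = e * c \<gamma> x + of_int m"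
    using reflection_form[OF refl(1,4)] by metis
  obtain \<delta> d n where 2: "\<delta> \<in> \<Phi>p" "d \<in> {1, -1::real}" "\<And>x. c \<gamma> (\<sigma> x) = d * c \<delta> x + of_int n"
    using refl(3)[OF 1(1)] by metis
  have "e * of_int n + of_int m = of_int ((if e = 1 then n else - n) + m)" using 1(2) by auto
  then have "\<forall>x. c \<beta> ((affine_reflection \<alpha> k \<circ> \<sigma>) x) = (e * d) * c \<delta> x + of_int ((if e = 1 then n else - n) + m)"
    using 1 2 by (simp add: algebra_simps)
  moreover have "e * d \<in> {1, -1}" using 1(2) 2(2) by auto
  ultimately show ?case using 2(1) by blast
qed

lemma Om_hyps:
  assumes "\<sigma> \<in> Om" "H \<in> hyps" shows "\<sigma> ` H \<in> hyps"
proof -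
  obtain \<alpha> k where H: "\<alpha> \<in> \<Phi>p" "H = affine_hyperplane \<alpha> k" using hypsE assms by blast
  obtain \<gamma> e m where f: "\<gamma> \<in> \<Phi>p" "e \<in> {1, -1::real}" "\<And>x. c \<alpha> (invf \<sigma> x) = e * c \<gamma> x + of_int m"
    using Om_form[OF Om_inv[OF assms(1)] H(1)] by metis
  have "\<sigma> ` H = {y. invf \<sigma> y \<in> H}" using bij_image_Collect_eq[OF Om_bij[OF assms(1)], of "\<lambda>x. x \<in> H"] by simp
  also have "\<dots> = affine_hyperplane \<gamma> (if e = 1 then k - m else m - k)"
    using f(2) by (auto simp: H(2) mem_affine_hyperplane f(3))
  finally show ?thesis using f(1) by simp
qed

lemma hrefl_Om: "H \<in> hyps \<Longrightarrow> hrefl H \<in> Om"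
  by (elim hypsE) (simp add: hrefl_affine_hyperplane)

lemma hrefl_invol [simp]: "H \<in> hyps \<Longrightarrow> hrefl H (hrefl H x) = x"
  by (elim hypsE) (simp add: hrefl_affine_hyperplane)

lemma hrefl_comp [simp]: "H \<in> hyps \<Longrightarrow> hrefl H \<circ> hrefl H = id"
  by (auto simp: fun_eq_iff)

lemma hrefl_fix: "H \<in> hyps \<Longrightarrow> x \<in> H \<Longrightarrow> hrefl H x = x"
  by (elim hypsE) (simp add: hrefl_affine_hyperplane affine_reflection_def mem_affine_hyperplane)

lemma hrefl_mirror: "H \<in> hyps \<Longrightarrow> is_mirror_image H x (hrefl H x)"
  by (elim hypsE) (simp add: hrefl_affine_hyperplane is_mirror_image_affine_reflection)

lemma hrefl_conj:
  assumes "\<sigma> \<in> Om" "H \<in> hyps"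
  shows "hrefl (\<sigma> ` H) (\<sigma> x) = \<sigma> (hrefl H x)"
proof (rule hrefl_eqI)
  have m: "is_mirror_image H x (hrefl H x)" using hrefl_mirror assms by blast
  have "\<sigma> (midpoint x y) = midpoint (\<sigma> x) (\<sigma> y)" for y
    using Om_affine[OF assms(1), of "1/2" x y] by (simp add: midpoint_def algebra_simps)
  then show "is_mirror_image (\<sigma> ` H) (\<sigma> x) (\<sigma> (hrefl H x))"
    using m Om_inner[OF assms(1)] unfolding is_mirror_image_def by auto (metis imageI)
qed

section \<open>Separating hyperplanes\<close>

definition Sep where "Sep p q = {H \<in> hyps. closed_segment p q \<inter> H \<noteq> {}}"
definition generic where "generic p \<longleftrightarrow> (\<forall>H\<in>hyps. p \<notin> H)"
text \<open>Segments are closed, so a hyperplane through an end point counts in \<open>Sep\<close>.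
  Tolerating those through x describes the closure of the alcove of a generic p
  (\<open>closure_alc\<close>).\<close>

definition Clos where "Clos p x \<longleftrightarrow> (\<forall>H\<in>Sep p x. x \<in> H)"

lemma Sep_hyps: "H \<in> Sep p q \<Longrightarrow> H \<in> hyps"
  by (simp add: Sep_def)

lemma Sep_sym: "Sep p q = Sep q p"
  by (simp add: Sep_def closed_segment_commute)

lemma Sep_iff:
  assumes "\<alpha> \<in> \<Phi>p"
  shows "affine_hyperplane \<alpha> k \<in> Sep p q \<longleftrightarrow> (c \<alpha> p - of_int k) * (c \<alpha> q - of_int k) \<le> 0" (is "_ \<longleftrightarrow> ?a * ?b \<le> 0")
proof
  assume "affine_hyperplane \<alpha> k \<in> Sep p q"
  then obtain t where t: "0 \<le> t" "t \<le> 1" "c \<alpha> ((1 - t) *\<^sub>R p + t *\<^sub>R q) = of_int k"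
    by (auto simp: Sep_def closed_segment_def mem_affine_hyperplane)
  then have eq: "(1 - t) * ?a + t * ?b = 0" by (simp add: algebra_simps)
  show "?a * ?b \<le> 0"
  proof (rule ccontr)
    assume "\<not> ?a * ?b \<le> 0"
    then have "(?a > 0 \<and> ?b > 0) \<or> (?a < 0 \<and> ?b < 0)" by (simp add: not_le zero_less_mult_iff)
    then show False
    proof
      assume ab: "?a > 0 \<and> ?b > 0"
      have "(1 - t) * ?a \<ge> 0" "t * ?b \<ge> 0" using t ab by simp_all
      then have "(1 - t) * ?a = 0" "t * ?b = 0" using eq by linarith+
      then show False using ab by simp
    next
      assume ab: "?a < 0 \<and> ?b < 0"
      have "(1 - t) * ?a \<le> 0" "t * ?b \<le> 0" using t ab by (simp_all add: mult_le_0_iff)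
      then have "(1 - t) * ?a = 0" "t * ?b = 0" using eq by linarith+
      then show False using ab by simp
    qed
  qed
next
  assume ab: "?a * ?b \<le> 0"
  have "\<exists>t. 0 \<le> t \<and> t \<le> 1 \<and> (1 - t) * ?a + t * ?b = 0"
  proof (cases "?a = 0")
    case True
    then show ?thesis by (intro exI[of _ 0]) auto
  next
    case False
    then have ne: "?a - ?b \<noteq> 0" using ab by (auto simp: mult_le_0_iff)
    \<comment> \<open>Along the segment the affine function runs from \<open>?a\<close> to
      \<open>?b\<close>, so this is the parameter of its zero.\<close>
    have "0 \<le> ?a / (?a - ?b)" "?a / (?a - ?b) \<le> 1"
      using ab ne by (auto simp: mult_le_0_iff divide_le_eq zero_le_divide_iff)
    moreover have "(1 - ?a / (?a - ?b)) * ?a + (?a / (?a - ?b)) * ?b = 0" using ne by (simp add: field_simps)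
    ultimately show ?thesis by blast
  qed
  then obtain t where "0 \<le> t" "t \<le> 1" "c \<alpha> ((1 - t) *\<^sub>R p + t *\<^sub>R q) = of_int k" by (auto simp: algebra_simps)
  then show "affine_hyperplane \<alpha> k \<in> Sep p q" using assms 
    by (auto simp: Sep_def closed_segment_def mem_affine_hyperplane)
qed

text \<open>Crossings count modulo 2: three points off H are distributed over two sides, so H
  separates none or two of the three pairs. All later length computations rest on this.\<close>

lemma Sep_xor:
  assumes "H \<in> hyps" "p \<notin> H" "q \<notin> H" "r \<notin> H"
  shows "H \<in> Sep p r \<longleftrightarrow> (H \<in> Sep p q) \<noteq> (H \<in> Sep q r)"
proof -
  obtain \<alpha> k where H: "\<alpha> \<in> \<Phi>p" "H = affine_hyperplane \<alpha> k" using hypsE assms by blast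
  have *: "a * d \<le> 0 \<longleftrightarrow> (a * b \<le> 0) \<noteq> (b * d \<le> 0)" if "a \<noteq> 0" "b \<noteq> 0" "d \<noteq> 0" for a b d :: real
    using that by (cases "a > 0"; cases "b > 0"; cases "d > 0") (auto simp: mult_le_0_iff)
  show ?thesis unfolding H(2) Sep_iff[OF H(1)]
    by (rule *) (use assms H in \<open>auto simp: mem_affine_hyperplane\<close>)
qed

lemma Sep_xor_generic: "\<lbrakk>generic p; generic q; generic r; H \<in> hyps\<rbrakk> \<Longrightarrow> H \<in> Sep p r \<longleftrightarrow> (H \<in> Sep p q) \<noteq> (H \<in> Sep q r)"
  using Sep_xor by (simp add: generic_def)

lemma Sep_image_iff:
  assumes "\<sigma> \<in> Om" "H \<in> hyps"
  shows "\<sigma> ` H \<in> Sep (\<sigma> p) (\<sigma> q) \<longleftrightarrow> H \<in> Sep p q"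
proof -
  have "closed_segment (\<sigma> p) (\<sigma> q) \<inter> \<sigma> ` H = \<sigma> ` (closed_segment p q \<inter> H)"
    using Om_segment[OF assms(1)] image_Int[OF bij_is_inj[OF Om_bij[OF assms(1)]]] by metis
  then show ?thesis using assms Om_hyps by (simp add: Sep_def)
qed

lemma image_inv_Om: "\<sigma> \<in> Om \<Longrightarrow> \<sigma> ` invf \<sigma> ` H = H" "\<sigma> \<in> Om \<Longrightarrow> invf \<sigma> ` \<sigma> ` H = H"
  by (simp_all only: image_comp surj_iff[THEN iffD1, OF bij_is_surj[OF Om_bij]]
        inv_o_cancel[OF bij_is_inj[OF Om_bij]] image_id id_apply)

lemma Sep_image:
  assumes "\<sigma> \<in> Om" shows "Sep (\<sigma> p) (\<sigma> q) = (`) \<sigma> ` Sep p q"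
proof (intro equalityI subsetI)
  fix H assume "H \<in> Sep (\<sigma> p) (\<sigma> q)"
  moreover then have "invf \<sigma> ` H \<in> hyps" using Om_hyps[of "invf \<sigma>"] Sep_hyps assms by simp
  ultimately have "invf \<sigma> ` H \<in> Sep p q" using Sep_image_iff[OF assms, of "invf \<sigma> ` H"] image_inv_Om[OF assms] by simp
  then show "H \<in> (`) \<sigma> ` Sep p q" using image_inv_Om[OF assms] by blast
next
  fix H assume "H \<in> (`) \<sigma> ` Sep p q"
  then show "H \<in> Sep (\<sigma> p) (\<sigma> q)" using Sep_image_iff[OF assms] Sep_hyps by blast
qed

lemma card_Sep_image: 
  assumes "\<sigma> \<in> Om" shows "card (Sep (\<sigma> p) (\<sigma> q)) = card (Sep p q)"
proof -
  have "inj ((`) \<sigma>)" using bij_is_inj[OF Om_bij[OF assms]] by (simp add: inj_image_eq_iff inj_def)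
  then show ?thesis unfolding Sep_image[OF assms] by (meson card_image inj_on_subset subset_UNIV)
qed

lemma finite_Sep: "finite (Sep p q)"
proof -
  let ?K = "\<lambda>\<alpha>. {\<lfloor>min (c \<alpha> p) (c \<alpha> q)\<rfloor>..\<lceil>max (c \<alpha> p) (c \<alpha> q)\<rceil>}"
  have "Sep p q \<subseteq> (\<Union>\<alpha>\<in>\<Phi>p. affine_hyperplane \<alpha> ` ?K \<alpha>)"
  proof
    fix H assume H: "H \<in> Sep p q"
    then obtain \<alpha> k where a: "\<alpha> \<in> \<Phi>p" "H = affine_hyperplane \<alpha> k" using hypsE Sep_hyps by blast
    then have "(c \<alpha> p - of_int k) * (c \<alpha> q - of_int k) \<le> 0" using Sep_iff H by simp
    then have "min (c \<alpha> p) (c \<alpha> q) \<le> of_int k" "of_int k \<le> max (c \<alpha> p) (c \<alpha> q)" 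
      by (auto simp: mult_le_0_iff)
    then have "k \<in> ?K \<alpha>" by (auto simp: floor_le_iff le_ceiling_iff simp del: min_le_iff_disj le_max_iff_disj)
    then show "H \<in> (\<Union>\<alpha>\<in>\<Phi>p. affine_hyperplane \<alpha> ` ?K \<alpha>)" using a by blast
  qed
  moreover have "finite (\<Union>\<alpha>\<in>\<Phi>p. affine_hyperplane \<alpha> ` ?K \<alpha>)" using finite_pos by simp
  ultimately show ?thesis by (rule finite_subset)
qed

lemma generic_image: "\<sigma> \<in> Om \<Longrightarrow> generic p \<Longrightarrow> generic (\<sigma> p)"
  unfolding generic_def
  by (metis Om_bij Om_hyps Om_inv bij_inv_eq_iff imageI)

lemma Clos_image:
  assumes "\<sigma> \<in> Om" "Clos p x" shows "Clos (\<sigma> p) (\<sigma> x)"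
  using assms(2) unfolding Clos_def Sep_image[OF assms(1)] by blast

lemma SepE:
  assumes "H \<in> Sep p q" obtains \<alpha> k where "\<alpha> \<in> \<Phi>p" "H = affine_hyperplane \<alpha> k"
  using hypsE[OF Sep_hyps[OF assms]] .

section \<open>Generic points and their alcoves\<close>

definition alc where "alc q = {y. \<forall>\<alpha>\<in>\<Phi>p. of_int \<lfloor>c \<alpha> q\<rfloor> < c \<alpha> y \<and> c \<alpha> y < of_int \<lfloor>c \<alpha> q\<rfloor> + 1}"

lemma generic_iff: "generic p \<longleftrightarrow> (\<forall>\<alpha>\<in>\<Phi>p. \<forall>k. c \<alpha> p \<noteq> of_int k)"
proof
  assume "generic p"
  then have "p \<notin> affine_hyperplane \<alpha> k" if "\<alpha> \<in> \<Phi>p" for \<alpha> k using that by (simp add: generic_def)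
  then show "\<forall>\<alpha>\<in>\<Phi>p. \<forall>k. c \<alpha> p \<noteq> of_int k" by (simp add: mem_affine_hyperplane)
qed (auto simp: generic_def mem_affine_hyperplane elim!: hypsE)

lemma open_strip: "open {y. \<forall>\<alpha>\<in>\<Phi>p. f \<alpha> < c \<alpha> y \<and> c \<alpha> y < g \<alpha>}"
proof -
  have "{y. \<forall>\<alpha>\<in>\<Phi>p. f \<alpha> < c \<alpha> y \<and> c \<alpha> y < g \<alpha>} = (\<Inter>\<alpha>\<in>\<Phi>p. {y. f \<alpha> < c \<alpha> y} \<inter> {y. c \<alpha> y < g \<alpha>})" by auto
  moreover have "open ({y. f \<alpha> < c \<alpha> y} \<inter> {y. c \<alpha> y < g \<alpha>})" for \<alpha>
    by (intro open_Int open_Collect_less continuous_intros)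
  ultimately show ?thesis using finite_pos by (simp add: open_INT)
qed

lemma open_alc: "open (alc q)"
  unfolding alc_def by (rule open_strip)

lemma mem_alc_self: "generic q \<Longrightarrow> q \<in> alc q"
  unfolding alc_def
proof (clarify, intro conjI)
  fix \<alpha> assume "generic q" "\<alpha> \<in> \<Phi>p"
  then have "c \<alpha> q \<noteq> of_int \<lfloor>c \<alpha> q\<rfloor>" by (simp add: generic_iff)
  then show "of_int \<lfloor>c \<alpha> q\<rfloor> < c \<alpha> q" "c \<alpha> q < of_int \<lfloor>c \<alpha> q\<rfloor> + 1" by linarith+
qed

text \<open>This links the box cut out by integer parts, visibly open and convex, with separation by
  hyperplanes.\<close>

lemma alc_iff:
  assumes "generic q"
  shows "y \<in> alc q \<longleftrightarrow> generic y \<and> Sep q y = {}"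
proof
  assume y: "y \<in> alc q"
  have "generic y" unfolding generic_iff
  proof (intro ballI allI notI)
    fix \<alpha> k assume "\<alpha> \<in> \<Phi>p" "c \<alpha> y = of_int k"
    then have "\<lfloor>c \<alpha> q\<rfloor> < k" "k < \<lfloor>c \<alpha> q\<rfloor> + 1" using y unfolding alc_def by (force, force)
    then show False by simp
  qed
  moreover have "Sep q y = {}"
  proof (rule ccontr)
    assume "Sep q y \<noteq> {}"
    then obtain H where H: "H \<in> Sep q y" by blast
    obtain \<alpha> k where a: "\<alpha> \<in> \<Phi>p" "affine_hyperplane \<alpha> k \<in> Sep q y" using SepE[OF H] H by metis
    let ?f = "\<lfloor>c \<alpha> q\<rfloor>"
    have b: "of_int ?f < c \<alpha> q" "c \<alpha> q < of_int ?f + 1" "of_int ?f < c \<alpha> y" "c \<alpha> y < of_int ?f + 1"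
      using y mem_alc_self[OF assms] a(1) unfolding alc_def by auto
    have "k \<le> ?f \<or> ?f + 1 \<le> k" by linarith
    then have "0 < (c \<alpha> q - of_int k) * (c \<alpha> y - of_int k)"
    proof
      assume "k \<le> ?f"
      then have "of_int k \<le> (of_int ?f :: real)" by simp
      then show ?thesis using b by (intro mult_pos_pos) linarith+
    next
      assume "?f + 1 \<le> k"
      then have "of_int ?f + 1 \<le> (of_int k :: real)" by linarith
      then show ?thesis using b by (intro mult_neg_neg) linarith+
    qed
    then show False using a Sep_iff by simp
  qed
  ultimately show "generic y \<and> Sep q y = {}" ..
next
  assume y: "generic y \<and> Sep q y = {}"
  show "y \<in> alc q" unfolding alc_def
  proof (clarify)
    fix \<alpha> assume a: "\<alpha> \<in> \<Phi>p"
    let ?f = "\<lfloor>c \<alpha> q\<rfloor>"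
    have b: "of_int ?f < c \<alpha> q" "c \<alpha> q < of_int (?f + 1)"
      using mem_alc_self[OF assms] a unfolding alc_def by auto
    have "affine_hyperplane \<alpha> ?f \<notin> Sep q y" "affine_hyperplane \<alpha> (?f + 1) \<notin> Sep q y" using y by auto
    then have "0 < (c \<alpha> q - of_int ?f) * (c \<alpha> y - of_int ?f)" 
      "0 < (c \<alpha> q - of_int (?f + 1)) * (c \<alpha> y - of_int (?f + 1))" 
      using Sep_iff[OF a] by (auto simp: not_le)
    then have "0 < c \<alpha> y - of_int ?f" "c \<alpha> y - of_int (?f + 1) < 0"
      using b by (auto simp: zero_less_mult_iff)
    then show "of_int ?f < c \<alpha> y \<and> c \<alpha> y < of_int ?f + 1" by simp
  qed
qed

lemma Sep_eq_empty: 
  assumes "generic p" "generic q" "generic r" "Sep q r = {}"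
  shows "Sep p q = Sep p r"
proof -
  have "H \<in> Sep p q \<longleftrightarrow> H \<in> Sep p r" for H
    using Sep_xor_generic[OF assms(1-3), of H] assms(4) Sep_hyps by blast
  then show ?thesis by blast
qed

lemma Sep_self: "generic p \<Longrightarrow> Sep p p = {}"
  by (auto simp: Sep_def generic_def)

lemma avoid_negligible:
  assumes "open U" "U \<noteq> {}" "negligible N"
  obtains x :: 'a where "x \<in> U" "x \<notin> N"
proof -
  have "\<not> U \<subseteq> N" using assms negligible_subset open_not_negligible by blast
  then show ?thesis using that by blast
qed

lemma negligible_finite_UN:
  "finite A \<Longrightarrow> (\<And>a. a \<in> A \<Longrightarrow> negligible (f a :: 'a set)) \<Longrightarrow> negligible (\<Union>a\<in>A. f a)"
  by (induction A rule: finite_induct) auto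

lemma negligible_affine_hyperplane: "\<alpha> \<in> \<Phi>p \<Longrightarrow> negligible (affine_hyperplane \<alpha> k)"
  unfolding affine_hyperplane_def coroot_eval_inner by (rule negligible_hyperplane) auto

lemma negligible_hyps: "negligible (\<Union>hyps)"
proof -
  have "\<Union>hyps = (\<Union>\<alpha>\<in>\<Phi>p. \<Union>k. affine_hyperplane \<alpha> k)" by (auto simp: hyperplanes_def)
  moreover have "negligible (\<Union>k. affine_hyperplane \<alpha> k)" if "\<alpha> \<in> \<Phi>p" for \<alpha>
    by (rule negligible_countable_Union) (auto simp: negligible_affine_hyperplane that)
  ultimately show ?thesis using negligible_finite_UN[OF finite_pos] by simp
qed

text \<open>The open box around x is bounded, for each root, by the nearest integers strictly below
  and strictly above the value at x. It therefore misses every hyperplane that does not contain x,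
  and it has generic points because the hyperplanes are negligible.\<close>

lemma near_point:
  obtains p where "generic p" "Clos p x"
proof -
  let ?U = "{y. \<forall>\<alpha>\<in>\<Phi>p. of_int (\<lceil>c \<alpha> x\<rceil> - 1) < c \<alpha> y \<and> c \<alpha> y < of_int (\<lfloor>c \<alpha> x\<rfloor> + 1)}"
  have "x \<in> ?U" by (auto simp: less_ceiling_iff[symmetric]) linarith+
  then obtain p where p: "p \<in> ?U" "p \<notin> \<Union>hyps" 
    using avoid_negligible[OF open_strip[of "\<lambda>\<alpha>. of_int (\<lceil>c \<alpha> x\<rceil> - 1)" "\<lambda>\<alpha>. of_int (\<lfloor>c \<alpha> x\<rfloor> + 1)"] _ negligible_hyps] by blast
  have "Clos p x" unfolding Clos_def
  proof (rule ballI, rule ccontr)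
    fix H assume H: "H \<in> Sep p x" "x \<notin> H"
    obtain \<alpha> k where a: "\<alpha> \<in> \<Phi>p" "H = affine_hyperplane \<alpha> k" using SepE[OF H(1)] .
    have b: "of_int (\<lceil>c \<alpha> x\<rceil> - 1) < c \<alpha> p" "c \<alpha> p < of_int (\<lfloor>c \<alpha> x\<rfloor> + 1)" using p(1) a(1) by auto
    have "c \<alpha> x \<noteq> of_int k" using H a by (simp add: mem_affine_hyperplane)
    then consider "of_int k < c \<alpha> x" | "c \<alpha> x < of_int k" by linarith
    then have "0 < (c \<alpha> p - of_int k) * (c \<alpha> x - of_int k)"
    proof cases
      case 1
      then have "k \<le> \<lceil>c \<alpha> x\<rceil> - 1" by (simp add: less_ceiling_iff)
      then have "of_int k \<le> (of_int (\<lceil>c \<alpha> x\<rceil> - 1) :: real)" by linarith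
      then show ?thesis using b 1 by (intro mult_pos_pos) linarith+
    next
      case 2
      then have "\<lfloor>c \<alpha> x\<rfloor> + 1 \<le> k" by linarith
      then have "of_int (\<lfloor>c \<alpha> x\<rfloor> + 1) \<le> (of_int k :: real)" by linarith
      then show ?thesis using b 2 by (intro mult_neg_neg) linarith+
    qed
    then show False using H(1) a Sep_iff by simp
  qed
  then show ?thesis using that p(2) by (auto simp: generic_def)
qed

text \<open>The ends \<open>q'\<close> of segments from \<open>p\<close> that meet two hyperplanes at once lie in countably many
  hyperplanes through \<open>p\<close>.\<close>

lemma perturb:
  assumes p: "generic p" and q: "generic q"
  obtains q' where "generic q'" "Sep q q' = {}" 
    "\<And>H H' x. \<lbrakk>H \<in> hyps; H' \<in> hyps; x \<in> closed_segment p q'; x \<in> H; x \<in> H'\<rbrakk> \<Longrightarrow> H = H'"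
proof -
  \<comment> \<open>The segment from p to y meets the two hyperplanes at parameters that are
    quotients; \<open>?F\<close> is their difference cleared of denominators.\<close>
  let ?F = "\<lambda>\<alpha> k \<beta> m y. (of_int k - c \<alpha> p) * (c \<beta> y - c \<beta> p) - (of_int m - c \<beta> p) * (c \<alpha> y - c \<alpha> p)"
  define N where "N = (\<Union>\<alpha>\<in>\<Phi>p. \<Union>\<beta>\<in>\<Phi>p. \<Union>k. \<Union>m. 
     (if affine_hyperplane \<alpha> k = affine_hyperplane \<beta> m then {} else {y. ?F \<alpha> k \<beta> m y = 0}))"
  have neg: "negligible {y. ?F \<alpha> k \<beta> m y = 0}"
    if ab: "\<alpha> \<in> \<Phi>p" "\<beta> \<in> \<Phi>p" "affine_hyperplane \<alpha> k \<noteq> affine_hyperplane \<beta> m" for \<alpha> k \<beta> m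
  proof -
    let ?a = "of_int k - c \<alpha> p" and ?b = "of_int m - c \<beta> p"
    let ?G = "?a *\<^sub>R ((2 / (\<beta> \<bullet> \<beta>)) *\<^sub>R \<beta>) - ?b *\<^sub>R ((2 / (\<alpha> \<bullet> \<alpha>)) *\<^sub>R \<alpha>)"
    have nz: "?a \<noteq> 0" "?b \<noteq> 0" using p ab(1,2) unfolding generic_iff by (metis eq_iff_diff_eq_0)+
    have F: "?F \<alpha> k \<beta> m y = ?G \<bullet> y - ?G \<bullet> p" for y
      by (simp add: coroot_eval_inner inner_diff_left algebra_simps)
    \<comment> \<open>A vanishing normal vector would make the equation hold for all y, and then the
      two hyperplanes would coincide.\<close>
    have "?G \<noteq> 0"
    proof
      assume "?G = 0"
      then have F0: "?F \<alpha> k \<beta> m y = 0" for y unfolding F by simp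
      have "c \<alpha> x = of_int k \<longleftrightarrow> c \<beta> x = of_int m" for x
      proof
        assume "c \<alpha> x = of_int k"
        then have "?a * (c \<beta> x - of_int m) = 0" using F0[of x] by (simp add: algebra_simps)
        then show "c \<beta> x = of_int m" using nz by simp
      next
        assume "c \<beta> x = of_int m"
        then have "?b * (of_int k - c \<alpha> x) = 0" using F0[of x] by (simp add: algebra_simps)
        then show "c \<alpha> x = of_int k" using nz by simp
      qed
      then show False using ab(3) by (auto simp: affine_hyperplane_def)
    qed
    moreover have "{y. ?F \<alpha> k \<beta> m y = 0} = {y. ?G \<bullet> y = ?G \<bullet> p}" unfolding F by auto
    ultimately show ?thesis by (simp only: negligible_hyperplane simp_thms)
  qed
  have "negligible (\<Union>k. \<Union>m. (if affine_hyperplane \<alpha> k = affine_hyperplane \<beta> m then {} else {y. ?F \<alpha> k \<beta> m y = 0}))"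
    if "\<alpha> \<in> \<Phi>p" "\<beta> \<in> \<Phi>p" for \<alpha> \<beta>
    using neg[OF that] by (intro negligible_countable_Union) auto
  then have "negligible N" unfolding N_def by (intro negligible_finite_UN[OF finite_pos])
  then obtain q' where q': "q' \<in> alc q" "q' \<notin> N"
    using avoid_negligible[OF open_alc _ \<open>negligible N\<close>] mem_alc_self[OF q] by blast
  show ?thesis
  proof (rule that)
    show "generic q'" "Sep q q' = {}" using q'(1) alc_iff[OF q] by auto
    fix H H' x assume H: "H \<in> hyps" "H' \<in> hyps" "x \<in> closed_segment p q'" "x \<in> H" "x \<in> H'"
    obtain \<alpha> k where a: "\<alpha> \<in> \<Phi>p" "H = affine_hyperplane \<alpha> k" using hypsE[OF H(1)] .
    obtain \<beta> m where b: "\<beta> \<in> \<Phi>p" "H' = affine_hyperplane \<beta> m" using hypsE[OF H(2)] .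
    obtain t where t: "x = (1 - t) *\<^sub>R p + t *\<^sub>R q'" using H(3) by (auto simp: closed_segment_def)
    have "of_int k - c \<alpha> p = t * (c \<alpha> q' - c \<alpha> p)" "of_int m - c \<beta> p = t * (c \<beta> q' - c \<beta> p)"
      using H(4,5) a b unfolding t by (auto simp: mem_affine_hyperplane algebra_simps)
    then have "?F \<alpha> k \<beta> m q' = 0" by simp
    then have "q' \<in> N" if "H \<noteq> H'" unfolding N_def using that a(2) b(2)
      by (intro UN_I[OF a(1)] UN_I[OF b(1)] UN_I[of k UNIV] UN_I[of m UNIV]) simp_all
    then show "H = H'" using q'(2) by blast
  qed
qed

text \<open>A hyperplane other than H misses x, hence separates neither p from x nor, by reflection
  in H, the mirror image of p from x. So it does not separate p from its mirror image.\<close>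

lemma wall:
  assumes p: "generic p" and H: "H \<in> hyps" "x \<in> H" "\<And>H'. H' \<in> hyps \<Longrightarrow> x \<in> H' \<Longrightarrow> H' = H" and cl: "Clos p x"
  shows "Sep p (hrefl H p) = {H}"
proof -
  let ?s = "hrefl H"
  have s: "?s \<in> Om" using hrefl_Om H by blast
  have sx: "?s x = x" using hrefl_fix H by blast
  have "H' \<notin> Sep p (?s p)" if H': "H' \<in> hyps" "H' \<noteq> H" for H'
  proof -
    have x': "x \<notin> H'" using H(3) H' by blast
    have sH: "?s ` ?s ` H' = H'" using H(1) by (simp add: image_comp)
    have "x \<notin> ?s ` H'" using x' sx sH by (metis imageI)
    then have "?s ` H' \<notin> Sep p x" using cl by (auto simp: Clos_def)
    then have "H' \<notin> Sep (?s p) x" using Sep_image_iff[OF s, of "?s ` H'" p x] Om_hyps[OF s H'(1)] sx sH by simp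
    moreover have "H' \<notin> Sep p x" using cl x' by (auto simp: Clos_def)
    moreover have "p \<notin> H'" "?s p \<notin> H'" using p generic_image[OF s p] H' by (auto simp: generic_def)
    ultimately show ?thesis using Sep_xor[OF H'(1), of p x "?s p"] x' Sep_sym by blast
  qed
  moreover have "H \<in> Sep p (?s p)"
  proof -
    have "midpoint p (?s p) \<in> H" using hrefl_mirror[OF H(1)] by (simp add: is_mirror_image_def)
    then show ?thesis using H(1) midpoint_in_closed_segment[of p "?s p"] unfolding Sep_def by blast
  qed
  ultimately show ?thesis using Sep_hyps by blast
qed

lemma Sep_segment_mono: "y \<in> closed_segment p x \<Longrightarrow> Sep p y \<subseteq> Sep p x"
  unfolding Sep_def using subset_closed_segment[of p y p x] by fastforce

lemma Sep_segment_inner: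
  assumes "generic p" "y \<in> closed_segment p x" "y \<noteq> x" "x \<in> H" "H \<in> hyps"
  shows "H \<notin> Sep p y"
proof -
  obtain \<alpha> k where a: "\<alpha> \<in> \<Phi>p" "H = affine_hyperplane \<alpha> k" using hypsE[OF assms(5)] .
  obtain t where t: "0 \<le> t" "t \<le> 1" "y = (1 - t) *\<^sub>R p + t *\<^sub>R x" using assms(2) by (auto simp: closed_segment_def)
  have "t \<noteq> 1" using t assms(3) by auto
  have "c \<alpha> x = of_int k" using assms(4) a by (simp add: mem_affine_hyperplane)
  then have "c \<alpha> y - of_int k = (1 - t) * (c \<alpha> p - of_int k)" unfolding t(3) by (simp add: algebra_simps)
  then have "(c \<alpha> p - of_int k) * (c \<alpha> y - of_int k) = (1 - t) * (c \<alpha> p - of_int k)\<^sup>2"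
    by (simp add: power2_eq_square)
  moreover have "c \<alpha> p \<noteq> of_int k" using assms(1) a(1) by (simp add: generic_iff)
  then have "0 < (1 - t) * (c \<alpha> p - of_int k)\<^sup>2" using t \<open>t \<noteq> 1\<close> by (intro mult_pos_pos) auto
  ultimately show ?thesis using a Sep_iff by simp
qed

text \<open>The wall is the first hyperplane met on a perturbed segment, where no two are met at the
  same point. A crossing point x with the fewest hyperplanes between p and x lies in the closure of
  the alcove of p, since an earlier crossing would leave out H.\<close>

lemma exists_wall:
  assumes p: "generic p" and q: "generic q" and ne: "Sep p q \<noteq> {}"
  obtains H where "H \<in> Sep p q" "Sep p (hrefl H p) = {H}"
proof -
  obtain q' where q': "generic q'" "Sep q q' = {}" 
    and uniq: "\<And>H H' x. \<lbrakk>H \<in> hyps; H' \<in> hyps; x \<in> closed_segment p q'; x \<in> H; x \<in> H'\<rbrakk> \<Longrightarrow> H = H'"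
    using perturb[OF p q] by metis
  have S: "Sep p q' = Sep p q" using Sep_eq_empty[OF p q q'(1,2)] by simp
  let ?X = "{x \<in> closed_segment p q'. \<exists>H\<in>hyps. x \<in> H}"
  obtain H0 where "H0 \<in> Sep p q'" using ne S by blast
  then obtain x0 where "x0 \<in> ?X" by (auto simp: Sep_def)
  then have "\<exists>x. x \<in> ?X \<and> (\<forall>y. y \<in> ?X \<longrightarrow> card (Sep p x) \<le> card (Sep p y))"
    by (rule ex_has_least_nat[where P = "\<lambda>x. x \<in> ?X"])
  then obtain x where x: "x \<in> ?X" "\<And>y. y \<in> ?X \<Longrightarrow> card (Sep p x) \<le> card (Sep p y)" by (elim exE conjE) blast
  from x(1) obtain H where H: "H \<in> hyps" "x \<in> H" by blast
  have "Clos p x" unfolding Clos_def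
  proof (rule ballI, rule ccontr)
    fix H' assume H': "H' \<in> Sep p x" "x \<notin> H'"
    then obtain y where y: "y \<in> closed_segment p x" "y \<in> H'" by (auto simp: Sep_def)
    have "H \<in> Sep p x" using H by (auto simp: Sep_def)
    moreover have "H \<notin> Sep p y" using Sep_segment_inner[OF p y(1) _ H(2,1)] H' y by blast
    ultimately have "Sep p y \<subset> Sep p x" using Sep_segment_mono[OF y(1)] by blast
    then have "card (Sep p y) < card (Sep p x)" using finite_Sep by (rule psubset_card_mono[rotated])
    moreover have "y \<in> ?X"
      using y x(1) Sep_hyps[OF H'(1)] subset_closed_segment[of p x p q'] by auto
    ultimately show False using x(2) by (meson not_le)
  qed
  then have "Sep p (hrefl H p) = {H}" using wall[OF p H] uniq x(1) H by blast
  moreover have "x \<in> closed_segment p q'" using x(1) by simp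
  then have "closed_segment p q' \<inter> H \<noteq> {}" using H(2) by blast
  then have "H \<in> Sep p q'" using H(1) by (simp add: Sep_def)
  ultimately show ?thesis using that[of H] S by simp
qed

section \<open>Words in the reflections at the walls of an alcove\<close>

definition walls where "walls p = {H \<in> hyps. Sep p (hrefl H p) = {H}}"
definition wprod where "wprod Hs = foldr (\<lambda>H g. hrefl H \<circ> g) Hs id"

lemma wprod_simps [simp]: "wprod [] = id" "wprod (H # Hs) = hrefl H \<circ> wprod Hs"
  by (simp_all add: wprod_def)

lemma wprod_append: "wprod (Hs @ Ks) = wprod Hs \<circ> wprod Ks"
  by (induction Hs) (simp_all add: comp_assoc)

lemma walls_hyps: "H \<in> walls p \<Longrightarrow> H \<in> hyps"
  by (simp add: walls_def)

lemma wprod_Om: "set Hs \<subseteq> hyps \<Longrightarrow> wprod Hs \<in> Om"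
  by (induction Hs) (auto simp: hrefl_Om)

lemma wprod_rev: "set Hs \<subseteq> hyps \<Longrightarrow> wprod (rev Hs) \<circ> wprod Hs = id"
proof (induction Hs)
  case (Cons H Hs)
  have "wprod (rev (H # Hs)) \<circ> wprod (H # Hs) = wprod (rev Hs) \<circ> (hrefl H \<circ> hrefl H) \<circ> wprod Hs"
    by (simp add: wprod_append comp_assoc)
  also have "\<dots> = wprod (rev Hs) \<circ> wprod Hs" using Cons.prems by simp
  also have "\<dots> = id" by (rule Cons.IH) (use Cons.prems in auto)
  finally show ?case .
qed simp

lemma Sep_wall_step:
  assumes "generic p" "generic q" "H \<in> walls p"
  shows "Sep (hrefl H p) q = (if H \<in> Sep p q then Sep p q - {H} else insert H (Sep p q))"
proof -
  have H: "H \<in> hyps" "Sep (hrefl H p) p = {H}" using assms(3) Sep_sym by (auto simp: walls_def)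
  have "generic (hrefl H p)" using generic_image hrefl_Om H assms by blast
  then have x: "K \<in> Sep (hrefl H p) q \<longleftrightarrow> (K = H) \<noteq> (K \<in> Sep p q)" if "K \<in> hyps" for K
    using Sep_xor_generic[of "hrefl H p" p q K] assms that H by simp
  show ?thesis
  proof (rule Set.set_eqI)
    fix K
    show "K \<in> Sep (hrefl H p) q \<longleftrightarrow> K \<in> (if H \<in> Sep p q then Sep p q - {H} else insert H (Sep p q))"
      using x[of K] Sep_hyps[of K] H(1) by (cases "K \<in> hyps") auto
  qed
qed

lemma image_hrefl_self: "H \<in> hyps \<Longrightarrow> hrefl H ` H = H"
  using hrefl_fix by (auto simp: image_iff) 

lemma Sep_wall_left:
  assumes "generic p" "generic q" "H \<in> walls p" 
  shows "card (Sep p (hrefl H q)) = card (Sep (hrefl H p) q)"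
  using card_Sep_image[OF hrefl_Om[OF walls_hyps[OF assms(3)]], of "hrefl H p" q] walls_hyps[OF assms(3)] by simp

text \<open>The induction reflects q instead of moving p, so that all letters are walls of the one
  alcove of p: if a wall separates p from q, fewer hyperplanes separate p from the mirror image of
  q.\<close>

lemma alcoves_connected:
  assumes "generic p" "generic q"
  shows "\<exists>Hs. set Hs \<subseteq> walls p \<and> Sep (wprod Hs p) q = {}"
  using assms(2)
proof (induction "card (Sep p q)" arbitrary: q rule: less_induct)
  case less
  show ?case
  proof (cases "Sep p q = {}")
    case True
    then show ?thesis by (intro exI[of _ "[]"]) auto
  next
    case False
    obtain H where H: "H \<in> Sep p q" "Sep p (hrefl H p) = {H}" using exists_wall[OF assms(1) less.prems False] .
    have Hh: "H \<in> hyps" using Sep_hyps[OF H(1)] .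
    then have Hw: "H \<in> walls p" using H by (simp add: walls_def)
    have "Sep (hrefl H p) q = Sep p q - {H}" using Sep_wall_step[OF assms(1) less.prems Hw] H by simp
    then have "card (Sep p (hrefl H q)) < card (Sep p q)"
      using Sep_wall_left[OF assms(1) less.prems Hw] card_Diff1_less[OF finite_Sep H(1)] by metis
    then obtain Hs where Hs: "set Hs \<subseteq> walls p" "Sep (wprod Hs p) (hrefl H q) = {}"
      using less.hyps generic_image[OF hrefl_Om[OF Hh] less.prems] by blast
    have "Sep (hrefl H (wprod Hs p)) (hrefl H (hrefl H q)) = {}"
      unfolding Sep_image[OF hrefl_Om[OF Hh]] Hs(2) by simp
    then show ?thesis using Hs(1) Hw Hh by (intro exI[of _ "H # Hs"]) simp
  qed
qed

lemma exists_point_on_one_hyperplane: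
  assumes "H \<in> hyps"
  obtains x where "x \<in> H" "\<And>H'. H' \<in> hyps \<Longrightarrow> x \<in> H' \<Longrightarrow> H' = H"
proof -
  obtain p where p: "generic p" using near_point .
  let ?q = "hrefl H p"
  have q: "generic ?q" using generic_image[OF hrefl_Om[OF assms] p] .
  have "midpoint p ?q \<in> H" using hrefl_mirror[OF assms] by (simp add: is_mirror_image_def)
  then have "H \<in> Sep p ?q" using assms midpoint_in_closed_segment[of p ?q] unfolding Sep_def by blast
  obtain q' where q': "generic q'" "Sep ?q q' = {}" 
    and uniq: "\<And>H H' x. \<lbrakk>H \<in> hyps; H' \<in> hyps; x \<in> closed_segment p q'; x \<in> H; x \<in> H'\<rbrakk> \<Longrightarrow> H = H'"
    using perturb[OF p q] by metis
  have "H \<in> Sep p q'" using Sep_eq_empty[OF p q q'] \<open>H \<in> Sep p ?q\<close> by simp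
  then obtain x where "x \<in> closed_segment p q'" "x \<in> H" by (auto simp: Sep_def)
  then show ?thesis using that[of x] uniq assms by blast
qed

text \<open>Take an alcove of which H is a wall and a word g that carries the alcove of p there. The
  hyperplane moved back by g is a wall of p, and the reflection in H is the conjugate by g of the
  reflection in that wall.\<close>

lemma hrefl_words:
  assumes p: "generic p" and H: "H \<in> hyps"
  shows "\<exists>Hs. set Hs \<subseteq> walls p \<and> wprod Hs = hrefl H"
proof -
  obtain x where x: "x \<in> H" "\<And>H'. H' \<in> hyps \<Longrightarrow> x \<in> H' \<Longrightarrow> H' = H"
    using exists_point_on_one_hyperplane[OF H] by metis
  obtain q where q: "generic q" "Clos q x" using near_point .
  have w: "Sep q (hrefl H q) = {H}" using wall[OF q(1) H x q(2)] .
  obtain Hs where Hs: "set Hs \<subseteq> walls p" "Sep (wprod Hs p) q = {}" using alcoves_connected[OF p q(1)] by blast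
  have Hsh: "set Hs \<subseteq> hyps" using Hs walls_hyps by blast
  define g where "g = wprod Hs"
  define g' where "g' = wprod (rev Hs)"
  have g: "g \<in> Om" "g' \<in> Om" "g' \<circ> g = id" "g \<circ> g' = id"
    using Hsh wprod_Om wprod_rev[of Hs] wprod_rev[of "rev Hs"] by (auto simp: g_def g'_def)
  have g'g: "g' (g y) = y" "g (g' y) = y" for y using g(3,4) by (metis comp_apply id_apply)+
  have s: "hrefl H \<in> Om" using hrefl_Om[OF H] .
  have gen: "generic (g p)" "generic (hrefl H q)" "generic (hrefl H (g p))" 
    using generic_image g(1) s p q by blast+
  have "Sep (hrefl H q) (hrefl H (g p)) = {}" using Hs(2) Sep_image[OF s, of q "g p"] Sep_sym g_def by simp
  then have "Sep (g p) (hrefl H (g p)) = Sep (g p) (hrefl H q)"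
    using Sep_eq_empty[OF gen(1,2,3)] by simp
  also have "\<dots> = Sep q (hrefl H q)"
    using Sep_eq_empty[OF gen(2,1) q(1)] Hs(2) Sep_sym g_def by metis
  finally have S: "Sep (g p) (hrefl H (g p)) = {H}" using w by simp
  define K where "K = g' ` H"
  have K: "K \<in> hyps" "g ` K = H" using Om_hyps[OF g(2) H] g'g by (auto simp: K_def image_comp)
  have conj: "g (hrefl K y) = hrefl H (g y)" for y using hrefl_conj[OF g(1) K(1), of y] K(2) by simp
  have "Sep (g p) (g (hrefl K p)) = {H}" using S conj by simp
  then have "(`) g ` Sep p (hrefl K p) = {H}" using Sep_image[OF g(1)] by simp
  then have "(`) g' ` (`) g ` Sep p (hrefl K p) = {K}" unfolding K_def by simp
  then have "Sep p (hrefl K p) = {K}" using g'g by (simp add: image_comp)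
  then have "K \<in> walls p" using K by (simp add: walls_def)
  moreover have "wprod (Hs @ [K] @ rev Hs) = hrefl H"
    using conj g'g by (auto simp: wprod_append fun_eq_iff g_def[symmetric] g'_def[symmetric])
  ultimately show ?thesis using Hs(1) by (intro exI[of _ "Hs @ [K] @ rev Hs"]) simp
qed

lemma Om_words:
  assumes p: "generic p" and "\<sigma> \<in> Om"
  shows "\<exists>Hs. set Hs \<subseteq> walls p \<and> wprod Hs = \<sigma>"
  using assms(2)
proof (induction rule: Om_induct)
  case id
  show ?case by (intro exI[of _ "[]"]) simp
next
  case (refl \<alpha> k \<sigma>)
  obtain Hs where Hs: "set Hs \<subseteq> walls p" "wprod Hs = \<sigma>" using refl(3) by blast
  have "affine_reflection \<alpha> k = hrefl (affine_hyperplane \<alpha> k)" using refl(1) by (simp add: hrefl_affine_hyperplane)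
  then obtain Ks where Ks: "set Ks \<subseteq> walls p" "wprod Ks = affine_reflection \<alpha> k"
    using hrefl_words[OF p hypsI[OF refl(1)], of k] by auto
  show ?case using Hs Ks by (intro exI[of _ "Ks @ Hs"]) (simp add: wprod_append)
qed

text \<open>The strong exchange condition: the alcoves along the word lead from p to its image, and
  the letter at which this path crosses H can be deleted. The induction transports H through the
  first letter.\<close>

lemma word_exchange:
  assumes p: "generic p" and "set Hs \<subseteq> walls p" "H \<in> Sep p (wprod Hs p)"
  shows "\<exists>Ks. set Ks \<subseteq> walls p \<and> Suc (length Ks) = length Hs \<and> wprod Ks = hrefl H \<circ> wprod Hs"
  using assms(2,3)
proof (induction Hs arbitrary: H)
  case Nil
  then show ?case using Sep_self[OF p] by simp
next
  case (Cons V Hs)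
  have V: "V \<in> walls p" "V \<in> hyps" using Cons.prems walls_hyps by auto
  have H: "H \<in> hyps" using Sep_hyps Cons.prems by blast
  let ?g = "wprod Hs" and ?s = "hrefl V"
  have s: "?s \<in> Om" using hrefl_Om V by blast
  have "set Hs \<subseteq> hyps" using Cons.prems walls_hyps by auto
  then have gp: "generic (?g p)" using generic_image[OF wprod_Om p] by blast
  show ?case
  proof (cases "H = V")
    case True
    then have eq: "?g = hrefl H \<circ> wprod (V # Hs)" using V by (simp add: fun_eq_iff)
    show ?thesis using Cons.prems(1) by (intro exI[of _ Hs] conjI eq) auto
  next
    case False
    let ?K = "?s ` H"
    have K: "?K \<in> hyps" "?s ` ?K = H" using Om_hyps[OF s H] V by (auto simp: image_comp)
    have "?s ` ?K \<in> Sep (?s (?s p)) (?s (?g p))" using Cons.prems(2) K V by simp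
    then have "?K \<in> Sep (?s p) (?g p)" using Sep_image_iff[OF s K(1)] by blast
    moreover have "?K \<noteq> V" using False K image_hrefl_self[OF V(2)] by auto
    ultimately have "?K \<in> Sep p (?g p)" using Sep_wall_step[OF p gp V(1)] by (auto split: if_splits)
    then have "\<exists>Ks. set Ks \<subseteq> walls p \<and> Suc (length Ks) = length Hs \<and> wprod Ks = hrefl ?K \<circ> ?g"
      by (intro Cons.IH) (use Cons.prems(1) in auto)
    then obtain Ks where Ks: "set Ks \<subseteq> walls p" "Suc (length Ks) = length Hs" "wprod Ks = hrefl ?K \<circ> ?g"
      by (elim exE conjE)
    have "?s (hrefl ?K y) = hrefl H (?s y)" for y using hrefl_conj[OF s K(1), of y] K(2) by simp
    then have "wprod (V # Ks) = hrefl H \<circ> wprod (V # Hs)" using Ks(3) by (simp add: fun_eq_iff)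
    then show ?thesis using Ks V by (intro exI[of _ "V # Ks"]) simp
  qed
qed

lemma card_Sep_word_le:
  assumes p: "generic p" and "set Hs \<subseteq> walls p"
  shows "card (Sep p (wprod Hs p)) \<le> length Hs"
  using assms(2)
proof (induction Hs)
  case Nil
  then show ?case using Sep_self[OF p] by simp
next
  case (Cons V Hs)
  have V: "V \<in> walls p" using Cons.prems by auto
  have "set Hs \<subseteq> hyps" using Cons.prems walls_hyps by auto
  then have gp: "generic (wprod Hs p)" using generic_image[OF wprod_Om p] by blast
  have "card (Sep p (wprod (V # Hs) p)) = card (Sep (hrefl V p) (wprod Hs p))"
    using Sep_wall_left[OF p gp V] by simp
  also have "\<dots> \<le> Suc (card (Sep p (wprod Hs p)))"
    using Sep_wall_step[OF p gp V] finite_Sep[of p "wprod Hs p"] 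
      card_Diff1_le[of "Sep p (wprod Hs p)" V] by (auto simp: card_insert_if)
  finally show ?case using Cons by simp
qed

text \<open>In a shortest word the first letter V does not separate p from its image under the tail;
  otherwise \<open>word_exchange\<close> would express the whole product by a word shorter by two.
  So each letter contributes one hyperplane.\<close>

lemma reduced_word_card:
  assumes p: "generic p" and "set Hs \<subseteq> walls p"
    and "\<And>Ks. \<lbrakk>set Ks \<subseteq> walls p; wprod Ks = wprod Hs\<rbrakk> \<Longrightarrow> length Hs \<le> length Ks"
  shows "card (Sep p (wprod Hs p)) = length Hs"
  using assms(2,3)
proof (induction Hs)
  case Nil
  then show ?case using Sep_self[OF p] by simp
next
  case (Cons V Hs)
  have V: "V \<in> walls p" "V \<in> hyps" using Cons.prems(1) walls_hyps by auto
  have "set Hs \<subseteq> hyps" using Cons.prems walls_hyps by auto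
  then have gp: "generic (wprod Hs p)" using generic_image[OF wprod_Om p] by blast
  have "length Hs \<le> length Ks" if "set Ks \<subseteq> walls p" "wprod Ks = wprod Hs" for Ks
    using Cons.prems(2)[of "V # Ks"] that V by simp
  then have IH: "card (Sep p (wprod Hs p)) = length Hs" using Cons by simp
  have "V \<notin> Sep p (wprod Hs p)"
  proof
    assume "V \<in> Sep p (wprod Hs p)"
    then obtain Ks where Ks: "set Ks \<subseteq> walls p" "Suc (length Ks) = length Hs" "wprod Ks = hrefl V \<circ> wprod Hs"
      using word_exchange[OF p, of Hs V] Cons.prems by auto
    then have "length (V # Hs) \<le> length Ks" by (intro Cons.prems(2)) simp_all
    then show False using Ks by simp
  qed
  then have "card (Sep (hrefl V p) (wprod Hs p)) = Suc (length Hs)"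
    using Sep_wall_step[OF p gp V(1)] finite_Sep[of p "wprod Hs p"] IH by simp
  then show ?case using Sep_wall_left[OF p gp V(1)] by simp
qed

lemma minimal_word:
  assumes p: "generic p" and "\<sigma> \<in> Om"
  obtains Hs where "set Hs \<subseteq> walls p" "wprod Hs = \<sigma>" "length Hs = card (Sep p (\<sigma> p))"
proof -
  obtain Hs0 where "set Hs0 \<subseteq> walls p \<and> wprod Hs0 = \<sigma>" using Om_words[OF assms] by blast
  then have "\<exists>Hs. (set Hs \<subseteq> walls p \<and> wprod Hs = \<sigma>) \<and> 
      (\<forall>Ks. (set Ks \<subseteq> walls p \<and> wprod Ks = \<sigma>) \<longrightarrow> length Hs \<le> length Ks)"
    by (rule ex_has_least_nat[where P = "\<lambda>Hs. set Hs \<subseteq> walls p \<and> wprod Hs = \<sigma>"])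
  then obtain Hs where Hs: "set Hs \<subseteq> walls p" "wprod Hs = \<sigma>" 
      and min: "\<forall>Ks. (set Ks \<subseteq> walls p \<and> wprod Ks = \<sigma>) \<longrightarrow> length Hs \<le> length Ks"
    by (elim exE conjE)
  have "card (Sep p (wprod Hs p)) = length Hs"
    by (rule reduced_word_card[OF p Hs(1)]) (use min Hs(2) in simp)
  then show ?thesis using that[OF Hs] Hs(2) by simp
qed

lemma Om_free:
  assumes "generic p" "\<sigma> \<in> Om" "Sep p (\<sigma> p) = {}"
  shows "\<sigma> = id"
  using minimal_word[OF assms(1,2)] assms(3) by (metis card.empty length_0_conv wprod_simps(1))

text \<open>If H separates, the exchange shortens a minimal word, and word length bounds the count.
  If H does not separate, the same is applied to the reflected element. In W this decides which
  reflections shorten an element.\<close>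

lemma card_Sep_reflection:
  assumes p: "generic p" and "\<sigma> \<in> Om" and H: "H \<in> hyps"
  shows "card (Sep p (hrefl H (\<sigma> p))) < card (Sep p (\<sigma> p)) \<longleftrightarrow> H \<in> Sep p (\<sigma> p)"
    "card (Sep p (hrefl H (\<sigma> p))) \<noteq> card (Sep p (\<sigma> p))"
proof -
  have less: "card (Sep p (hrefl H (\<sigma> p))) < card (Sep p (\<sigma> p))" if *: "\<sigma> \<in> Om" "H \<in> Sep p (\<sigma> p)" for \<sigma>
  proof -
    obtain Hs where Hs: "set Hs \<subseteq> walls p" "wprod Hs = \<sigma>" "length Hs = card (Sep p (\<sigma> p))"
      using minimal_word[OF p *(1)] by metis
    obtain Ks where Ks: "set Ks \<subseteq> walls p" "Suc (length Ks) = length Hs" "wprod Ks = hrefl H \<circ> \<sigma>"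
      using word_exchange[OF p Hs(1), of H] Hs(2) *(2) by blast
    then show ?thesis using card_Sep_word_le[OF p Ks(1)] Hs(3) by simp
  qed
  show "card (Sep p (hrefl H (\<sigma> p))) < card (Sep p (\<sigma> p)) \<longleftrightarrow> H \<in> Sep p (\<sigma> p)"
    "card (Sep p (hrefl H (\<sigma> p))) \<noteq> card (Sep p (\<sigma> p))"
  proof -
    have "card (Sep p (\<sigma> p)) < card (Sep p (hrefl H (\<sigma> p)))" if "H \<notin> Sep p (\<sigma> p)"
    proof -
      let ?t = "hrefl H \<circ> \<sigma>"
      have gen: "generic (\<sigma> p)" "generic (hrefl H (\<sigma> p))" using generic_image assms hrefl_Om by blast+
      have "midpoint (\<sigma> p) (hrefl H (\<sigma> p)) \<in> H" using hrefl_mirror[OF H] by (simp add: is_mirror_image_def)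
      then have "H \<in> Sep (\<sigma> p) (hrefl H (\<sigma> p))" 
        using H midpoint_in_closed_segment[of "\<sigma> p" "hrefl H (\<sigma> p)"] unfolding Sep_def by blast
      then have "H \<in> Sep p (?t p)" using Sep_xor_generic[OF p gen H] that by simp
      then show ?thesis using less[of ?t] Om_comp[OF hrefl_Om[OF H] assms(2)] H by simp
    qed
    note gt = this
    show "card (Sep p (hrefl H (\<sigma> p))) < card (Sep p (\<sigma> p)) \<longleftrightarrow> H \<in> Sep p (\<sigma> p)"
    proof (cases "H \<in> Sep p (\<sigma> p)")
      case True
      then show ?thesis using less[OF assms(2) True] by simp
    next
      case False
      then show ?thesis using gt[OF False] by simp
    qed
    show "card (Sep p (hrefl H (\<sigma> p))) \<noteq> card (Sep p (\<sigma> p))"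
    proof (cases "H \<in> Sep p (\<sigma> p)")
      case True
      then show ?thesis using less[OF assms(2) True] by simp
    next
      case False
      then show ?thesis using gt[OF False] by simp
    qed
  qed
qed

text \<open>Among the elements mapping \<open>x\<close> to \<open>y\<close>, one moving the alcove of \<open>p\<close> the least must fix that
  alcove: any hyperplane to be crossed contains \<open>y\<close>, and reflecting in it gives a smaller one.\<close>

lemma strict_fundamental_domain:
  assumes p: "generic p" and cl: "Clos p x" "Clos p y" and \<sigma>: "\<sigma> \<in> Om" "\<sigma> x = y"
  shows "x = y"
proof -
  have ex: "\<sigma> \<in> Om \<and> \<sigma> x = y" using \<sigma> by blast
  have "\<exists>\<tau>. (\<tau> \<in> Om \<and> \<tau> x = y) \<and> (\<forall>\<rho>. (\<rho> \<in> Om \<and> \<rho> x = y) \<longrightarrow> card (Sep p (\<tau> p)) \<le> card (Sep p (\<rho> p)))"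
    by (rule ex_has_least_nat[where P = "\<lambda>\<tau>. \<tau> \<in> Om \<and> \<tau> x = y", OF ex])
  then obtain \<tau> where \<tau>: "\<tau> \<in> Om" "\<tau> x = y" 
    and min: "\<forall>\<rho>. (\<rho> \<in> Om \<and> \<rho> x = y) \<longrightarrow> card (Sep p (\<tau> p)) \<le> card (Sep p (\<rho> p))"
    by (elim exE conjE)
  have gen: "generic (\<tau> p)" using generic_image[OF \<tau>(1) p] .
  have "Sep p (\<tau> p) = {}"
  proof (rule ccontr)
    assume ne: "Sep p (\<tau> p) \<noteq> {}"
    then obtain H where H: "H \<in> Sep p (\<tau> p)" by blast
    have Hh: "H \<in> hyps" using Sep_hyps[OF H] .
    have "y \<in> H"
    proof (rule ccontr)
      assume y: "y \<notin> H"
      have "Clos (\<tau> p) y" using Clos_image[OF \<tau>(1) cl(1)] \<tau>(2) by simp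
      then have "H \<notin> Sep p y" "H \<notin> Sep (\<tau> p) y" using cl(2) y by (auto simp: Clos_def)
      moreover have "p \<notin> H" "\<tau> p \<notin> H" using p gen Hh by (auto simp: generic_def)
      ultimately show False using Sep_xor[OF Hh, of p y "\<tau> p"] y H Sep_sym by blast
    qed
    then have "(hrefl H \<circ> \<tau>) x = y" using \<tau>(2) hrefl_fix[OF Hh] by simp
    then have "card (Sep p (\<tau> p)) \<le> card (Sep p ((hrefl H \<circ> \<tau>) p))"
      by (intro min[rule_format] conjI Om_comp[OF hrefl_Om[OF Hh] \<tau>(1)])
    then show False using card_Sep_reflection(1)[OF p \<tau>(1) Hh] H by simp
  qed
  then have "\<tau> = id" using Om_free[OF p \<tau>(1)] by blast
  then show ?thesis using \<tau>(2) by simp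
qed

section \<open>Alcoves as connected components\<close>

lemma alc_eq_iff:
  assumes "generic p" "generic q" shows "alc p = alc q \<longleftrightarrow> Sep p q = {}"
proof
  assume "alc p = alc q"
  then show "Sep p q = {}" using mem_alc_self[OF assms(2)] alc_iff[OF assms(1), of q] by simp
next
  assume S: "Sep p q = {}"
  have "Sep p y = Sep q y" if "generic y" for y
    using Sep_eq_empty[OF that assms S] Sep_sym by metis
  then show "alc p = alc q" using alc_iff assms by blast
qed

lemma alc_image:
  assumes "\<sigma> \<in> Om" "generic p" shows "\<sigma> ` alc p = alc (\<sigma> p)"
proof -
  have sub: "\<sigma> ` alc p \<subseteq> alc (\<sigma> p)" if "\<sigma> \<in> Om" "generic p" for \<sigma> p
    using that alc_iff[of p] alc_iff[of "\<sigma> p"] generic_image Sep_image by auto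
  have b: "bij \<sigma>" using Om_bij assms by blast
  have "invf \<sigma> ` alc (\<sigma> p) \<subseteq> alc p"
    using sub[of "invf \<sigma>" "\<sigma> p"] generic_image assms b by (simp add: bij_is_inj)
  then have "\<sigma> ` invf \<sigma> ` alc (\<sigma> p) \<subseteq> \<sigma> ` alc p" by blast
  then show ?thesis using sub[OF assms] image_inv_Om(1)[OF assms(1)] by auto
qed

lemma convex_alc: "convex (alc q)"
proof -
  have eq: "alc q = (\<Inter>\<alpha>\<in>\<Phi>p. {y. of_int \<lfloor>c \<alpha> q\<rfloor> < ((2 / (\<alpha> \<bullet> \<alpha>)) *\<^sub>R \<alpha>) \<bullet> y} \<inter> {y. ((2 / (\<alpha> \<bullet> \<alpha>)) *\<^sub>R \<alpha>) \<bullet> y < of_int \<lfloor>c \<alpha> q\<rfloor> + 1})"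
    unfolding alc_def coroot_eval_inner by auto
  show ?thesis unfolding eq by (intro convex_INT convex_Int convex_halfspace_lt convex_halfspace_gt)
qed

text \<open>The box is convex, and a connected set that leaves it meets a hyperplane by the
  intermediate value property of some \<open>c \<alpha>\<close>.\<close>

lemma component_eq_alc:
  assumes p: "generic p" shows "connected_component_set (UNIV - \<Union>hyps) p = alc p"
proof
  have "alc p \<subseteq> UNIV - \<Union>hyps" using alc_iff[OF p] by (auto simp: generic_def)
  then show "alc p \<subseteq> connected_component_set (UNIV - \<Union>hyps) p"
    using connected_component_maximal[OF mem_alc_self[OF p]] convex_connected[OF convex_alc] by blast
  show "connected_component_set (UNIV - \<Union>hyps) p \<subseteq> alc p"
  proof
    let ?C = "connected_component_set (UNIV - \<Union>hyps) p"
    fix y assume y: "y \<in> ?C"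
    have sub: "?C \<subseteq> UNIV - \<Union>hyps" by (rule connected_component_subset)
    then have gy: "generic y" using y unfolding generic_def by blast
    have pC: "p \<in> ?C" using p by (simp add: generic_def connected_component_refl_eq)
    have "Sep p y = {}"
    proof (rule ccontr)
      assume "Sep p y \<noteq> {}"
      then obtain H where H: "H \<in> Sep p y" by blast
      obtain \<alpha> k where a: "\<alpha> \<in> \<Phi>p" "H = affine_hyperplane \<alpha> k" using SepE[OF H] .
      have ab: "(c \<alpha> p - of_int k) * (c \<alpha> y - of_int k) \<le> 0" using H Sep_iff[OF a(1)] a(2) by simp
      have conn: "connected ?C" by (rule connected_connected_component)
      have "\<exists>z\<in>?C. c \<alpha> z = of_int k"
      proof (cases "c \<alpha> p \<le> of_int k")
        case True
        then have "of_int k \<le> c \<alpha> y \<or> c \<alpha> p = of_int k" using ab by (auto simp: mult_le_0_iff)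
        then have "of_int k \<le> c \<alpha> y" using p a(1) by (auto simp: generic_iff)
        then show ?thesis using True connected_ivt_hyperplane[OF conn pC y, of _ "of_int k"]
          unfolding coroot_eval_inner by blast
      next
        case False
        then have "c \<alpha> y \<le> of_int k" using ab by (auto simp: mult_le_0_iff)
        moreover have "of_int k \<le> c \<alpha> p" using False by simp
        ultimately show ?thesis using connected_ivt_hyperplane[OF conn y pC, of _ "of_int k"]
          unfolding coroot_eval_inner by blast
      qed
      then obtain z where "z \<in> ?C" "z \<in> affine_hyperplane \<alpha> k" by (auto simp: mem_affine_hyperplane)
      then show False using sub hypsI[OF a(1)] by blast
    qed
    then show "y \<in> alc p" using alc_iff[OF p] gy by blast
  qed
qed

lemma alcoves_eq: "alcoves \<Phi>p = alc ` {p. generic p}"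
proof -
  have "UNIV - \<Union>hyps = {p. generic p}" by (auto simp: generic_def)
  then have "alcoves \<Phi>p = connected_component_set (UNIV - \<Union>hyps) ` {p. generic p}"
    unfolding alcoves_def components_def by simp
  also have "\<dots> = alc ` {p. generic p}" by (rule image_cong) (simp_all only: component_eq_alc mem_Collect_eq)
  finally show ?thesis .
qed

section \<open>Facets, faces and the crossing of a face\<close>

definition facet where
  "facet x = {y. \<forall>\<alpha>\<in>\<Phi>p. \<forall>k::int. sgn (c \<alpha> x - of_int k) = sgn (c \<alpha> y - of_int k)}"

lemma facets_eq: "facets \<Phi>p = range facet"
  unfolding facets_def quotient_def facet_def by auto

text \<open>Phrased through hyperplanes as sets, because these are what Omega permutes.\<close>

lemma facet_iff: "y \<in> facet x \<longleftrightarrow> (\<forall>H\<in>hyps. (x \<in> H \<longleftrightarrow> y \<in> H) \<and> (x \<notin> H \<longrightarrow> H \<notin> Sep x y))"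
proof -
  have sgn: "sgn a = sgn b \<longleftrightarrow> (a = 0 \<longleftrightarrow> b = 0) \<and> (a \<noteq> 0 \<longrightarrow> \<not> a * b \<le> 0)" for a b :: real
    by (auto simp: sgn_if mult_le_0_iff)
  have "y \<in> facet x \<longleftrightarrow> (\<forall>\<alpha>\<in>\<Phi>p. \<forall>k. (x \<in> affine_hyperplane \<alpha> k \<longleftrightarrow> y \<in> affine_hyperplane \<alpha> k) \<and> 
    (x \<notin> affine_hyperplane \<alpha> k \<longrightarrow> affine_hyperplane \<alpha> k \<notin> Sep x y))"
    unfolding facet_def mem_Collect_eq sgn mem_affine_hyperplane by (simp add: Sep_iff)
  also have "\<dots> \<longleftrightarrow> (\<forall>H\<in>hyps. (x \<in> H \<longleftrightarrow> y \<in> H) \<and> (x \<notin> H \<longrightarrow> H \<notin> Sep x y))"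
    unfolding hyperplanes_def by blast
  finally show ?thesis .
qed

lemma facet_self [simp]: "x \<in> facet x"
  by (simp add: facet_def)

lemma facet_image:
  assumes "\<sigma> \<in> Om" shows "\<sigma> ` facet x = facet (\<sigma> x)"
proof -
  have sub: "\<sigma> ` facet x \<subseteq> facet (\<sigma> x)" if s: "\<sigma> \<in> Om" for \<sigma> x
  proof
    fix z assume "z \<in> \<sigma> ` facet x"
    then obtain y where y: "z = \<sigma> y" "y \<in> facet x" by blast
    show "z \<in> facet (\<sigma> x)" unfolding facet_iff y(1)
    proof (rule ballI)
      fix H assume H: "H \<in> hyps"
      let ?K = "invf \<sigma> ` H"
      have K: "?K \<in> hyps" "\<sigma> ` ?K = H" using Om_hyps[OF Om_inv[OF s] H] image_inv_Om(1)[OF s] by auto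
      have m: "\<sigma> w \<in> H \<longleftrightarrow> w \<in> ?K" for w 
        using K(2) inj_image_mem_iff[OF bij_is_inj[OF Om_bij[OF s]], of w ?K] by simp
      have S: "H \<in> Sep (\<sigma> x) (\<sigma> y) \<longleftrightarrow> ?K \<in> Sep x y" using Sep_image_iff[OF s K(1), of x y] K(2) by simp
      show "(\<sigma> x \<in> H \<longleftrightarrow> \<sigma> y \<in> H) \<and> (\<sigma> x \<notin> H \<longrightarrow> H \<notin> Sep (\<sigma> x) (\<sigma> y))"
        unfolding m S using y(2)[unfolded facet_iff] K(1) by blast
    qed
  qed
  have b: "bij \<sigma>" using Om_bij assms by blast
  have "invf \<sigma> ` facet (\<sigma> x) \<subseteq> facet x"
    using sub[of "invf \<sigma>" "\<sigma> x"] assms b by (simp add: bij_is_inj)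
  then have "\<sigma> ` invf \<sigma> ` facet (\<sigma> x) \<subseteq> \<sigma> ` facet x" by blast
  then show ?thesis using sub[OF assms] image_inv_Om(1)[OF assms] by auto
qed

lemma Clos_facet:
  assumes "generic p" "Clos p x" "y \<in> facet x" shows "Clos p y"
  unfolding Clos_def
proof (rule ballI, rule ccontr)
  fix H assume H: "H \<in> Sep p y" "y \<notin> H"
  have Hh: "H \<in> hyps" using Sep_hyps[OF H(1)] .
  then have x: "x \<notin> H" "H \<notin> Sep x y" using assms(3) H(2) unfolding facet_iff by blast+
  then have "H \<notin> Sep p x" using assms(2) by (auto simp: Clos_def)
  moreover have "p \<notin> H" using assms(1) Hh by (simp add: generic_def)
  ultimately show False using Sep_xor[OF Hh, of p x y] x H by blast
qed

lemma Clos_cong: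
  assumes "generic p" "generic q" "Sep p q = {}" "Clos p x" shows "Clos q x"
  unfolding Clos_def
proof (rule ballI, rule ccontr)
  fix H assume H: "H \<in> Sep q x" "x \<notin> H"
  have Hh: "H \<in> hyps" using Sep_hyps[OF H(1)] .
  have "H \<notin> Sep p x" using assms(4) H by (auto simp: Clos_def)
  moreover have "p \<notin> H" "q \<notin> H" using assms Hh by (auto simp: generic_def)
  ultimately show False using Sep_xor[OF Hh, of p q x] assms(3) H by blast
qed

text \<open>A strict separation of p from x would persist in a neighbourhood of x. Conversely, on
  the segment from x to p no level changes sign, so its interior lies in the alcove.\<close>

lemma closure_alc: 
  assumes p: "generic p" shows "x \<in> closure (alc p) \<longleftrightarrow> Clos p x"
proof
  assume x: "x \<in> closure (alc p)"
  show "Clos p x" unfolding Clos_def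
  proof (rule ballI, rule ccontr)
    fix H assume H: "H \<in> Sep p x" "x \<notin> H"
    obtain \<alpha> k where a: "\<alpha> \<in> \<Phi>p" "H = affine_hyperplane \<alpha> k" using SepE[OF H(1)] .
    let ?s = "c \<alpha> p - of_int k"
    have s: "?s \<noteq> 0" using p a(1) by (simp add: generic_iff)
    have "?s * (c \<alpha> x - of_int k) \<le> 0" using H a Sep_iff by simp
    moreover have "c \<alpha> x - of_int k \<noteq> 0" using H(2) a by (simp add: mem_affine_hyperplane)
    ultimately have neg: "?s * (c \<alpha> x - of_int k) < 0" using s by (simp add: less_le)
    let ?U = "{y. ?s * (c \<alpha> y - of_int k) < 0}"
    have "open ?U" by (intro open_Collect_less continuous_intros)
    then have "?U \<inter> alc p \<noteq> {}" using neg x open_Int_closure_eq_empty[of ?U "alc p"] by blast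
    then obtain y where y: "y \<in> alc p" "?s * (c \<alpha> y - of_int k) < 0" by blast
    then have "H \<in> Sep p y" using a Sep_iff[OF a(1), of k p y] by simp
    then show False using y(1) alc_iff[OF p] by blast
  qed
next
  assume cl: "Clos p x"
  have "open_segment x p \<subseteq> alc p"
  proof
    fix y assume "y \<in> open_segment x p"
    then obtain t where t: "0 < t" "t < 1" "y = (1 - t) *\<^sub>R x + t *\<^sub>R p" by (auto simp: in_segment)
    have pos: "0 < (c \<alpha> p - of_int k) * (c \<alpha> y - of_int k)" if a: "\<alpha> \<in> \<Phi>p" for \<alpha> k
    proof -
      have "0 \<le> (c \<alpha> p - of_int k) * (c \<alpha> x - of_int k)"
      proof (rule ccontr)
        assume neg: "\<not> ?thesis"
        then have "affine_hyperplane \<alpha> k \<in> Sep p x" using Sep_iff[OF a] by simp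
        then have "c \<alpha> x = of_int k" using cl by (auto simp: Clos_def mem_affine_hyperplane)
        then show False using neg by simp
      qed
      moreover have "c \<alpha> p - of_int k \<noteq> 0" using p a by (simp add: generic_iff)
      then have "0 < (c \<alpha> p - of_int k) * (c \<alpha> p - of_int k)" by (metis not_real_square_gt_zero)
      moreover have "(c \<alpha> p - of_int k) * (c \<alpha> y - of_int k) =
         (1 - t) * ((c \<alpha> p - of_int k) * (c \<alpha> x - of_int k)) + t * ((c \<alpha> p - of_int k) * (c \<alpha> p - of_int k))"
        unfolding t(3) by (simp add: algebra_simps)
      ultimately show ?thesis using t by (simp add: add_nonneg_pos)
    qed
    have "generic y" unfolding generic_iff
    proof (intro ballI allI)
      fix \<alpha> k assume "\<alpha> \<in> \<Phi>p"
      from pos[OF this, of k] show "c \<alpha> y \<noteq> of_int k" by auto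
    qed
    moreover have "Sep p y = {}"
    proof (rule ccontr)
      assume "Sep p y \<noteq> {}"
      then obtain H where H: "H \<in> Sep p y" by blast
      obtain \<alpha> k where a: "\<alpha> \<in> \<Phi>p" "H = affine_hyperplane \<alpha> k" using SepE[OF H] .
      then show False using pos[OF a(1), of k] H Sep_iff[OF a(1), of k p y] by simp
    qed
    ultimately show "y \<in> alc p" using alc_iff[OF p] by blast
  qed
  then have "closure (open_segment x p) \<subseteq> closure (alc p)" by (rule closure_mono)
  then show "x \<in> closure (alc p)" 
    using mem_alc_self[OF p] closure_subset[of "alc p"] by (cases "x = p") (auto simp: closure_open_segment)
qed

definition on_one :: "'a \<Rightarrow> 'a set \<Rightarrow> bool" where
  "on_one x H \<longleftrightarrow> H \<in> hyps \<and> x \<in> H \<and> (\<forall>H'\<in>hyps. x \<in> H' \<longrightarrow> H' = H)"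

lemma on_one_image:
  assumes "\<sigma> \<in> Om" "on_one x H" shows "on_one (\<sigma> x) (\<sigma> ` H)"
  unfolding on_one_def
proof (intro conjI ballI impI)
  show "\<sigma> ` H \<in> hyps" "\<sigma> x \<in> \<sigma> ` H" using assms Om_hyps by (auto simp: on_one_def)
  fix H' assume H': "H' \<in> hyps" "\<sigma> x \<in> H'"
  have "invf \<sigma> (\<sigma> x) \<in> invf \<sigma> ` H'" using H'(2) by blast
  then have "x \<in> invf \<sigma> ` H'" using Om_bij[OF assms(1)] by (simp add: bij_is_inj)
  then have "invf \<sigma> ` H' = H" using assms(2) Om_hyps[OF Om_inv[OF assms(1)] H'(1)] by (simp add: on_one_def)
  then show "H' = \<sigma> ` H" using image_inv_Om(1)[OF assms(1)] by blast
qed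

lemma affine_hyperplane_facts:
  assumes "H \<in> hyps"
  shows "affine H" "aff_dim H = int DIM('a) - 1"
proof -
  obtain \<alpha> k where a: "\<alpha> \<in> \<Phi>p" "H = affine_hyperplane \<alpha> k" using hypsE[OF assms] .
  have H: "H = {x. ((2 / (\<alpha> \<bullet> \<alpha>)) *\<^sub>R \<alpha>) \<bullet> x = of_int k}"
    unfolding a(2) affine_hyperplane_def coroot_eval_inner ..
  show "affine H" unfolding H by (rule affine_hyperplane)
  show "aff_dim H = int DIM('a) - 1" unfolding H
    using aff_dim_hyperplane[of "(2 / (\<alpha> \<bullet> \<alpha>)) *\<^sub>R \<alpha>" "of_int k"] a(1) by (simp add: of_nat_diff)
qed

text \<open>In codimension 1 the affine hull of the facet equals every hyperplane through x, so
  there is at most one; there is one, since the facet of a generic point contains an open alcove.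
  Conversely, the facet contains a neighbourhood of x in H.\<close>

lemma aff_dim_facet: "aff_dim (facet x) = int DIM('a) - 1 \<longleftrightarrow> (\<exists>H. on_one x H)"
proof
  assume d: "aff_dim (facet x) = int DIM('a) - 1"
  have sub: "facet x \<subseteq> H" if "H \<in> hyps" "x \<in> H" for H using that by (auto simp: facet_iff)
  have hull: "affine hull (facet x) = H" if H: "H \<in> hyps" "x \<in> H" for H
  proof (rule affine_dim_equal)
    show "affine hull (facet x) \<subseteq> H" using sub[OF H] affine_hyperplane_facts(1)[OF H(1)] by (rule hull_minimal)
    show "affine hull facet x \<noteq> {}" using facet_self by (metis affine_hull_eq_empty empty_iff)
    show "aff_dim (affine hull facet x) = aff_dim H" using d affine_hyperplane_facts(2)[OF H(1)] by simp
  qed (use affine_hyperplane_facts[OF H(1)] in auto)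
  have "\<not> generic x"
  proof
    assume g: "generic x"
    have "alc x \<subseteq> facet x" using alc_iff[OF g] g by (auto simp: facet_iff generic_def)
    moreover have "aff_dim (alc x) = int DIM('a)" using aff_dim_open[OF open_alc] mem_alc_self[OF g] by auto
    ultimately show False using aff_dim_subset[of "alc x" "facet x"] d by simp
  qed
  then obtain H where H: "H \<in> hyps" "x \<in> H" by (auto simp: generic_def)
  have "H' = H" if "H' \<in> hyps" "x \<in> H'" for H' using hull[OF that] hull[OF H] by simp
  then have "on_one x H" unfolding on_one_def using H by blast
  then show "\<exists>H. on_one x H" ..
next
  assume "\<exists>H. on_one x H"
  then obtain H where H: "H \<in> hyps" "x \<in> H" "\<And>H'. H' \<in> hyps \<Longrightarrow> x \<in> H' \<Longrightarrow> H' = H" unfolding on_one_def by blast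
  let ?U = "{y. \<forall>\<alpha>\<in>\<Phi>p. of_int (\<lceil>c \<alpha> x\<rceil> - 1) < c \<alpha> y \<and> c \<alpha> y < of_int (\<lfloor>c \<alpha> x\<rfloor> + 1)}"
  have oU: "open ?U" by (rule open_strip)
  have xU: "x \<in> ?U" by (auto simp: less_ceiling_iff[symmetric]) linarith+
  have subU: "H \<inter> ?U \<subseteq> facet x" unfolding facet_def
  proof (clarify)
    fix y \<alpha> k assume y: "y \<in> H" "\<forall>\<alpha>\<in>\<Phi>p. of_int (\<lceil>c \<alpha> x\<rceil> - 1) < c \<alpha> y \<and> c \<alpha> y < of_int (\<lfloor>c \<alpha> x\<rfloor> + 1)"
      and a: "\<alpha> \<in> \<Phi>p"
    have b: "of_int (\<lceil>c \<alpha> x\<rceil> - 1) < c \<alpha> y" "c \<alpha> y < of_int (\<lfloor>c \<alpha> x\<rfloor> + 1)" using y(2) a by auto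
    consider "c \<alpha> x = of_int k" | "of_int k < c \<alpha> x" | "c \<alpha> x < of_int k" by linarith
    then show "sgn (c \<alpha> x - of_int k) = sgn (c \<alpha> y - of_int k)"
    proof cases
      case 1
      then have "affine_hyperplane \<alpha> k = H" using H(3)[OF hypsI[OF a]] by (simp add: mem_affine_hyperplane)
      then have "c \<alpha> y = of_int k" using y(1) by (auto simp: mem_affine_hyperplane)
      then show ?thesis using 1 by simp
    next
      case 2
      then have "k \<le> \<lceil>c \<alpha> x\<rceil> - 1" by (simp add: less_ceiling_iff)
      then have "of_int k \<le> (of_int (\<lceil>c \<alpha> x\<rceil> - 1) :: real)" by linarith
      then have "of_int k < c \<alpha> y" using b by linarith
      then show ?thesis using 2 by simp
    next
      case 3
      then have "\<lfloor>c \<alpha> x\<rfloor> + 1 \<le> k" by linarith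
      then have "of_int (\<lfloor>c \<alpha> x\<rfloor> + 1) \<le> (of_int k :: real)" by linarith
      then have "c \<alpha> y < of_int k" using b by linarith
      then show ?thesis using 3 by simp
    qed
  qed
  obtain U where U: "open U" "x \<in> U" "H \<inter> U \<subseteq> facet x" by (rule that[OF oU xU subU])
  have "facet x \<subseteq> H" using H(1,2) by (auto simp: facet_iff)
  moreover have "affine hull (H \<inter> U) = affine hull H"
  proof (rule affine_hull_affine_Int_open[OF affine_hyperplane_facts(1)[OF H(1)] U(1)])
    show "H \<inter> U \<noteq> {}" using H(2) U(2) by blast
  qed
  then have "aff_dim (H \<inter> U) = aff_dim H" using aff_dim_affine_hull[of "H \<inter> U"] aff_dim_affine_hull[of H] by simp
  ultimately show "aff_dim (facet x) = int DIM('a) - 1"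
    using aff_dim_subset[OF U(3)] aff_dim_subset[of "facet x" H] affine_hyperplane_facts(2)[OF H(1)] by simp
qed

lemma face_iff:
  "face_of_alcove \<Phi>p f A \<longleftrightarrow> (\<exists>p x H. generic p \<and> A = alc p \<and> f = facet x \<and> on_one x H \<and> Clos p x)"
proof
  assume f: "face_of_alcove \<Phi>p f A"
  then obtain p where p: "generic p" "A = alc p" unfolding face_of_alcove_def alcoves_eq by blast
  obtain x where x: "f = facet x" using f unfolding face_of_alcove_def facets_eq by blast
  obtain H where H: "on_one x H" using f x aff_dim_facet unfolding face_of_alcove_def by blast
  have "x \<in> closure (alc p)" using f p x facet_self[of x] unfolding face_of_alcove_def by blast
  then show "\<exists>p x H. generic p \<and> A = alc p \<and> f = facet x \<and> on_one x H \<and> Clos p x"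
    using p x H closure_alc by blast
next
  assume "\<exists>p x H. generic p \<and> A = alc p \<and> f = facet x \<and> on_one x H \<and> Clos p x"
  then obtain p x H where *: "generic p" "A = alc p" "f = facet x" "on_one x H" "Clos p x" by blast
  have "aff_dim f = int DIM('a) - 1" using * aff_dim_facet by blast
  moreover have "facet x \<subseteq> closure (alc p)" using closure_alc Clos_facet * by blast
  ultimately show "face_of_alcove \<Phi>p f A" unfolding face_of_alcove_def alcoves_eq facets_eq using * by simp
qed

lemma face_type_closed:
  assumes "s \<in> face_types \<Phi>p" "f \<in> s" "\<sigma> \<in> Om" shows "\<sigma> ` f \<in> s"
proof -
  obtain f0 where s: "s = {\<sigma> ` f0 | \<sigma>. \<sigma> \<in> Om}" using assms(1) unfolding face_types_def by blast
  then obtain \<tau> where "f = \<tau> ` f0" "\<tau> \<in> Om" using assms(2) by blast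
  then have "\<sigma> ` f = (\<sigma> \<circ> \<tau>) ` f0" "\<sigma> \<circ> \<tau> \<in> Om" using assms(3) by (simp_all add: image_comp)
  then show ?thesis using s by blast
qed

lemma face_type_transitive:
  assumes "s \<in> face_types \<Phi>p" "f \<in> s" "g \<in> s" shows "\<exists>\<sigma>\<in>Om. g = \<sigma> ` f"
proof -
  obtain f0 where s: "s = {\<sigma> ` f0 | \<sigma>. \<sigma> \<in> Om}" using assms(1) unfolding face_types_def by blast
  then obtain \<tau> \<rho> where t: "f = \<tau> ` f0" "\<tau> \<in> Om" "g = \<rho> ` f0" "\<rho> \<in> Om" using assms(2,3) by blast
  have "invf \<tau> ` f = f0" using t image_inv_Om(2) by simp
  then have "g = (\<rho> \<circ> invf \<tau>) ` f" unfolding t(3) image_comp[symmetric] by simp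
  then show ?thesis using t Om_comp[OF t(4) Om_inv[OF t(2)]] by blast
qed

lemma face_of_type_exists:
  assumes "s \<in> face_types \<Phi>p" "generic p"
  obtains x H where "facet x \<in> s" "on_one x H" "Clos p x"
proof -
  obtain f0 A where s: "s = {\<sigma> ` f0 | \<sigma>. \<sigma> \<in> Om}" "face_of_alcove \<Phi>p f0 A" using assms(1) unfolding face_types_def by blast
  then obtain q x H where q: "generic q" "f0 = facet x" "on_one x H" "Clos q x" unfolding face_iff by blast
  obtain Hs where Hs: "set Hs \<subseteq> walls q" "Sep (wprod Hs q) p = {}" using alcoves_connected[OF q(1) assms(2)] by blast
  let ?g = "wprod Hs"
  have g: "?g \<in> Om" using wprod_Om Hs(1) walls_hyps by blast
  have "facet (?g x) \<in> s" using s(1) q(2) g facet_image[OF g] by blast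
  moreover have "on_one (?g x) (?g ` H)" using on_one_image[OF g q(3)] .
  moreover have "Clos p (?g x)" 
    using Clos_cong[OF generic_image[OF g q(1)] assms(2) Hs(2) Clos_image[OF g q(4)]] .
  ultimately show ?thesis by (rule that)
qed

text \<open>An element of Omega carrying one face to the other moves x within the closure of one
  alcove, hence fixes it by \<open>strict_fundamental_domain\<close>.\<close>

lemma face_of_type_unique:
  assumes s: "s \<in> face_types \<Phi>p" and p: "generic p" and x: "facet x \<in> s" "Clos p x" and y: "facet y \<in> s" "Clos p y"
  shows "facet x = facet y"
proof -
  obtain \<sigma> where \<sigma>: "\<sigma> \<in> Om" "facet y = \<sigma> ` facet x" using face_type_transitive[OF s x(1) y(1)] by blast
  then have eq: "facet y = facet (\<sigma> x)" using facet_image by simp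
  then have "\<sigma> x \<in> facet y" by simp
  then have "Clos p (\<sigma> x)" using Clos_facet[OF p y(2)] by blast
  then have "x = \<sigma> x" using strict_fundamental_domain[OF p x(2) _ \<sigma>(1)] by blast
  then show ?thesis using eq by simp
qed

lemma on_one_wall: "\<lbrakk>generic p; on_one x H; Clos p x\<rbrakk> \<Longrightarrow> H \<in> walls p"
  using wall[of p H x] by (simp add: on_one_def walls_def)

text \<open>An alcove that shares the face has x in its closure, so only hyperplanes through x, that
  is H, can separate it from p. Two alcoves that are separated from p by H alone coincide.\<close>

lemma cross_face_eq:
  assumes s: "s \<in> face_types \<Phi>p" and p: "generic p" and x: "facet x \<in> s" "on_one x H" "Clos p x"
  shows "cross_face \<Phi>p s (alc p) = alc (hrefl H p)"
proof -
  have H: "H \<in> hyps" "x \<in> H" using x(2) by (auto simp: on_one_def)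
  let ?r = "hrefl H"
  have r: "?r \<in> Om" using hrefl_Om H(1) .
  have gr: "generic (?r p)" using generic_image[OF r p] .
  have w: "Sep p (?r p) = {H}" using on_one_wall[OF p x(2,3)] by (simp add: walls_def)
  let ?R = "\<lambda>B. B \<noteq> alc p \<and> (\<exists>f\<in>s. face_of_alcove \<Phi>p f (alc p) \<and> face_of_alcove \<Phi>p f B)"
  have "(THE B. ?R B) = alc (?r p)"
  proof (rule the_equality)
    have "Clos (?r p) (?r x)" using Clos_image[OF r x(3)] .
    then have "Clos (?r p) x" using hrefl_fix[OF H] by simp
    then have "face_of_alcove \<Phi>p (facet x) (alc p)" "face_of_alcove \<Phi>p (facet x) (alc (?r p))"
      unfolding face_iff using p gr x by blast+
    moreover have "alc (?r p) \<noteq> alc p" using alc_eq_iff[OF p gr] w by auto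
    ultimately show "?R (alc (?r p))" using x(1) by blast
  next
    fix B assume B: "?R B"
    then obtain f where f: "f \<in> s" "face_of_alcove \<Phi>p f (alc p)" "face_of_alcove \<Phi>p f B" by blast
    then obtain p' y where y: "generic p'" "alc p = alc p'" "f = facet y" "Clos p' y" unfolding face_iff by blast
    have "Clos p y" using Clos_cong[OF y(1) p _ y(4)] alc_eq_iff[OF y(1) p] y(2) by simp
    then have fx: "f = facet x" using face_of_type_unique[OF s p] f(1) y(3) x by metis
    obtain q z where z: "generic q" "B = alc q" "f = facet z" "Clos q z" using f(3) unfolding face_iff by blast
    have "x \<in> facet z" using fx z(3) facet_self by metis
    then have qx: "Clos q x" using Clos_facet[OF z(1,4)] by blast
    have "K = H" if K: "K \<in> Sep p q" for K
    proof (rule ccontr)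
      assume "K \<noteq> H"
      have Kh: "K \<in> hyps" using Sep_hyps[OF K] .
      then have "x \<notin> K" using x(2) \<open>K \<noteq> H\<close> by (auto simp: on_one_def)
      moreover then have "K \<notin> Sep p x" "K \<notin> Sep q x" using x(3) qx by (auto simp: Clos_def)
      moreover have "p \<notin> K" "q \<notin> K" using p z(1) Kh by (auto simp: generic_def)
      ultimately show False using Sep_xor[OF Kh, of p x q] K Sep_sym by blast
    qed
    moreover have "Sep p q \<noteq> {}" using B z alc_eq_iff[OF p z(1)] by blast
    ultimately have S: "Sep q p = {H}" using Sep_sym by blast
    have "Sep q (?r p) = {}"
    proof (rule ccontr)
      assume "Sep q (?r p) \<noteq> {}"
      then obtain K where K: "K \<in> Sep q (?r p)" by blast
      then show False using Sep_xor_generic[OF z(1) p gr Sep_hyps[OF K]] S w by simp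
    qed
    then show "B = alc (?r p)" using alc_eq_iff[OF z(1) gr] z(2) by blast
  qed
  moreover have "alc p \<in> alcoves \<Phi>p" using p alcoves_eq by blast
  ultimately show ?thesis unfolding cross_face_def by simp
qed

text \<open>Types are Omega-orbits, so \<sigma> carries the face of p to the face of the same type
  of its image. Thus crossing commutes with Omega, and a single wall of p describes it on all images
  of p.\<close>

lemma cross_face_wall:
  assumes s: "s \<in> face_types \<Phi>p" and p: "generic p"
  shows "\<exists>H\<in>walls p. \<forall>\<sigma>\<in>Om. cross_face \<Phi>p s (alc (\<sigma> p)) = alc (\<sigma> (hrefl H p))"
proof -
  obtain x H where x: "facet x \<in> s" "on_one x H" "Clos p x" using face_of_type_exists[OF s p] .
  have H: "H \<in> hyps" using x(2) by (simp add: on_one_def)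
  have "cross_face \<Phi>p s (alc (\<sigma> p)) = alc (\<sigma> (hrefl H p))" if \<sigma>: "\<sigma> \<in> Om" for \<sigma>
  proof -
    have "facet (\<sigma> x) \<in> s" using face_type_closed[OF s x(1) \<sigma>] facet_image[OF \<sigma>] by simp
    from cross_face_eq[OF s generic_image[OF \<sigma> p] this on_one_image[OF \<sigma> x(2)] Clos_image[OF \<sigma> x(3)]]
    show ?thesis using hrefl_conj[OF \<sigma> H] by simp
  qed
  then show ?thesis using on_one_wall[OF p x(2,3)] by blast
qed

text \<open>The midpoint between p and its mirror image lies on H and on no other hyperplane; its
  facet is a face of the required type.\<close>

lemma wall_cross_face:
  assumes p: "generic p" and H: "H \<in> walls p"
  shows "\<exists>s\<in>face_types \<Phi>p. cross_face \<Phi>p s (alc p) = alc (hrefl H p)"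
proof -
  have Hh: "H \<in> hyps" and S: "Sep p (hrefl H p) = {H}" using H by (auto simp: walls_def)
  let ?x = "midpoint p (hrefl H p)"
  have xH: "?x \<in> H" using hrefl_mirror[OF Hh] by (simp add: is_mirror_image_def)
  have xs: "?x \<in> closed_segment p (hrefl H p)" by (rule midpoint_in_closed_segment)
  have "H' = H" if "H' \<in> hyps" "?x \<in> H'" for H'
  proof -
    have "H' \<in> Sep p (hrefl H p)" unfolding Sep_def using that xs by blast
    then show ?thesis using S by simp
  qed
  then have one: "on_one ?x H" unfolding on_one_def using Hh xH by blast
  have cl: "Clos p ?x" using Sep_segment_mono[OF xs] S xH by (auto simp: Clos_def)
  let ?s = "{\<sigma> ` facet ?x | \<sigma>. \<sigma> \<in> Om}"
  have "face_of_alcove \<Phi>p (facet ?x) (alc p)" unfolding face_iff using p one cl by blast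
  then have s: "?s \<in> face_types \<Phi>p" unfolding face_types_def by blast
  have "facet ?x \<in> ?s" by (intro CollectI exI[of _ id]) simp
  then show ?thesis using cross_face_eq[OF s p _ one cl] s by blast
qed

end

section \<open>The affine Weyl group\<close>

lemma (in affine_arrangement) finite_walls: 
  assumes p: "generic p" shows "finite (walls p)"
proof (rule finite_subset)
  let ?F = "\<lambda>\<alpha>. {\<lfloor>c \<alpha> p\<rfloor>, \<lfloor>c \<alpha> p\<rfloor> + 1}"
  show "finite (\<Union>\<alpha>\<in>\<Phi>p. affine_hyperplane \<alpha> ` ?F \<alpha>)" using finite_pos by simp
  show "walls p \<subseteq> (\<Union>\<alpha>\<in>\<Phi>p. affine_hyperplane \<alpha> ` ?F \<alpha>)"
  proof
    fix H assume H: "H \<in> walls p"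
    then have S: "Sep p (hrefl H p) = {H}" by (simp add: walls_def)
    obtain \<alpha> k where a: "\<alpha> \<in> \<Phi>p" "H = affine_hyperplane \<alpha> k" using hypsE[OF walls_hyps[OF H]] .
    let ?f = "\<lfloor>c \<alpha> p\<rfloor>"
    have s: "c \<alpha> (hrefl H p) = 2 * of_int k - c \<alpha> p"
      using a by (simp add: hrefl_affine_hyperplane coroot_eval_affine_reflection)
    have inj: "m = k" if "affine_hyperplane \<alpha> m = H" for m
    proof -
      have "midpoint p (hrefl H p) \<in> H" using hrefl_mirror[OF walls_hyps[OF H]] by (simp add: is_mirror_image_def)
      then show ?thesis using that a(2) by (metis mem_affine_hyperplane of_int_eq_iff)
    qed
    have f: "of_int ?f \<le> c \<alpha> p" "c \<alpha> p < of_int ?f + 1" by linarith+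
    have "k = ?f \<or> k = ?f + 1"
    proof (rule ccontr)
      assume nk: "\<not> ?thesis"
      then consider "k \<le> ?f - 1" | "?f + 2 \<le> k" by linarith
      then show False
      proof cases
        case 1
        then have "of_int k \<le> (of_int ?f - 1 :: real)" by linarith
        then have "(c \<alpha> p - of_int ?f) * (c \<alpha> (hrefl H p) - of_int ?f) \<le> 0"
          unfolding s using f by (intro mult_nonneg_nonpos) linarith+
        then have "affine_hyperplane \<alpha> ?f \<in> Sep p (hrefl H p)" using Sep_iff[OF a(1)] by simp
        then show False using S inj[of ?f] nk by simp
      next
        case 2
        then have "of_int ?f + 2 \<le> (of_int k :: real)" by linarith
        then have "(c \<alpha> p - of_int (?f + 1)) * (c \<alpha> (hrefl H p) - of_int (?f + 1)) \<le> 0"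
          unfolding s using f by (intro mult_nonpos_nonneg) (simp; linarith)+
        then have "affine_hyperplane \<alpha> (?f + 1) \<in> Sep p (hrefl H p)" using Sep_iff[OF a(1)] by blast
        then show False using S inj[of "?f + 1"] nk by simp
      qed
    qed
    then show "H \<in> (\<Union>\<alpha>\<in>\<Phi>p. affine_hyperplane \<alpha> ` ?F \<alpha>)" using a by blast
  qed
qed

locale based_arrangement = affine_arrangement \<Phi> \<Phi>p for \<Phi> \<Phi>p :: "'a::euclidean_space set" +
  fixes p0 :: 'a
  assumes p0: "generic p0"
begin

abbreviation alcs where "alcs \<equiv> alcoves \<Phi>p"
abbreviation W where "W \<equiv> affine_weyl_group \<Phi>p"
abbreviation S where "S \<equiv> affine_gens \<Phi>p"
abbreviation len where "len \<equiv> word_length W S"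

lemma alc_mem [simp]: "generic p \<Longrightarrow> alc p \<in> alcs"
  by (auto simp: alcoves_eq)

lemma generic_Om: "\<sigma> \<in> Om \<Longrightarrow> generic (\<sigma> p0)"
  using generic_image p0 by blast

lemma X_orbit:
  assumes "A \<in> alcs" shows "\<exists>\<sigma>\<in>Om. A = alc (\<sigma> p0)"
proof -
  obtain p where p: "generic p" "A = alc p" using assms alcoves_eq by auto
  obtain Hs where Hs: "set Hs \<subseteq> walls p0" "Sep (wprod Hs p0) p = {}" using alcoves_connected[OF p0 p(1)] by blast
  have "wprod Hs \<in> Om" using Hs(1) walls_hyps by (intro wprod_Om) blast
  then show ?thesis using alc_eq_iff[OF generic_Om p(1)] Hs(2) p(2) by blast
qed

lemma alc_inj:
  assumes "\<sigma> \<in> Om" "\<tau> \<in> Om" "alc (\<sigma> p0) = alc (\<tau> p0)" shows "\<sigma> = \<tau>"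
proof -
  have b: "bij \<sigma>" using Om_bij assms by blast
  have "Sep (\<sigma> p0) (\<tau> p0) = {}" using alc_eq_iff generic_Om assms by blast
  then have "Sep (invf \<sigma> (\<sigma> p0)) (invf \<sigma> (\<tau> p0)) = {}" using Sep_image[OF Om_inv[OF assms(1)]] by simp
  then have "Sep p0 ((invf \<sigma> \<circ> \<tau>) p0) = {}" using b by (simp add: bij_is_inj)
  then have "invf \<sigma> \<circ> \<tau> = id" using Om_free[OF p0 Om_comp[OF Om_inv[OF assms(1)] assms(2)]] by blast
  then have "\<sigma> \<circ> (invf \<sigma> \<circ> \<tau>) = \<sigma>" by simp
  then show ?thesis using b by (simp add: comp_assoc[symmetric] surj_iff[THEN iffD1, OF bij_is_surj])
qed

lemma cross_face_Bij:
  assumes s: "s \<in> face_types \<Phi>p" shows "cross_face \<Phi>p s \<in> Bij alcs" "A \<in> alcs \<Longrightarrow> cross_face \<Phi>p s (cross_face \<Phi>p s A) = A"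
proof -
  have *: "cross_face \<Phi>p s A \<in> alcs \<and> cross_face \<Phi>p s (cross_face \<Phi>p s A) = A" if A: "A \<in> alcs" for A
  proof -
    obtain p where p: "generic p" "A = alc p" using A alcoves_eq by auto
    obtain H where H: "H \<in> walls p" "\<And>\<sigma>. \<sigma> \<in> Om \<Longrightarrow> cross_face \<Phi>p s (alc (\<sigma> p)) = alc (\<sigma> (hrefl H p))"
      using cross_face_wall[OF s p(1)] by blast
    have Hh: "H \<in> hyps" using walls_hyps[OF H(1)] .
    have "cross_face \<Phi>p s (alc p) = alc (hrefl H p)" using H(2)[OF Om_id] by simp
    moreover have "cross_face \<Phi>p s (alc (hrefl H p)) = alc p" using H(2)[OF hrefl_Om[OF Hh]] Hh by simp
    moreover have "generic (hrefl H p)" using generic_image[OF hrefl_Om[OF Hh] p(1)] .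
    ultimately show ?thesis using p(2) by simp
  qed
  then show "A \<in> alcs \<Longrightarrow> cross_face \<Phi>p s (cross_face \<Phi>p s A) = A" by blast
  have "bij_betw (cross_face \<Phi>p s) alcs alcs"
    by (rule bij_betw_byWitness[where f' = "cross_face \<Phi>p s"]) (use * in auto)
  moreover have "cross_face \<Phi>p s \<in> extensional alcs" by (simp add: cross_face_def)
  ultimately show "cross_face \<Phi>p s \<in> Bij alcs" by (simp add: Bij_def)
qed

lemma group_W: "group W"
  unfolding affine_weyl_group_def by (rule group.group_subgroup_generated[OF group_BijGroup])

sublocale W: group W by (rule group_W)

lemma carrier_W: "carrier W = generate (BijGroup alcs) S"
proof -
  have "S \<subseteq> Bij alcs" using cross_face_Bij by (auto simp: affine_gens_def)
  then have "carrier (BijGroup alcs) \<inter> S = S" by (auto simp: BijGroup_def)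
  then show ?thesis unfolding affine_weyl_group_def carrier_subgroup_generated by simp
qed

lemma S_sub_Bij: "S \<subseteq> Bij alcs"
  using cross_face_Bij by (auto simp: affine_gens_def)

lemma W_Bij: "w \<in> carrier W \<Longrightarrow> w \<in> Bij alcs"
  using group.generate_in_carrier[OF group_BijGroup, of S alcs w] S_sub_Bij
  unfolding carrier_W by (simp add: BijGroup_def)

lemma W_mult:
  assumes "w \<in> carrier W" "w' \<in> carrier W" "A \<in> alcs"
  shows "(w \<otimes>\<^bsub>W\<^esub> w') A = w (w' A)"
proof -
  have b: "w \<in> Bij alcs" "w' \<in> Bij alcs" using W_Bij assms by blast+
  have "w \<otimes>\<^bsub>W\<^esub> w' = w \<otimes>\<^bsub>BijGroup alcs\<^esub> w'" by (simp add: affine_weyl_group_def)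
  also have "\<dots> = compose alcs w w'" using b by (simp add: BijGroup_def)
  finally show ?thesis using assms(3) by (simp add: compose_def)
qed

lemma W_one: "A \<in> alcs \<Longrightarrow> \<one>\<^bsub>W\<^esub> A = A"
  by (simp add: affine_weyl_group_def BijGroup_def)

lemma S_carrier: "s \<in> S \<Longrightarrow> s \<in> carrier W"
  unfolding carrier_W by (rule generate.incl)

lemma S_invol: assumes "s \<in> S" shows "s \<otimes>\<^bsub>W\<^esub> s = \<one>\<^bsub>W\<^esub>"
proof (rule extensionalityI)
  have "s \<otimes>\<^bsub>W\<^esub> s \<in> Bij alcs" "\<one>\<^bsub>W\<^esub> \<in> Bij alcs" using W_Bij S_carrier assms by auto
  then show "s \<otimes>\<^bsub>W\<^esub> s \<in> extensional alcs" "\<one>\<^bsub>W\<^esub> \<in> extensional alcs" by (auto simp: Bij_def)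
  show "(s \<otimes>\<^bsub>W\<^esub> s) A = \<one>\<^bsub>W\<^esub> A" if "A \<in> alcs" for A
    using assms that cross_face_Bij(2) by (auto simp: W_mult W_one S_carrier) (auto simp: affine_gens_def)
qed

lemma W_gen: "w \<in> carrier W \<Longrightarrow> \<exists>ss. set ss \<subseteq> S \<and> w = foldr (\<otimes>\<^bsub>W\<^esub>) ss \<one>\<^bsub>W\<^esub>"
  unfolding carrier_W
proof (induction rule: generate.induct)
  case one
  show ?case by (intro exI[of _ "[]"]) (simp add: affine_weyl_group_def)
next
  case (incl h)
  then show ?case by (intro exI[of _ "[h]"]) (simp add: S_carrier)
next
  case (inv h)
  have hh: "h \<otimes>\<^bsub>BijGroup alcs\<^esub> h = \<one>\<^bsub>BijGroup alcs\<^esub>" using S_invol[OF inv] by (simp add: affine_weyl_group_def)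
  have "h \<in> carrier (BijGroup alcs)" using S_sub_Bij inv by (auto simp: BijGroup_def)
  then have "inv\<^bsub>BijGroup alcs\<^esub> h = h" using group.inv_equality[OF group_BijGroup hh] by blast
  then show ?case using inv by (intro exI[of _ "[h]"]) (simp add: S_carrier)
next
  case (eng h1 h2)
  obtain ss ts where st: "set ss \<subseteq> S" "h1 = foldr (\<otimes>\<^bsub>W\<^esub>) ss \<one>\<^bsub>W\<^esub>" "set ts \<subseteq> S" "h2 = foldr (\<otimes>\<^bsub>W\<^esub>) ts \<one>\<^bsub>W\<^esub>"
    using eng.IH by blast
  have m: "h1 \<otimes>\<^bsub>BijGroup alcs\<^esub> h2 = h1 \<otimes>\<^bsub>W\<^esub> h2" by (simp add: affine_weyl_group_def)
  have c: "foldr (\<otimes>\<^bsub>W\<^esub>) ts \<one>\<^bsub>W\<^esub> \<in> carrier W" using st(3) by (induction ts) (auto simp: S_carrier)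
  have "foldr (\<otimes>\<^bsub>W\<^esub>) (ss @ ts) \<one>\<^bsub>W\<^esub> = foldr (\<otimes>\<^bsub>W\<^esub>) ss \<one>\<^bsub>W\<^esub> \<otimes>\<^bsub>W\<^esub> foldr (\<otimes>\<^bsub>W\<^esub>) ts \<one>\<^bsub>W\<^esub>"
    using st(1)
  proof (induction ss)
    case Nil
    then show ?case using c by simp
  next
    case (Cons a ss)
    have "foldr (\<otimes>\<^bsub>W\<^esub>) ss \<one>\<^bsub>W\<^esub> \<in> carrier W" using Cons.prems by (induction ss) (auto simp: S_carrier)
    then show ?case using Cons c by (simp add: W.m_assoc S_carrier)
  qed
  then show ?case unfolding m using st by (intro exI[of _ "ss @ ts"]) simp
qed

text \<open>Quantifying over all g records that W commutes with Omega, and it carries the induction: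
  a letter in front of the word acts on an alcove already moved by g and \<sigma>, and adds its
  reflection on the right of \<sigma>.\<close>

lemma omega_anti_exists:
  assumes "w \<in> carrier W"
  shows "\<exists>\<sigma>\<in>Om. \<forall>g\<in>Om. w (alc (g p0)) = alc (g (\<sigma> p0))"
proof -
  have "set ss \<subseteq> S \<Longrightarrow> \<exists>\<sigma>\<in>Om. foldr (\<otimes>\<^bsub>W\<^esub>) ss \<one>\<^bsub>W\<^esub> \<in> carrier W \<and> (\<forall>g\<in>Om. foldr (\<otimes>\<^bsub>W\<^esub>) ss \<one>\<^bsub>W\<^esub> (alc (g p0)) = alc (g (\<sigma> p0)))" for ss
  proof (induction ss)
    case Nil
    show ?case by (intro bexI[of _ id]) (auto simp: W_one generic_Om)
  next
    case (Cons s ss)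
    let ?w = "foldr (\<otimes>\<^bsub>W\<^esub>) ss \<one>\<^bsub>W\<^esub>"
    obtain \<sigma> where \<sigma>: "\<sigma> \<in> Om" "?w \<in> carrier W" "\<And>g. g \<in> Om \<Longrightarrow> ?w (alc (g p0)) = alc (g (\<sigma> p0))" using Cons by auto
    obtain t where t: "t \<in> face_types \<Phi>p" "s = cross_face \<Phi>p t" using Cons.prems by (auto simp: affine_gens_def)
    obtain H where H: "H \<in> walls p0" "\<And>\<sigma>. \<sigma> \<in> Om \<Longrightarrow> s (alc (\<sigma> p0)) = alc (\<sigma> (hrefl H p0))"
      using cross_face_wall[OF t(1) p0] t(2) by blast
    have s: "s \<in> carrier W" using Cons.prems S_carrier by simp
    have "(s \<otimes>\<^bsub>W\<^esub> ?w) (alc (g p0)) = alc (g ((\<sigma> \<circ> hrefl H) p0))" if g: "g \<in> Om" for g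
      using W_mult[OF s \<sigma>(2), of "alc (g p0)"] \<sigma>(3)[OF g] H(2)[OF Om_comp[OF g \<sigma>(1)]] generic_Om[OF g] by simp
    moreover have "\<sigma> \<circ> hrefl H \<in> Om" using Om_comp[OF \<sigma>(1) hrefl_Om[OF walls_hyps[OF H(1)]]] .
    ultimately show ?case using s \<sigma>(2) by (intro bexI[of _ "\<sigma> \<circ> hrefl H"]) auto
  qed
  note * = this
  obtain ss where ss: "set ss \<subseteq> S" "w = foldr (\<otimes>\<^bsub>W\<^esub>) ss \<one>\<^bsub>W\<^esub>" using W_gen[OF assms] by (elim exE conjE)
  obtain \<sigma> where \<sigma>: "\<sigma> \<in> Om" "\<forall>g\<in>Om. w (alc (g p0)) = alc (g (\<sigma> p0))"
    using *[OF ss(1)] unfolding ss(2)[symmetric] by (elim bexE conjE)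
  show ?thesis using \<sigma>(2,1) by (rule bexI)
qed

text \<open>\<open>W\<close> acts on the left and \<open>\<Omega>\<close> on the right, so that \<open>w A\<^sub>0 = A\<^sub>0 \<sigma>\<close> defines an antihomomorphism for the composition
  of functions.\<close>

definition omega_anti where "omega_anti w = (SOME \<sigma>. \<sigma> \<in> Om \<and> (\<forall>g\<in>Om. w (alc (g p0)) = alc (g (\<sigma> p0))))"

lemma omega_anti_props:
  assumes "w \<in> carrier W"
  shows "omega_anti w \<in> Om" "g \<in> Om \<Longrightarrow> w (alc (g p0)) = alc (g (omega_anti w p0))"
proof -
  have "\<exists>\<sigma>. \<sigma> \<in> Om \<and> (\<forall>g\<in>Om. w (alc (g p0)) = alc (g (\<sigma> p0)))" using omega_anti_exists[OF assms] by blast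
  then have "omega_anti w \<in> Om \<and> (\<forall>g\<in>Om. w (alc (g p0)) = alc (g (omega_anti w p0)))" unfolding omega_anti_def by (rule someI_ex)
  then show "omega_anti w \<in> Om" "g \<in> Om \<Longrightarrow> w (alc (g p0)) = alc (g (omega_anti w p0))" by blast+
qed

lemma omega_anti_eqI:
  assumes "w \<in> carrier W" "\<sigma> \<in> Om" "w (alc p0) = alc (\<sigma> p0)" shows "omega_anti w = \<sigma>"
  using omega_anti_props(2)[OF assms(1) Om_id] assms(3) alc_inj[OF omega_anti_props(1)[OF assms(1)] assms(2)] by simp

lemma omega_anti_mult:
  assumes "w \<in> carrier W" "w' \<in> carrier W" shows "omega_anti (w \<otimes>\<^bsub>W\<^esub> w') = omega_anti w' \<circ> omega_anti w"
proof (rule omega_anti_eqI)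
  show "w \<otimes>\<^bsub>W\<^esub> w' \<in> carrier W" "omega_anti w' \<circ> omega_anti w \<in> Om" using assms omega_anti_props(1) by auto
  have "(w \<otimes>\<^bsub>W\<^esub> w') (alc p0) = w (w' (alc p0))" using W_mult assms p0 by simp
  also have "w' (alc p0) = alc (omega_anti w' p0)" using omega_anti_props(2)[OF assms(2) Om_id] by simp
  also have "w (alc (omega_anti w' p0)) = alc (omega_anti w' (omega_anti w p0))" using omega_anti_props(2)[OF assms(1) omega_anti_props(1)[OF assms(2)]] .
  finally show "(w \<otimes>\<^bsub>W\<^esub> w') (alc p0) = alc ((omega_anti w' \<circ> omega_anti w) p0)" by simp
qed

lemma omega_anti_one: "omega_anti \<one>\<^bsub>W\<^esub> = id"
  by (rule omega_anti_eqI) (simp_all add: W_one p0)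

lemma omega_anti_inj:
  assumes "w \<in> carrier W" "w' \<in> carrier W" "omega_anti w = omega_anti w'" shows "w = w'"
proof (rule extensionalityI)
  show "w \<in> extensional alcs" "w' \<in> extensional alcs" using W_Bij assms by (auto simp: Bij_def)
  show "w A = w' A" if A: "A \<in> alcs" for A
  proof -
    obtain g where g: "g \<in> Om" "A = alc (g p0)" using X_orbit[OF A] by blast
    show ?thesis using omega_anti_props(2)[OF assms(1) g(1)] omega_anti_props(2)[OF assms(2) g(1)] assms(3) g(2) by simp
  qed
qed

lemma omega_anti_inv:
  assumes "w \<in> carrier W" shows "omega_anti (inv\<^bsub>W\<^esub> w) = invf (omega_anti w)"
proof -
  have "omega_anti w \<circ> omega_anti (inv\<^bsub>W\<^esub> w) = id" using omega_anti_mult[of "inv\<^bsub>W\<^esub> w" w] assms omega_anti_one by simp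
  then have "invf (omega_anti w) \<circ> (omega_anti w \<circ> omega_anti (inv\<^bsub>W\<^esub> w)) = invf (omega_anti w)" by simp
  then show ?thesis using Om_bij[OF omega_anti_props(1)[OF assms]] by (simp add: comp_assoc[symmetric] inv_o_cancel[OF bij_is_inj])
qed

text \<open>Inversion turns the antihomomorphism into a homomorphism, so that left multiplication in
  W becomes composition on the left, as the Coxeter axioms require. For translations
  \<open>omega_anti\<close> is better suited: there a right factor acts last on points.\<close>

definition omega_hom where "omega_hom w = omega_anti (inv\<^bsub>W\<^esub> w)"

lemma omega_hom_Om: "w \<in> carrier W \<Longrightarrow> omega_hom w \<in> Om"
  by (simp add: omega_hom_def omega_anti_props)

lemma omega_hom_mult: "\<lbrakk>w \<in> carrier W; w' \<in> carrier W\<rbrakk> \<Longrightarrow> omega_hom (w \<otimes>\<^bsub>W\<^esub> w') = omega_hom w \<circ> omega_hom w'"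
  by (simp add: omega_hom_def omega_anti_mult W.inv_mult_group)

lemma omega_hom_one: "omega_hom \<one>\<^bsub>W\<^esub> = id"
  by (simp add: omega_hom_def omega_anti_one)

lemma omega_hom_inj: "\<lbrakk>w \<in> carrier W; w' \<in> carrier W; omega_hom w = omega_hom w'\<rbrakk> \<Longrightarrow> w = w'"
  unfolding omega_hom_def by (metis omega_anti_inj W.inv_closed W.inv_inv)

lemma inv_gens: "s \<in> S \<Longrightarrow> inv\<^bsub>W\<^esub> s = s"
  using W.inv_equality[OF S_invol] S_carrier by blast

lemma omega_hom_gen: assumes "s \<in> S" shows "\<exists>H\<in>walls p0. omega_hom s = hrefl H"
proof -
  obtain t where t: "t \<in> face_types \<Phi>p" "s = cross_face \<Phi>p t" using assms by (auto simp: affine_gens_def)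
  obtain H where H: "H \<in> walls p0" "\<And>\<sigma>. \<sigma> \<in> Om \<Longrightarrow> s (alc (\<sigma> p0)) = alc (\<sigma> (hrefl H p0))"
    using cross_face_wall[OF t(1) p0] t(2) by blast
  have "omega_anti s = hrefl H" 
    using omega_anti_eqI[OF S_carrier[OF assms] hrefl_Om[OF walls_hyps[OF H(1)]]] H(2)[OF Om_id] by simp
  then show ?thesis using H(1) inv_gens[OF assms] by (auto simp: omega_hom_def)
qed

lemma wall_gen: assumes "H \<in> walls p0" shows "\<exists>s\<in>S. omega_hom s = hrefl H"
proof -
  obtain t where t: "t \<in> face_types \<Phi>p" "cross_face \<Phi>p t (alc p0) = alc (hrefl H p0)" 
    using wall_cross_face[OF p0 assms] by blast
  let ?s = "cross_face \<Phi>p t"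
  have s: "?s \<in> S" using t by (simp add: affine_gens_def)
  have "omega_anti ?s = hrefl H" using omega_anti_eqI[OF S_carrier[OF s] hrefl_Om[OF walls_hyps[OF assms]] t(2)] .
  then show ?thesis using s inv_gens[OF s] by (auto simp: omega_hom_def intro!: bexI[of _ ?s])
qed

text \<open>Words in the generators and words in the reflections at the walls of \<open>p0\<close>
  correspond letter by letter under \<open>omega_hom\<close>.\<close>

lemma len_eq:
  assumes w: "w \<in> carrier W" shows "len w = card (Sep p0 (omega_hom w p0))"
  unfolding word_length_def
proof (rule Least_equality)
  have words: "\<exists>ss. length ss = length Hs \<and> set ss \<subseteq> S \<and> foldr (\<otimes>\<^bsub>W\<^esub>) ss \<one>\<^bsub>W\<^esub> \<in> carrier W \<and> omega_hom (foldr (\<otimes>\<^bsub>W\<^esub>) ss \<one>\<^bsub>W\<^esub>) = wprod Hs"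
    if "set Hs \<subseteq> walls p0" for Hs
    using that
  proof (induction Hs)
    case Nil
    show ?case by (intro exI[of _ "[]"]) (simp add: omega_hom_one)
  next
    case (Cons H Hs)
    obtain ss where ss: "length ss = length Hs" "set ss \<subseteq> S" "foldr (\<otimes>\<^bsub>W\<^esub>) ss \<one>\<^bsub>W\<^esub> \<in> carrier W" "omega_hom (foldr (\<otimes>\<^bsub>W\<^esub>) ss \<one>\<^bsub>W\<^esub>) = wprod Hs"
      using Cons by auto
    obtain s where s: "s \<in> S" "omega_hom s = hrefl H" using wall_gen Cons.prems by auto
    show ?case using ss s S_carrier by (intro exI[of _ "s # ss"]) (simp add: omega_hom_mult)
  qed
  obtain Hs where Hs: "set Hs \<subseteq> walls p0" "wprod Hs = omega_hom w" "length Hs = card (Sep p0 (omega_hom w p0))"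
    using minimal_word[OF p0 omega_hom_Om[OF w]] by metis
  obtain ss where ss: "length ss = length Hs" "set ss \<subseteq> S" "foldr (\<otimes>\<^bsub>W\<^esub>) ss \<one>\<^bsub>W\<^esub> \<in> carrier W" "omega_hom (foldr (\<otimes>\<^bsub>W\<^esub>) ss \<one>\<^bsub>W\<^esub>) = wprod Hs"
    using words[OF Hs(1)] by blast
  have "w = foldr (\<otimes>\<^bsub>W\<^esub>) ss \<one>\<^bsub>W\<^esub>" using omega_hom_inj[OF w ss(3)] ss(4) Hs(2) by simp
  then show "\<exists>ss. length ss = card (Sep p0 (omega_hom w p0)) \<and> set ss \<subseteq> S \<and> w = foldr (\<otimes>\<^bsub>W\<^esub>) ss \<one>\<^bsub>W\<^esub>"
    using ss Hs(3) by (intro exI[of _ ss]) simp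
next
  fix n assume "\<exists>ss. length ss = n \<and> set ss \<subseteq> S \<and> w = foldr (\<otimes>\<^bsub>W\<^esub>) ss \<one>\<^bsub>W\<^esub>"
  then obtain ss where ss: "length ss = n" "set ss \<subseteq> S" "w = foldr (\<otimes>\<^bsub>W\<^esub>) ss \<one>\<^bsub>W\<^esub>" by blast
  have "set ss \<subseteq> S \<Longrightarrow> foldr (\<otimes>\<^bsub>W\<^esub>) ss \<one>\<^bsub>W\<^esub> \<in> carrier W \<and> 
      (\<exists>Hs. length Hs = length ss \<and> set Hs \<subseteq> walls p0 \<and> omega_hom (foldr (\<otimes>\<^bsub>W\<^esub>) ss \<one>\<^bsub>W\<^esub>) = wprod Hs)" for ss
  proof (induction ss)
    case Nil
    show ?case by (auto simp: omega_hom_one)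
  next
    case (Cons s ss)
    obtain Hs where Hs: "length Hs = length ss" "set Hs \<subseteq> walls p0" "omega_hom (foldr (\<otimes>\<^bsub>W\<^esub>) ss \<one>\<^bsub>W\<^esub>) = wprod Hs"
      using Cons by auto
    obtain H where H: "H \<in> walls p0" "omega_hom s = hrefl H" using omega_hom_gen Cons.prems by auto
    have c: "s \<in> carrier W" "foldr (\<otimes>\<^bsub>W\<^esub>) ss \<one>\<^bsub>W\<^esub> \<in> carrier W" using Cons S_carrier by auto
    show ?case
    proof
      show "foldr (\<otimes>\<^bsub>W\<^esub>) (s # ss) \<one>\<^bsub>W\<^esub> \<in> carrier W" using c by simp
      show "\<exists>Hs. length Hs = length (s # ss) \<and> set Hs \<subseteq> walls p0 \<and> omega_hom (foldr (\<otimes>\<^bsub>W\<^esub>) (s # ss) \<one>\<^bsub>W\<^esub>) = wprod Hs"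
        using Hs H c by (intro exI[of _ "H # Hs"]) (simp add: omega_hom_mult)
    qed
  qed
  then obtain Hs where "length Hs = n" "set Hs \<subseteq> walls p0" "omega_hom w = wprod Hs" using ss by blast
  then show "card (Sep p0 (omega_hom w p0)) \<le> n" using card_Sep_word_le[OF p0] by metis
qed

lemma omega_hom_refl:
  assumes "t \<in> reflections_of W S" shows "\<exists>K\<in>hyps. omega_hom t = hrefl K \<and> t \<in> carrier W"
proof -
  obtain w s where t: "t = w \<otimes>\<^bsub>W\<^esub> s \<otimes>\<^bsub>W\<^esub> inv\<^bsub>W\<^esub> w" "w \<in> carrier W" "s \<in> S"
    using assms by (auto simp: reflections_of_def)
  obtain H where H: "H \<in> walls p0" "omega_hom s = hrefl H" using omega_hom_gen[OF t(3)] by blast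
  have Hh: "H \<in> hyps" using walls_hyps[OF H(1)] .
  have s: "s \<in> carrier W" using S_carrier t by blast
  let ?g = "omega_hom w"
  have g: "?g \<in> Om" using omega_hom_Om[OF t(2)] .
  have "?g \<circ> omega_hom (inv\<^bsub>W\<^esub> w) = id" using omega_hom_mult[of w "inv\<^bsub>W\<^esub> w"] t(2) omega_hom_one by simp
  then have gi: "?g (omega_hom (inv\<^bsub>W\<^esub> w) y) = y" for y by (metis comp_apply id_apply)
  have "omega_hom t = ?g \<circ> hrefl H \<circ> omega_hom (inv\<^bsub>W\<^esub> w)" using t s H(2) by (simp add: omega_hom_mult)
  then have "omega_hom t y = hrefl (?g ` H) y" for y
    using hrefl_conj[OF g Hh, of "omega_hom (inv\<^bsub>W\<^esub> w) y"] gi by simp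
  then have "omega_hom t = hrefl (?g ` H)" by blast
  then show ?thesis using Om_hyps[OF g Hh] t s by auto
qed

lemma finite_gens: "finite S"
proof -
  have "finite (hrefl ` walls p0)" using finite_walls[OF p0] by simp
  moreover have "omega_hom ` S \<subseteq> hrefl ` walls p0" using omega_hom_gen by blast
  ultimately have "finite (omega_hom ` S)" by (rule finite_subset[rotated])
  moreover have "inj_on omega_hom S" using omega_hom_inj S_carrier by (auto simp: inj_on_def)
  ultimately show ?thesis by (rule finite_imageD)
qed

text \<open>A reflection in K shortens w iff K separates \<open>p0\<close> from its image under w.
  Reflecting everything in V replaces \<open>p0\<close> by its mirror image, and going back to
  \<open>p0\<close> changes the separating set only by V, which differs from K.\<close>

lemma coxeter_W: "coxeter W S"
proof (unfold_locales)
  show "finite S" by (rule finite_gens)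
  show "S \<subseteq> carrier W" using S_carrier by blast
  show "s \<otimes>\<^bsub>W\<^esub> s = \<one>\<^bsub>W\<^esub>" if "s \<in> S" for s using S_invol that .
  show "\<exists>ss. set ss \<subseteq> S \<and> w = foldr (\<otimes>\<^bsub>W\<^esub>) ss \<one>\<^bsub>W\<^esub>" if "w \<in> carrier W" for w using W_gen that .
  show "len (t \<otimes>\<^bsub>W\<^esub> w) \<noteq> len w" if t: "t \<in> reflections_of W S" and w: "w \<in> carrier W" for t w
  proof -
    obtain K where K: "K \<in> hyps" "omega_hom t = hrefl K" "t \<in> carrier W" using omega_hom_refl[OF t] by blast
    show ?thesis using card_Sep_reflection(2)[OF p0 omega_hom_Om[OF w] K(1)] K w by (simp add: len_eq omega_hom_mult)
  qed
  show "len (t \<otimes>\<^bsub>W\<^esub> w) < len w \<longleftrightarrow> len (s \<otimes>\<^bsub>W\<^esub> (t \<otimes>\<^bsub>W\<^esub> w)) < len (s \<otimes>\<^bsub>W\<^esub> w)"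
    if s: "s \<in> S" and t: "t \<in> reflections_of W S" and ts: "t \<noteq> s" and w: "w \<in> carrier W" for s t w
  proof -
    obtain K where K: "K \<in> hyps" "omega_hom t = hrefl K" "t \<in> carrier W" using omega_hom_refl[OF t] by blast
    obtain V where V: "V \<in> walls p0" "omega_hom s = hrefl V" using omega_hom_gen[OF s] by blast
    have Vh: "V \<in> hyps" using walls_hyps[OF V(1)] .
    have sc: "s \<in> carrier W" using S_carrier[OF s] .
    have KV: "K \<noteq> V" using omega_hom_inj[OF K(3) sc] K V ts by auto
    let ?g = "omega_hom w" and ?s = "hrefl V"
    have g: "?g \<in> Om" and sO: "?s \<in> Om" using omega_hom_Om[OF w] hrefl_Om[OF Vh] .
    have L: "len (t \<otimes>\<^bsub>W\<^esub> w) < len w \<longleftrightarrow> K \<in> Sep p0 (?g p0)"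
      using card_Sep_reflection(1)[OF p0 g K(1)] K w by (simp add: len_eq omega_hom_mult)
    have "?s (hrefl K (?g p0)) = hrefl (?s ` K) (?s (?g p0))" using hrefl_conj[OF sO K(1)] by simp
    then have "len (s \<otimes>\<^bsub>W\<^esub> (t \<otimes>\<^bsub>W\<^esub> w)) < len (s \<otimes>\<^bsub>W\<^esub> w) \<longleftrightarrow> ?s ` K \<in> Sep p0 (?s (?g p0))"
      using card_Sep_reflection(1)[OF p0 Om_comp[OF sO g] Om_hyps[OF sO K(1)]] K V w sc by (simp add: len_eq omega_hom_mult)
    also have "\<dots> \<longleftrightarrow> K \<in> Sep (?s p0) (?g p0)"
      using Sep_image_iff[OF sO K(1), of "?s p0" "?g p0"] Vh by simp
    also have "\<dots> \<longleftrightarrow> K \<in> Sep p0 (?g p0)"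
      using Sep_wall_step[OF p0 generic_Om[OF g] V(1)] KV by auto
    finally show ?thesis using L by blast
  qed
qed

end

section \<open>Translations\<close>

context affine_arrangement begin

lemma Om_translate_apply: "\<sigma> \<in> Om \<Longrightarrow> \<sigma> (x + d) = \<sigma> x + (\<sigma> d - \<sigma> 0)"
proof -
  assume "\<sigma> \<in> Om"
  then have l: "linear (\<lambda>x. \<sigma> x - \<sigma> 0)" using Om_linear_part orthogonal_transformation_linear by blast
  show ?thesis using linear_add[OF l, of x d] by (simp add: algebra_simps)
qed

lemma Om_linear:
  assumes "\<sigma> \<in> Om" "\<sigma> 0 = 0" shows "linear \<sigma>"
proof -
  have "(\<lambda>x. \<sigma> x - \<sigma> 0) = \<sigma>" using assms(2) by auto
  then show ?thesis using Om_linear_part[OF assms(1)] orthogonal_transformation_linear by metis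
qed

lemma translate_conj:
  assumes "\<sigma> \<in> Om" shows "\<sigma> \<circ> translate d \<circ> invf \<sigma> = translate (\<sigma> d - \<sigma> 0)"
proof
  fix x
  have "\<sigma> (invf \<sigma> x) = x" using Om_bij[OF assms] by (simp add: bij_is_surj surj_f_inv_f)
  then show "(\<sigma> \<circ> translate d \<circ> invf \<sigma>) x = translate (\<sigma> d - \<sigma> 0) x"
    using Om_translate_apply[OF assms, of "invf \<sigma> x" d] by (simp add: translate_def)
qed

lemma translate_orbit_Om: "\<lbrakk>translate d \<in> Om; \<sigma> \<in> Om\<rbrakk> \<Longrightarrow> translate (\<sigma> d - \<sigma> 0) \<in> Om"
  using translate_conj[of \<sigma> d] Om_comp[OF Om_comp[of \<sigma> "translate d"] Om_inv[of \<sigma>]] by simp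

lemma translate_multiple_Om: "translate d \<in> Om \<Longrightarrow> translate (real n *\<^sub>R d) \<in> Om"
proof (induction n)
  case 0
  have "translate 0 = (id :: 'a \<Rightarrow> 'a)" by (auto simp: translate_def)
  then show ?case using Om_id by (metis of_nat_0 scaleR_zero_left)
next
  case (Suc n)
  have "translate (real (Suc n) *\<^sub>R d) = translate d \<circ> translate (real n *\<^sub>R d)"
    by (auto simp: translate_def algebra_simps)
  then show ?case using Om_comp[OF Suc.prems Suc.IH[OF Suc.prems]] by (simp only:)
qed

lemma generic_translate: "translate d \<in> Om \<Longrightarrow> generic p \<Longrightarrow> generic (p + d)"
  using generic_image[of "translate d" p] by (simp add: translate_def)

lemma card_Sep_translate: "translate d \<in> Om \<Longrightarrow> card (Sep (p + d) (q + d)) = card (Sep p q)"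
  using card_Sep_image[of "translate d" p q] by (simp add: translate_def)

lemma translate_integral:
  assumes "translate d \<in> Om" "\<alpha> \<in> \<Phi>p" obtains m :: int where "c \<alpha> d = of_int m"
proof -
  obtain \<gamma> e m where "\<forall>x. c \<alpha> (translate d x) = e * c \<gamma> x + of_int m" using Om_form[OF assms] by blast
  then have "c \<alpha> (translate d 0) = e * c \<gamma> 0 + of_int m" by blast
  then show ?thesis using that[of m] by (simp add: translate_def)
qed

text \<open>\<open>Sep p r\<close> is the symmetric difference of the other two sets, so counts add
  iff no hyperplane is crossed twice. This is the geometric form of the dot.\<close>

lemma card_Sep_add_iff:
  assumes "generic p" "generic q" "generic r"
  shows "card (Sep p r) = card (Sep p q) + card (Sep q r) \<longleftrightarrow> Sep p q \<inter> Sep q r = {}"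
proof -
  let ?A = "Sep p q" and ?B = "Sep q r"
  have S: "Sep p r = (?A \<union> ?B) - (?A \<inter> ?B)"
    using Sep_xor_generic[OF assms] Sep_hyps by blast
  have fin: "finite ?A" "finite ?B" by (rule finite_Sep)+
  have "card (Sep p r) = card (?A \<union> ?B) - card (?A \<inter> ?B)" unfolding S
    by (rule card_Diff_subset) (use fin in auto)
  moreover have "card ?A + card ?B = card (?A \<union> ?B) + card (?A \<inter> ?B)" using card_Un_Int fin by blast
  moreover have "card (?A \<inter> ?B) = 0 \<longleftrightarrow> ?A \<inter> ?B = {}" using fin by simp
  ultimately show ?thesis by linarith
qed

lemma card_Sep_triangle:
  assumes "generic p" "generic q" "generic r" shows "card (Sep p r) \<le> card (Sep p q) + card (Sep q r)"
proof -
  have "Sep p r \<subseteq> Sep p q \<union> Sep q r" using Sep_xor_generic[OF assms] Sep_hyps by blast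
  then show ?thesis using card_mono[of "Sep p q \<union> Sep q r" "Sep p r"] finite_Sep card_Un_le le_trans by (metis finite_UnI)
qed

text \<open>A hyperplane crossed twice in the conclusion, moved back by d, is crossed twice in the
  hypothesis; its level changes by the integer m.\<close>

lemma straight_step:
  assumes d: "translate d \<in> Om" and "Sep p q \<inter> Sep q (q + d) = {}"
  shows "Sep p (q + d) \<inter> Sep (q + d) (q + d + d) = {}"
proof (rule ccontr)
  assume "\<not> ?thesis"
  then obtain H where H: "H \<in> Sep p (q + d)" "H \<in> Sep (q + d) (q + d + d)" by blast
  obtain \<alpha> k where a: "\<alpha> \<in> \<Phi>p" "H = affine_hyperplane \<alpha> k" using SepE[OF H(1)] .
  obtain m where m: "c \<alpha> d = of_int m" using translate_integral[OF d a(1)] .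
  define x y z where "x = c \<alpha> p - of_int k" and "y = c \<alpha> q + of_int m - of_int k" and "z = (of_int m :: real)"
  have 1: "x * y \<le> 0" using H(1) Sep_iff[OF a(1), of k p "q + d"] a(2) m by (simp add: x_def y_def)
  have 2: "y * (y + z) \<le> 0" using H(2) Sep_iff[OF a(1), of k "q + d" "q + d + d"] a(2) m 
    by (simp add: y_def z_def algebra_simps)
  have "y * y + z * y \<le> 0" using 2 by (simp add: algebra_simps)
  then have "z * y \<le> 0" using zero_le_square[of y] by linarith
  then have "(x + z) * y \<le> 0" using 1 by (simp add: algebra_simps)
  then have "affine_hyperplane \<alpha> (k - m) \<in> Sep p q" using Sep_iff[OF a(1), of "k - m" p q]
    by (simp add: x_def y_def z_def algebra_simps)
  moreover have "affine_hyperplane \<alpha> (k - m) \<in> Sep q (q + d)" using Sep_iff[OF a(1), of "k - m" q "q + d"] 2 m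
    by (simp add: y_def z_def algebra_simps)
  ultimately show False using assms(2) by blast
qed

lemma card_Sep_multiple:
  assumes d: "translate d \<in> Om" and p: "generic p"
  shows "card (Sep p (p + real n *\<^sub>R d)) = n * card (Sep p (p + d))"
proof -
  have "Sep p (p + real n *\<^sub>R d) \<inter> Sep (p + real n *\<^sub>R d) (p + real n *\<^sub>R d + d) = {} \<and>
    card (Sep p (p + real n *\<^sub>R d)) = n * card (Sep p (p + d))"
  proof (induction n)
    case 0
    show ?case using Sep_self[OF p] by simp
  next
    case (Suc n)
    let ?q = "p + real n *\<^sub>R d"
    have e: "p + real (Suc n) *\<^sub>R d = ?q + d" by (simp add: algebra_simps)
    have t: "translate (real n *\<^sub>R d) \<in> Om" using translate_multiple_Om[OF d] .
    have gq: "generic ?q" "generic (?q + d)" using generic_translate t d p by blast+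
    have "card (Sep p (?q + d)) = card (Sep p ?q) + card (Sep ?q (?q + d))"
      using card_Sep_add_iff[OF p gq] Suc by blast
    moreover have "card (Sep ?q (?q + d)) = card (Sep p (p + d))"
      using card_Sep_translate[OF t, of p "p + d"] by (simp add: algebra_simps)
    ultimately show ?case unfolding e using straight_step[OF d] Suc by simp
  qed
  then show ?thesis by blast
qed

text \<open>Both counts grow linearly along the multiples of \<open>d\<close>, and they differ by a bounded amount.\<close>

lemma card_Sep_base_indep:
  assumes d: "translate d \<in> Om" and "generic p" "generic q"
  shows "card (Sep p (p + d)) = card (Sep q (q + d))"
proof -
  have le: "card (Sep p (p + d)) \<le> card (Sep q (q + d))" if g: "generic p" "generic q" for p q
  proof (rule ccontr)
    let ?a = "card (Sep p (p + d))" and ?b = "card (Sep q (q + d))" and ?c = "card (Sep p q)"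
    assume "\<not> ?a \<le> ?b"
    then have ab: "?b + 1 \<le> ?a" by simp
    define n where "n = 2 * ?c + 1"
    let ?d = "real n *\<^sub>R d"
    have t: "translate ?d \<in> Om" using translate_multiple_Om[OF d] .
    have gd: "generic (p + ?d)" "generic (q + ?d)" using generic_translate[OF t] g by blast+
    have "card (Sep p (p + ?d)) \<le> card (Sep p q) + card (Sep q (p + ?d))" using card_Sep_triangle g gd by blast
    also have "card (Sep q (p + ?d)) \<le> card (Sep q (q + ?d)) + card (Sep (q + ?d) (p + ?d))" using card_Sep_triangle g gd by blast
    also have "card (Sep (q + ?d) (p + ?d)) = ?c" using card_Sep_translate[OF t, of q p] Sep_sym by simp
    finally have "n * ?a \<le> n * ?b + 2 * ?c" using card_Sep_multiple[OF d] g by simp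
    moreover have "n * (?b + 1) \<le> n * ?a" using ab by (rule mult_le_mono2)
    ultimately show False by (simp add: n_def)
  qed
  show ?thesis using le[OF assms(2,3)] le[OF assms(3,2)] by simp
qed

text \<open>For opposite signs the path goes forth along d and back along e. Both moves are nonzero
  integers in the coordinate of \<alpha>, so the path recrosses the last hyperplane of the family
  passed before q + d.\<close>

lemma same_sign_of_straight:
  assumes d: "translate d \<in> Om" "translate e \<in> Om" and g: "generic p" "generic q"
    and "Sep p q \<inter> Sep q (q + d) = {}" "Sep p (q + d) \<inter> Sep (q + d) (q + d + e) = {}" and a: "\<alpha> \<in> \<Phi>p"
  shows "0 \<le> c \<alpha> d * c \<alpha> e"
proof (rule ccontr)
  assume neg: "\<not> 0 \<le> c \<alpha> d * c \<alpha> e"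
  obtain m n where mn: "c \<alpha> d = of_int m" "c \<alpha> e = of_int n" using translate_integral d a by metis
  have "of_int (m * n) < (0 :: real)" using neg mn by simp
  then have mn0: "m * n < 0" by linarith
  let ?y = "c \<alpha> q + of_int m"
  have ny: "?y \<noteq> of_int k" for k 
    using generic_translate[OF d(1) g(2)] a mn(1) by (auto simp: generic_iff)
  have f: "of_int \<lfloor>?y\<rfloor> < ?y" "?y < of_int \<lfloor>?y\<rfloor> + 1" using ny[of "\<lfloor>?y\<rfloor>"] by linarith+
  \<comment> \<open>The level is the integer part of the coordinate at q + d if the path arrives
    from below, and the next integer if it arrives from above.\<close>
  have "\<exists>k::int. (c \<alpha> q - of_int k) * (?y - of_int k) \<le> 0 \<and> (?y - of_int k) * (?y + of_int n - of_int k) \<le> 0"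
  proof (cases "0 < m")
    case True
    then have "n < 0" using mn0 by (simp add: mult_less_0_iff)
    then have "(1::real) \<le> of_int m" "of_int n \<le> (-1::real)" using True by linarith+
    then show ?thesis using f by (intro exI[of _ "\<lfloor>?y\<rfloor>"] conjI mult_nonpos_nonneg mult_nonneg_nonpos) linarith+
  next
    case False
    then have "m < 0" "0 < n" using mn0 by (auto simp: mult_less_0_iff)
    then have "of_int m \<le> (-1::real)" "(1::real) \<le> of_int n" by linarith+
    then show ?thesis using f 
      by (intro exI[of _ "\<lfloor>?y\<rfloor> + 1"] conjI mult_nonpos_nonneg mult_nonneg_nonpos) (simp; linarith)+
  qed
  then obtain k where k: "(c \<alpha> q - of_int k) * (?y - of_int k) \<le> 0" "(?y - of_int k) * (?y + of_int n - of_int k) \<le> 0" by blast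
  let ?H = "affine_hyperplane \<alpha> k"
  have 1: "?H \<in> Sep q (q + d)" using k(1) mn Sep_iff[OF a] by simp
  have 2: "?H \<in> Sep (q + d) (q + d + e)" using k(2) mn Sep_iff[OF a, of k "q + d" "q + d + e"] by simp
  have "?H \<notin> Sep p q" using 1 assms(5) by blast
  then have "?H \<in> Sep p (q + d)" using Sep_xor_generic[OF g generic_translate[OF d(1) g(2)] hypsI[OF a]] 1 by blast
  then show False using 2 assms(6) by blast
qed

text \<open>Small multiples of \<open>d\<close> and \<open>e\<close> lie in the closure of one alcove, which is a strict fundamental
  domain.\<close>

lemma orbit_same_chamber:
  assumes \<rho>: "\<rho> \<in> Om" "linear \<rho>" "\<rho> d = e" and sgn: "\<And>\<alpha>. \<alpha> \<in> \<Phi>p \<Longrightarrow> 0 \<le> c \<alpha> d * c \<alpha> e"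
  shows "d = e"
proof -
  \<comment> \<open>After division by K the values of both vectors under every coroot are so small
    that no hyperplane of nonzero level is reached.\<close>
  define K where "K = 1 + (\<Sum>\<alpha>\<in>\<Phi>p. \<bar>c \<alpha> d\<bar> + \<bar>c \<alpha> e\<bar>)"
  have K: "\<bar>c \<alpha> d\<bar> + \<bar>c \<alpha> e\<bar> < K" if "\<alpha> \<in> \<Phi>p" for \<alpha>
  proof -
    have "\<bar>c \<alpha> d\<bar> + \<bar>c \<alpha> e\<bar> \<le> (\<Sum>\<alpha>\<in>\<Phi>p. \<bar>c \<alpha> d\<bar> + \<bar>c \<alpha> e\<bar>)"
      by (rule member_le_sum) (use finite_pos that in auto)
    then show ?thesis by (simp add: K_def)
  qed
  have K1: "1 \<le> K" unfolding K_def by (simp add: sum_nonneg)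
  define D E where "D = (1 / K) *\<^sub>R d" and "E = (1 / K) *\<^sub>R e"
  have sm: "\<bar>c \<alpha> D\<bar> + \<bar>c \<alpha> E\<bar> < 1" "0 \<le> c \<alpha> D * c \<alpha> E" if a: "\<alpha> \<in> \<Phi>p" for \<alpha>
  proof -
    have "\<bar>c \<alpha> D\<bar> + \<bar>c \<alpha> E\<bar> = (\<bar>c \<alpha> d\<bar> + \<bar>c \<alpha> e\<bar>) / K"
      using K1 by (simp add: D_def E_def abs_mult add_divide_distrib)
    then show "\<bar>c \<alpha> D\<bar> + \<bar>c \<alpha> E\<bar> < 1" using K[OF a] K1 by simp
    show "0 \<le> c \<alpha> D * c \<alpha> E" using sgn[OF a] K1 by (simp add: D_def E_def)
  qed
  \<comment> \<open>Where the signs agree weakly, D + E vanishes under a coroot only if D and E both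
    do. So D and E lie in the closure of any alcove that has D + E in its closure.\<close>
  obtain p where p: "generic p" "Clos p (D + E)" using near_point .
  have close: "Clos p Y" if Y: "Y = D \<and> Z = E \<or> Y = E \<and> Z = D" for Y Z
    unfolding Clos_def
  proof (rule ballI, rule ccontr)
    fix H assume H: "H \<in> Sep p Y" "Y \<notin> H"
    obtain \<alpha> k where a: "\<alpha> \<in> \<Phi>p" "H = affine_hyperplane \<alpha> k" using SepE[OF H(1)] .
    let ?y = "c \<alpha> Y" and ?z = "c \<alpha> Z" and ?x = "c \<alpha> (D + E)"
    have x: "?x = ?y + ?z" using Y by auto
    have b: "\<bar>?y\<bar> + \<bar>?z\<bar> < 1" "0 \<le> ?y * ?z" using sm[OF a(1)] Y by (auto simp: mult.commute add.commute)
    have yk: "?y \<noteq> of_int k" using H(2) a(2) by (simp add: mem_affine_hyperplane)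
    have xy: "0 < (?x - of_int k) * (?y - of_int k)"
    proof -
      consider "k = 0" | "1 \<le> k" | "k \<le> -1" by linarith
      then show ?thesis
      proof cases
        case 1
        then have "?y * ?y > 0" using yk by (metis not_real_square_gt_zero of_int_0)
        then show ?thesis using 1 b(2) unfolding x by (simp add: algebra_simps)
      next
        case 2
        then have "(1::real) \<le> of_int k" by linarith
        then show ?thesis using b(1) unfolding x by (intro mult_neg_neg) linarith+
      next
        case 3
        then have "of_int k \<le> (-1::real)" by linarith
        then show ?thesis using b(1) unfolding x by (intro mult_pos_pos) linarith+
      qed
    qed
    then have xH: "D + E \<notin> H" using a(2) by (auto simp: mem_affine_hyperplane simp del: coroot_eval_simps)
    have Hh: "H \<in> hyps" using Sep_hyps[OF H(1)] .
    have "H \<notin> Sep (D + E) Y" using xy Sep_iff[OF a(1), of k "D + E" Y] a(2) by simp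
    moreover have "H \<notin> Sep p (D + E)" using p(2) xH by (auto simp: Clos_def)
    moreover have "p \<notin> H" using p(1) Hh by (simp add: generic_def)
    ultimately show False using Sep_xor[OF Hh _ xH, of p Y] H by blast
  qed
  have "\<rho> D = E" unfolding D_def E_def using linear_scale[OF \<rho>(2)] \<rho>(3) by simp
  then have "D = E" using strict_fundamental_domain[OF p(1) close[of D E] close[of E D] \<rho>(1)] by simp
  then show ?thesis using K1 by (simp add: D_def E_def)
qed

end

context based_arrangement begin

interpretation C: coxeter W S by (rule coxeter_W)

lemma len_sg: assumes w: "w \<in> carrier W" shows "len w = card (Sep p0 (omega_anti w p0))"
proof -
  have "len w = len (inv\<^bsub>W\<^esub> w)" using C.len_inv[OF w] by simp
  also have "\<dots> = card (Sep p0 (omega_anti w p0))" using len_eq[of "inv\<^bsub>W\<^esub> w"] w by (simp add: omega_hom_def)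
  finally show ?thesis .
qed

text \<open>The elements of W that correspond to translations by the vectors in the orbit of d; it
  contains all \<open>us l\<close>.\<close>

definition translation_conjugates where 
  "translation_conjugates d = {w \<in> carrier W. \<exists>\<sigma>\<in>Om. omega_anti w = translate (\<sigma> d - \<sigma> 0)}"

text \<open>Multiplying z on the right by v moves the point \<open>omega_anti z p0\<close> by a
  vector e of the orbit, so the axioms become statements on \<open>Sep\<close>. For uniqueness,
  straightness along e and then e' makes both vectors agree in sign on all roots, and a linear
  element of Omega carries one to the other.\<close>

lemma translation_class_W:
  assumes d: "translate d \<in> Om" and u: "u \<in> carrier W" "omega_anti u = translate d"
  shows "translation_class W S (translation_conjugates d) (len u)"
proof (unfold_locales)
  let ?U = "translation_conjugates d"
  show "?U \<subseteq> carrier W" by (auto simp: translation_conjugates_def)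
  show "s \<otimes>\<^bsub>W\<^esub> v \<otimes>\<^bsub>W\<^esub> s \<in> ?U" if v: "v \<in> ?U" and s: "s \<in> S" for v s
  proof -
    obtain \<sigma> where \<sigma>: "v \<in> carrier W" "\<sigma> \<in> Om" "omega_anti v = translate (\<sigma> d - \<sigma> 0)"
      using v by (auto simp: translation_conjugates_def)
    have sc: "s \<in> carrier W" using S_carrier[OF s] .
    let ?r = "omega_anti s"
    have r: "?r \<in> Om" using omega_anti_props sc by blast
    have ri: "?r = invf ?r" using omega_anti_inv[OF sc] inv_gens[OF s] by simp
    have "omega_anti (s \<otimes>\<^bsub>W\<^esub> v \<otimes>\<^bsub>W\<^esub> s) = ?r \<circ> omega_anti v \<circ> invf ?r" using sc \<sigma> ri by (simp add: omega_anti_mult comp_assoc)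
    also have "\<dots> = translate (?r (\<sigma> d - \<sigma> 0) - ?r 0)" unfolding \<sigma>(3) using translate_conj[OF r] .
    also have "?r (\<sigma> d - \<sigma> 0) - ?r 0 = (?r \<circ> \<sigma>) d - (?r \<circ> \<sigma>) 0"
      using Om_translate_apply[OF r, of "\<sigma> 0" "\<sigma> d - \<sigma> 0"] by simp
    finally show ?thesis using Om_comp[OF r \<sigma>(2)] sc \<sigma>(1) unfolding translation_conjugates_def by blast
  qed
  have transl: "\<exists>e. translate e \<in> Om \<and> omega_anti v = translate e \<and> (\<exists>\<sigma>\<in>Om. e = \<sigma> d - \<sigma> 0) \<and> v \<in> carrier W" if "v \<in> ?U" for v
    using that translate_orbit_Om[OF d] by (auto simp: translation_conjugates_def)
  \<comment> \<open>The count does not depend on the base point, and with base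
    \<open>\<sigma> p0\<close> it is the image under \<sigma> of the count between p0 and p0 +
    d.\<close>
  have M: "card (Sep q (q + e)) = len u" if q: "generic q" and e: "\<sigma> \<in> Om" "e = \<sigma> d - \<sigma> 0" for q \<sigma> e
  proof -
    have eO: "translate e \<in> Om" using translate_orbit_Om[OF d] e by blast
    have "card (Sep q (q + e)) = card (Sep (\<sigma> p0) (\<sigma> p0 + e))" using card_Sep_base_indep[OF eO q generic_Om[OF e(1)]] .
    also have "\<sigma> p0 + e = \<sigma> (p0 + d)" using Om_translate_apply[OF e(1)] e(2) by simp
    also have "card (Sep (\<sigma> p0) (\<sigma> (p0 + d))) = card (Sep p0 (p0 + d))" using card_Sep_image[OF e(1)] .
    also have "\<dots> = len u" using len_sg[OF u(1)] u(2) by (simp add: translate_def)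
    finally show ?thesis .
  qed
  have mult: "omega_anti (z \<otimes>\<^bsub>W\<^esub> v) p0 = omega_anti z p0 + e" if "z \<in> carrier W" "v \<in> carrier W" "omega_anti v = translate e" for z v e
    using that by (simp add: omega_anti_mult translate_def)
  show "len v = len u" if v: "v \<in> ?U" for v
  proof -
    obtain e where e: "translate e \<in> Om" "omega_anti v = translate e" "\<exists>\<sigma>\<in>Om. e = \<sigma> d - \<sigma> 0" "v \<in> carrier W" using transl[OF v] by blast
    then show ?thesis using M[OF p0, of _ e] len_sg[OF e(4)] by (auto simp: translate_def)
  qed
  have dot: "len (z \<otimes>\<^bsub>W\<^esub> v) = len z + len u \<longleftrightarrow> Sep p0 (omega_anti z p0) \<inter> Sep (omega_anti z p0) (omega_anti z p0 + e) = {}"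
    if z: "z \<in> carrier W" and e: "translate e \<in> Om" "omega_anti v = translate e" "\<exists>\<sigma>\<in>Om. e = \<sigma> d - \<sigma> 0" "v \<in> carrier W" for z v e
  proof -
    have g: "generic (omega_anti z p0)" using generic_Om omega_anti_props(1)[OF z] by blast
    have g2: "generic (omega_anti z p0 + e)" using generic_translate[OF e(1) g] .
    have "len (z \<otimes>\<^bsub>W\<^esub> v) = card (Sep p0 (omega_anti z p0 + e))"
      using len_sg[of "z \<otimes>\<^bsub>W\<^esub> v"] mult[OF z e(4,2)] z e(4) by simp
    moreover have "card (Sep (omega_anti z p0) (omega_anti z p0 + e)) = len u" using M[OF g] e(3) by blast
    ultimately show ?thesis using card_Sep_add_iff[OF p0 g g2] len_sg[OF z] by simp
  qed
  show "len (z \<otimes>\<^bsub>W\<^esub> v \<otimes>\<^bsub>W\<^esub> v) = len z + 2 * len u"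
    if z: "z \<in> carrier W" and v: "v \<in> ?U" and l: "len (z \<otimes>\<^bsub>W\<^esub> v) = len z + len u" for z v
  proof -
    obtain e where e: "translate e \<in> Om" "omega_anti v = translate e" "\<exists>\<sigma>\<in>Om. e = \<sigma> d - \<sigma> 0" "v \<in> carrier W" using transl[OF v] by blast
    have zv: "z \<otimes>\<^bsub>W\<^esub> v \<in> carrier W" using z e by simp
    have "Sep p0 (omega_anti z p0) \<inter> Sep (omega_anti z p0) (omega_anti z p0 + e) = {}" using dot[OF z e] l by blast
    from straight_step[OF e(1) this] show ?thesis
      using dot[OF zv e] mult[OF z e(4,2)] l by simp
  qed
  show "v = v'"
    if z: "z \<in> carrier W" and v: "v \<in> ?U" "v' \<in> ?U" and l: "len (z \<otimes>\<^bsub>W\<^esub> v) = len z + len u" 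
      "len (z \<otimes>\<^bsub>W\<^esub> v \<otimes>\<^bsub>W\<^esub> v') = len z + 2 * len u" for z v v'
  proof -
    obtain e where e: "translate e \<in> Om" "omega_anti v = translate e" "\<exists>\<sigma>\<in>Om. e = \<sigma> d - \<sigma> 0" "v \<in> carrier W" using transl[OF v(1)] by blast
    obtain e' where e': "translate e' \<in> Om" "omega_anti v' = translate e'" "\<exists>\<sigma>\<in>Om. e' = \<sigma> d - \<sigma> 0" "v' \<in> carrier W" using transl[OF v(2)] by blast
    have zv: "z \<otimes>\<^bsub>W\<^esub> v \<in> carrier W" using z e by simp
    have g: "generic (omega_anti z p0)" using generic_Om omega_anti_props(1)[OF z] by blast
    have 1: "Sep p0 (omega_anti z p0) \<inter> Sep (omega_anti z p0) (omega_anti z p0 + e) = {}" using dot[OF z e] l by blast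
    have 2: "Sep p0 (omega_anti z p0 + e) \<inter> Sep (omega_anti z p0 + e) (omega_anti z p0 + e + e') = {}" 
      using dot[OF zv e'] mult[OF z e(4,2)] l by simp
    obtain \<sigma> \<tau> where st: "\<sigma> \<in> Om" "e = \<sigma> d - \<sigma> 0" "\<tau> \<in> Om" "e' = \<tau> d - \<tau> 0" using e(3) e'(3) by blast
    let ?L = "\<lambda>x. \<sigma> x - \<sigma> 0" and ?L' = "\<lambda>x. \<tau> x - \<tau> 0"
    have L: "?L \<in> Om" "linear ?L" "?L' \<in> Om" "linear ?L'" 
      using Om_linear_part[OF st(1)] Om_linear_part[OF st(3)] orthogonal_transformation_linear by blast+
    \<comment> \<open>\<open>?L\<close> sends d to e and \<open>?L'\<close> sends d to e', so this
      element of Omega is linear and sends e to e'.\<close>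
    let ?R = "?L' \<circ> invf ?L"
    have bL: "bij ?L" using Om_bij[OF L(1)] .
    have R: "?R \<in> Om" using Om_comp[OF L(3) Om_inv[OF L(1)]] .
    have inv0: "invf ?L (?L x) = x" for x by (rule inv_f_f[OF bij_is_inj[OF bL]])
    have "?R 0 = 0" using inv0[of 0] by simp
    then have "linear ?R" by (rule Om_linear[OF R])
    moreover have "?R e = e'" using inv0[of d] st(2,4) by simp
    ultimately have "e = e'" 
      using orbit_same_chamber[OF R] same_sign_of_straight[OF e(1) e'(1) p0 g 1 2] by blast
    then show ?thesis using omega_anti_inj[OF e(4) e'(4)] e(2) e'(2) by simp
  qed
qed

end

section \<open>The theorem\<close>

text \<open>The vector that defines positivity has positive values under all positive coroots;
  dividing by a bound K brings them below 1.\<close>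

lemma fundamental_alcove_point:
  assumes "root_system \<Phi>" "positive_roots \<Phi> \<Phi>p"
  obtains p where "affine_arrangement.generic \<Phi>p p" "fundamental_alcove \<Phi>p = affine_arrangement.alc \<Phi>p p"
proof -
  interpret affine_arrangement \<Phi> \<Phi>p using assms by unfold_locales
  obtain \<xi> where \<xi>: "\<Phi>p = {\<alpha> \<in> \<Phi>. 0 < \<alpha> \<bullet> \<xi>}" using assms(2) unfolding positive_roots_def by blast
  have pos: "0 < c \<alpha> \<xi>" if "\<alpha> \<in> \<Phi>p" for \<alpha>
    using that \<xi> by (auto simp: coroot_eval_def inner_commute)
  define K where "K = 1 + (\<Sum>\<alpha>\<in>\<Phi>p. c \<alpha> \<xi>)"
  have K: "c \<alpha> \<xi> < K" if "\<alpha> \<in> \<Phi>p" for \<alpha>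
  proof -
    have "c \<alpha> \<xi> \<le> (\<Sum>\<alpha>\<in>\<Phi>p. c \<alpha> \<xi>)"
      by (rule member_le_sum) (use finite_pos that pos in \<open>auto intro: less_imp_le\<close>)
    then show ?thesis by (simp add: K_def)
  qed
  have K1: "1 \<le> K" unfolding K_def using pos by (simp add: sum_nonneg less_imp_le)
  let ?p = "(1 / K) *\<^sub>R \<xi>"
  have b: "0 < c \<alpha> ?p" "c \<alpha> ?p < 1" if "\<alpha> \<in> \<Phi>p" for \<alpha>
    using pos[OF that] K[OF that] K1 by simp_all
  have fl: "\<lfloor>c \<alpha> ?p\<rfloor> = 0" if "\<alpha> \<in> \<Phi>p" for \<alpha> using b[OF that] by linarith
  have "generic ?p" unfolding generic_iff
  proof (intro ballI allI notI)
    fix \<alpha> k assume a: "\<alpha> \<in> \<Phi>p" "c \<alpha> ?p = of_int k"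
    then have "0 < k" "k < 1" using b[OF a(1)] by (metis of_int_0_less_iff, metis of_int_less_1_iff)
    then show False by simp
  qed
  moreover have "fundamental_alcove \<Phi>p = alc ?p" unfolding alc_def fundamental_alcove_def using fl by auto
  ultimately show ?thesis by (rule that)
qed

theorem theorem1p2:
  fixes \<Phi> \<Phi>p :: "'a::euclidean_space set"
    and \<Gamma>p :: "'g::ab_group_add set"
    and v :: "('a set \<Rightarrow> 'a set) \<Rightarrow> 'g"
    and \<H> :: "('a set \<Rightarrow> 'a set, 'g) hecke ring"
    and u z z' :: "'a set \<Rightarrow> 'a set"
    and ud :: 'a
    and us :: "nat \<Rightarrow> 'a set \<Rightarrow> 'a set"
    and uds :: "nat \<Rightarrow> 'a"
    and n r i j :: nat
    and W :: "('a set \<Rightarrow> 'a set) monoid"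
    and S :: "('a set \<Rightarrow> 'a set) set"
    and M :: nat
    and N :: int
  defines "W \<equiv> affine_weyl_group \<Phi>p"
    and "S \<equiv> affine_gens \<Phi>p"
    and "M \<equiv> word_length W S u"
    and "N \<equiv> int (word_length W S z') - int (word_length W S z)"
  assumes "irreducible_root_system \<Phi>"
    and "positive_roots \<Phi> \<Phi>p"
    and "positive_cone \<Gamma>p"
    and "positive_weights W S \<Gamma>p v"
    and "hecke_algebra W S v \<H>"
    and "translation_with \<Phi>p u ud"
    and "uds ` {1..n} = linear_orbit \<Phi>p ud"
    and "inj_on uds {1..n}"
    and "uds 1 = ud"
    and "\<forall>l\<in>{1..n}. us l \<in> carrier W \<and>
           us l (fundamental_alcove \<Phi>p) = translate (uds l) ` fundamental_alcove \<Phi>p"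
    and "z \<in> carrier W"
    and "z' \<in> carrier W"
    and "r \<ge> 1"
    and "i \<in> {1..n}"
    and "j \<in> {1..n}"
    and "dotted W S z (us i [^]\<^bsub>W\<^esub> r)"
    and "dotted W S z' (us j [^]\<^bsub>W\<^esub> r)"
    and "int r > N * (int M + 1)"
  shows "\<forall>k::nat.
      dotted W S z (us i [^]\<^bsub>W\<^esub> (r + k)) \<and> dotted W S z' (us j [^]\<^bsub>W\<^esub> (r + k)) \<and>
      kl_P W S \<Gamma>p \<H> (z \<otimes>\<^bsub>W\<^esub> us i [^]\<^bsub>W\<^esub> r) (z' \<otimes>\<^bsub>W\<^esub> us j [^]\<^bsub>W\<^esub> r) =
      kl_P W S \<Gamma>p \<H> (z \<otimes>\<^bsub>W\<^esub> us i [^]\<^bsub>W\<^esub> (r + k)) (z' \<otimes>\<^bsub>W\<^esub> us j [^]\<^bsub>W\<^esub> (r + k)) \<and>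
      (\<forall>s\<in>S.
         bruhat_less W S (s \<otimes>\<^bsub>W\<^esub> (z \<otimes>\<^bsub>W\<^esub> us i [^]\<^bsub>W\<^esub> r)) (z \<otimes>\<^bsub>W\<^esub> us i [^]\<^bsub>W\<^esub> r) \<and>
         bruhat_less W S (z \<otimes>\<^bsub>W\<^esub> us i [^]\<^bsub>W\<^esub> r) (z' \<otimes>\<^bsub>W\<^esub> us j [^]\<^bsub>W\<^esub> r) \<and>
         bruhat_less W S (z' \<otimes>\<^bsub>W\<^esub> us j [^]\<^bsub>W\<^esub> r) (s \<otimes>\<^bsub>W\<^esub> (z' \<otimes>\<^bsub>W\<^esub> us j [^]\<^bsub>W\<^esub> r)) \<longrightarrow>
         kl_M W S \<Gamma>p \<H> s (z \<otimes>\<^bsub>W\<^esub> us i [^]\<^bsub>W\<^esub> r) (z' \<otimes>\<^bsub>W\<^esub> us j [^]\<^bsub>W\<^esub> r) =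
         kl_M W S \<Gamma>p \<H> s (z \<otimes>\<^bsub>W\<^esub> us i [^]\<^bsub>W\<^esub> (r + k)) (z' \<otimes>\<^bsub>W\<^esub> us j [^]\<^bsub>W\<^esub> (r + k)))"
proof -
  have rs: "root_system \<Phi>" using assms(5) by (simp add: irreducible_root_system_def)
  obtain p0 where p0: "affine_arrangement.generic \<Phi>p p0" "fundamental_alcove \<Phi>p = affine_arrangement.alc \<Phi>p p0"
    using fundamental_alcove_point[OF rs assms(6)] .
  interpret B: based_arrangement \<Phi> \<Phi>p p0
    using rs assms(6) p0(1) by (simp add: based_arrangement_def affine_arrangement_def based_arrangement_axioms_def)
  have u: "u \<in> carrier W" "translate ud \<in> Omega \<Phi>p" "u (fundamental_alcove \<Phi>p) = translate ud ` fundamental_alcove \<Phi>p"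
    using assms(10) by (auto simp: translation_with_def W_def)
  have omega_anti: "B.omega_anti w = translate d" 
    if "w \<in> carrier W" "translate d \<in> Omega \<Phi>p" "w (fundamental_alcove \<Phi>p) = translate d ` fundamental_alcove \<Phi>p" for w d
    using B.omega_anti_eqI[of w "translate d"] B.alc_image[OF that(2) p0(1)] that unfolding W_def p0(2) by simp
  let ?U = "B.translation_conjugates ud"
  have TC: "translation_class W S ?U M"
    unfolding W_def S_def M_def using B.translation_class_W[OF u(2)] u(1) omega_anti[OF u] unfolding W_def by blast
  have CW: "coxeter W S" unfolding W_def S_def by (rule B.coxeter_W)
  interpret K: kl_translation W S \<Gamma>p v \<H> ?U M
    unfolding kl_translation_def kl_setting_def kl_setting_axioms_def
    using TC CW assms(7-9) by (simp add: positive_weights_def)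
  have us: "us l \<in> ?U" if l: "l \<in> {1..n}" for l
  proof -
    have ul: "us l \<in> carrier W" "us l (fundamental_alcove \<Phi>p) = translate (uds l) ` fundamental_alcove \<Phi>p"
      using assms(14) l by auto
    have "uds l \<in> linear_orbit \<Phi>p ud" using assms(11) l by blast
    then obtain \<sigma> where \<sigma>: "\<sigma> \<in> Omega \<Phi>p" "uds l = \<sigma> ud - \<sigma> 0" by (auto simp: linear_orbit_def)
    have "translate (uds l) \<in> Omega \<Phi>p" unfolding \<sigma>(2) by (rule B.translate_orbit_Om[OF u(2) \<sigma>(1)])
    from omega_anti[OF ul(1) this ul(2)] show ?thesis
      using \<sigma> ul(1) unfolding B.translation_conjugates_def W_def by auto
  qed
  let ?x = "z \<otimes>\<^bsub>W\<^esub> us i [^]\<^bsub>W\<^esub> r" and ?w = "z' \<otimes>\<^bsub>W\<^esub> us j [^]\<^bsub>W\<^esub> r"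
  note ui = us[OF assms(18)] and uj = us[OF assms(19)]
  have lx: "K.len ?x = K.len z + r * M" and lw: "K.len ?w = K.len z' + r * M"
    using assms(20,21) K.len_U_pow[OF ui] K.len_U_pow[OF uj] by (simp_all add: dotted_def)
  have dx: "K.deep (us i) r ?x" and dw: "K.deep (us j) r ?w"
    using K.deepI[OF assms(15) ui, of r] K.deepI[OF assms(16) uj, of r] lx lw by simp_all
  have c: "?x \<in> carrier W" "?w \<in> carrier W" using K.deepD dx dw by blast+
  show ?thesis
  proof (rule allI)
    fix k :: nat
    let ?x' = "z \<otimes>\<^bsub>W\<^esub> us i [^]\<^bsub>W\<^esub> (r + k)" and ?w' = "z' \<otimes>\<^bsub>W\<^esub> us j [^]\<^bsub>W\<^esub> (r + k)"
    have x': "K.shift k ?x = ?x'" and w': "K.shift k ?w = ?w'"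
      using K.shift_eq[OF dx assms(17)] K.shift_eq[OF dw assms(17)] assms(15,16) K.U_closed[OF ui] K.U_closed[OF uj]
      by (simp_all add: K.m_assoc K.nat_pow_mult)
    have dotted: "dotted W S z (us i [^]\<^bsub>W\<^esub> (r + k))" "dotted W S z' (us j [^]\<^bsub>W\<^esub> (r + k))"
      using K.straight_pow_iff[OF assms(15) ui lx assms(17)] K.straight_pow_iff[OF assms(16) uj lw assms(17)]
        K.len_U_pow[OF ui] K.len_U_pow[OF uj] by (simp_all add: dotted_def)
    have main: "kl_P W S \<Gamma>p \<H> ?x ?w = kl_P W S \<Gamma>p \<H> ?x' ?w' \<and>
      (\<forall>s\<in>S. bruhat_less W S (s \<otimes>\<^bsub>W\<^esub> ?x) ?x \<and> bruhat_less W S ?x ?w \<and>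
         bruhat_less W S ?w (s \<otimes>\<^bsub>W\<^esub> ?w) \<longrightarrow>
         kl_M W S \<Gamma>p \<H> s ?x ?w = kl_M W S \<Gamma>p \<H> s ?x' ?w')"
    proof (cases "K.len z \<le> K.len z'")
      case True
      define m where "m = K.len z' - K.len z"
      have m: "K.len ?w = K.len ?x + m" using True lx lw by (simp add: m_def)
      have "N = int m" using True by (simp add: N_def m_def)
      then have "int (m * (M + 1)) < int r" using assms(22) by (simp only: of_nat_mult of_nat_add of_nat_1)
      then have rm: "m * (M + 1) < r" by (simp only: of_nat_less_iff)
      \<comment> \<open>The depth of x is lowered to the one that \<open>P_shift\<close> and
        \<open>Mu_shift\<close> expect at distance m.\<close>
      have dx': "K.deep (us i) (r - m) ?x" by (rule K.deep_mono[OF dx]) simp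
      have "kl_M W S \<Gamma>p \<H> s ?x ?w = kl_M W S \<Gamma>p \<H> s ?x' ?w'"
        if s: "s \<in> S" "bruhat_less W S (s \<otimes>\<^bsub>W\<^esub> ?x) ?x" "bruhat_less W S ?w (s \<otimes>\<^bsub>W\<^esub> ?w)" for s
      proof -
        have "K.len (s \<otimes>\<^bsub>W\<^esub> ?x) < K.len ?x" "K.len ?w < K.len (s \<otimes>\<^bsub>W\<^esub> ?w)"
          using K.blessD s(2,3) by blast+
        from K.Mu_shift[OF s(1) dw this(2) m dx' rm this(1), where k = k] show ?thesis unfolding x' w' by simp
      qed
      moreover have "kl_P W S \<Gamma>p \<H> ?x ?w = kl_P W S \<Gamma>p \<H> ?x' ?w'"
        using K.P_shift[OF dw m dx' rm, where k = k] unfolding x' w' by simp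
      ultimately show ?thesis by blast
    next
      case False
      \<comment> \<open>For negative N the first argument is longer than the second, before and
        after the shift: both polynomials vanish, and the Bruhat premise of the second claim
        fails.\<close>
      then have lt: "K.len ?w < K.len ?x" using lx lw by simp
      have lt': "K.len ?w' < K.len ?x'"
        using K.deep_shift'(2)[OF dx assms(17), of k] K.deep_shift'(2)[OF dw assms(17), of k] lt unfolding x' w' by simp
      have c': "?w' \<in> carrier W" using K.deep_shift'(1)[OF dw assms(17), of k] K.deepD unfolding w' by blast
      have "kl_P W S \<Gamma>p \<H> ?x ?w = 0" using K.P_ble[OF c(2), of ?x] K.bleD[of ?x ?w] lt by force
      moreover have "kl_P W S \<Gamma>p \<H> ?x' ?w' = 0" using K.P_ble[OF c', of ?x'] K.bleD[of ?x' ?w'] lt' by force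
      moreover have "\<not> bruhat_less W S ?x ?w" using K.blessD[of ?x ?w] lt by force
      ultimately show ?thesis by simp
    qed
    show "dotted W S z (us i [^]\<^bsub>W\<^esub> (r + k)) \<and> dotted W S z' (us j [^]\<^bsub>W\<^esub> (r + k)) \<and>
      kl_P W S \<Gamma>p \<H> ?x ?w = kl_P W S \<Gamma>p \<H> ?x' ?w' \<and>
      (\<forall>s\<in>S. bruhat_less W S (s \<otimes>\<^bsub>W\<^esub> ?x) ?x \<and> bruhat_less W S ?x ?w \<and>
         bruhat_less W S ?w (s \<otimes>\<^bsub>W\<^esub> ?w) \<longrightarrow>
         kl_M W S \<Gamma>p \<H> s ?x ?w = kl_M W S \<Gamma>p \<H> s ?x' ?w')"
      using dotted main by blast
  qed
qed

end
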